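(* Let $L\colon\mathbb T^d\to\mathbb T^d$ be a hyperbolic automorphism such that the characteristic polynomial of $L$ factors over $\mathbb Q$ (i.e. is reducible over $\mathbb Q$). Then there exist $C^\infty$-diffeomorphisms $\tilde L\colon\mathbb T^d\to\mathbb T^d$ and $\hat L\colon\mathbb T^d\to\mathbb T^d$, arbitrarily $C^1$-close to $L$, with the same periodic data, such that the conjugacy between $\tilde L$ and $\hat L$ is not Lipschitz.
   Context: Diffeomorphisms $f,g$ that are $C^1$-close to the Anosov automorphism $L$ are topologically conjugate, $h\circ f=g\circ h$, by a homeomorphism $h$ which is unique in a neighborhood of the identity; this is the conjugacy between $f$ and $g$. The periodic data of $f$ and $g$ are the same if for every periodic point $x$ of $f$, with $f^p(x)=x$, the linear maps $Df^p(x)$ and $Dg^p(h(x))$ are conjugate. *)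

theory Defs
  imports
    "HOL-Analysis.Analysis"
    "HOL-Computational_Algebra.Polynomial_Factorial"
begin

section \<open>The torus\<close>

definition lattice_equiv :: "real^'n \<Rightarrow> real^'n \<Rightarrow> bool" where
  "lattice_equiv x y \<longleftrightarrow> (\<forall>i. (x - y) $ i \<in> \<int>)"

lemma lattice_equiv_equivp: "equivp lattice_equiv"
proof (rule equivpI)
  show "reflp lattice_equiv"
    by (simp add: reflp_def lattice_equiv_def)
  show "symp lattice_equiv"
    unfolding symp_def lattice_equiv_def by (metis Ints_minus minus_diff_eq vector_minus_component)
  show "transp lattice_equiv"
  proof (rule transpI)
    fix x y z :: "real^'n"
    assume "lattice_equiv x y" "lattice_equiv y z"
    then have "(x - y) $ i + (y - z) $ i \<in> \<int>" for i
      unfolding lattice_equiv_def by (intro Ints_add) auto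
    then show "lattice_equiv x z"
      by (simp add: lattice_equiv_def)
  qed
qed

quotient_type 'n torus = "real^('n::finite)" / lattice_equiv
  morphisms rep_torus torus_proj
  by (rule lattice_equiv_equivp)

lemma torus_proj_eq_iff: "torus_proj x = torus_proj y \<longleftrightarrow> (\<forall>i. (x - y) $ i \<in> \<int>)"
  by (simp add: torus.abs_eq_iff lattice_equiv_def)

lemma torus_proj_surj: "\<exists>x. torus_proj x = p"
  by (metis Quotient_abs_rep[OF Quotient_torus])

definition torus_fiber :: "('n::finite) torus \<Rightarrow> (real^'n) set" where
  "torus_fiber p = {x. torus_proj x = p}"

lemma torus_fiber_nonempty: "torus_fiber p \<noteq> {}"
  using torus_proj_surj by (auto simp: torus_fiber_def)

lemma closed_torus_fiber: "closed (torus_fiber p)"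
proof -
  obtain y where y: "torus_proj y = p"
    using torus_proj_surj by blast
  have eq: "torus_fiber p = (\<Inter>i. (\<lambda>x. (x - y) $ i) -` \<int>)"
    using y by (auto simp: torus_fiber_def torus_proj_eq_iff)
  show ?thesis
    unfolding eq
    by (intro closed_INT ballI continuous_closed_vimage closed_Ints continuous_intros)
qed

lemma infdist_torus_fiber_le:
  fixes x y :: "real^'n"
  assumes "torus_proj x = torus_proj y"
  shows "infdist x (torus_fiber q) \<le> infdist y (torus_fiber q)"
proof -
  have "infdist x (torus_fiber q) \<le> dist y b" if "b \<in> torus_fiber q" for b
  proof -
    have "torus_proj (b + (x - y)) = q"
      using assms that by (auto simp: torus_fiber_def torus_proj_eq_iff)
    then have "infdist x (torus_fiber q) \<le> dist x (b + (x - y))"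
      by (intro infdist_le) (simp add: torus_fiber_def)
    also have "\<dots> = dist y b"
      by (simp add: dist_norm algebra_simps)
    finally show ?thesis .
  qed
  then show ?thesis
    using torus_fiber_nonempty[of q] by (auto simp: infdist_def[of y] intro!: cINF_greatest)
qed

instantiation torus :: (finite) metric_space
begin

text \<open>The flat metric; the quotient map is 1-Lipschitz and a local isometry.\<close>

definition dist_torus :: "'a torus \<Rightarrow> 'a torus \<Rightarrow> real" where
  "dist_torus p q = Inf {dist x y | x y. torus_proj x = p \<and> torus_proj y = q}"

definition uniformity_torus :: "('a torus \<times> 'a torus) filter" where
  "uniformity_torus = (INF e\<in>{0<..}. principal {(x, y). dist x y < e})"

definition open_torus :: "'a torus set \<Rightarrow> bool" where
  "open_torus U = (\<forall>x\<in>U. \<forall>\<^sub>F (x', y) in uniformity. x' = x \<longrightarrow> y \<in> U)"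

lemma dist_torus_proj: "dist (torus_proj x) q = infdist x (torus_fiber q)"
proof (rule antisym)
  have bdd: "bdd_below {dist u y | u y. torus_proj u = torus_proj x \<and> torus_proj y = q}"
    by (rule bdd_belowI[of _ 0]) auto
  show "dist (torus_proj x) q \<le> infdist x (torus_fiber q)"
    unfolding dist_torus_def infdist_notempty[OF torus_fiber_nonempty]
    by (intro cINF_greatest torus_fiber_nonempty cInf_lower[OF _ bdd]) (auto simp: torus_fiber_def)
  show "infdist x (torus_fiber q) \<le> dist (torus_proj x) q"
    unfolding dist_torus_def
  proof (rule cInf_greatest)
    show "{dist u y | u y. torus_proj u = torus_proj x \<and> torus_proj y = q} \<noteq> {}"
      using torus_proj_surj[of q] by auto
    fix r assume "r \<in> {dist u y | u y. torus_proj u = torus_proj x \<and> torus_proj y = q}"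
    then obtain u y where uy: "r = dist u y" "torus_proj u = torus_proj x" "torus_proj y = q"
      by blast
    have "infdist x (torus_fiber q) \<le> infdist u (torus_fiber q)"
      using uy(2) by (intro infdist_torus_fiber_le) simp
    also have "\<dots> \<le> r"
      using uy by (auto intro!: infdist_le simp: torus_fiber_def)
    finally show "infdist x (torus_fiber q) \<le> r" .
  qed
qed

instance
proof
  fix p q r :: "'a torus"
  obtain x y where xy: "torus_proj x = p" "torus_proj y = q"
    using torus_proj_surj by metis
  show "dist p q = 0 \<longleftrightarrow> p = q"
    using in_closed_iff_infdist_zero[OF closed_torus_fiber torus_fiber_nonempty, of x q]
    by (auto simp: dist_torus_proj torus_fiber_def simp flip: xy(1))
  have sym: "dist q r = dist r q"
    unfolding dist_torus_def by (rule arg_cong[where f = Inf]) (metis dist_commute)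
  have "dist p q - dist r q \<le> dist x z" if "z \<in> torus_fiber r" for z
    using that infdist_triangle[of x "torus_fiber q" z]
    by (auto simp: torus_fiber_def dist_torus_proj simp flip: xy(1))
  then have "dist p q - dist r q \<le> infdist x (torus_fiber r)"
    unfolding infdist_notempty[OF torus_fiber_nonempty]
    by (intro cINF_greatest torus_fiber_nonempty)
  then show "dist p q \<le> dist p r + dist q r"
    by (simp add: sym dist_torus_proj flip: xy(1))
qed (simp_all add: uniformity_torus_def open_torus_def)

end

lemma dist_torus_proj_le: "dist (torus_proj x) (torus_proj y) \<le> dist x y"
  by (auto simp: dist_torus_proj torus_fiber_def intro: infdist_le)

lemma continuous_on_torus_proj: "continuous_on S torus_proj"
  by (rule lipschitz_on_continuous_on[where L = 1], rule lipschitz_onI)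
     (auto simp: dist_torus_proj_le)


section \<open>Smooth maps of the torus\<close>

text \<open>Every continuous self-map of the torus has a continuous lift to the universal cover, and
  two such lifts differ by a constant lattice vector; hence smoothness and derivatives can be read
  off from any continuous lift. The tangent spaces are identified with \<open>real^'n\<close> by
  translations.\<close>

definition torus_lift :: "(real^'n \<Rightarrow> real^'n) \<Rightarrow> ('n::finite torus \<Rightarrow> 'n torus) \<Rightarrow> bool" where
  "torus_lift F f \<longleftrightarrow> continuous_on UNIV F \<and> (\<forall>x. f (torus_proj x) = torus_proj (F x))"

fun k_smooth :: "nat \<Rightarrow> ('a::real_normed_vector \<Rightarrow> 'b::real_normed_vector) \<Rightarrow> bool" where
  "k_smooth 0 F \<longleftrightarrow> continuous_on UNIV F"
| "k_smooth (Suc k) F \<longleftrightarrow>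
     (\<forall>x. F differentiable (at x)) \<and> (\<forall>v. k_smooth k (\<lambda>x. frechet_derivative F (at x) v))"

definition torus_smooth :: "('n::finite torus \<Rightarrow> 'n torus) \<Rightarrow> bool" where
  "torus_smooth f \<longleftrightarrow> (\<exists>F. torus_lift F f \<and> (\<forall>k. k_smooth k F))"

definition torus_diffeo :: "('n::finite torus \<Rightarrow> 'n torus) \<Rightarrow> bool" where
  "torus_diffeo f \<longleftrightarrow> bij f \<and> torus_smooth f \<and> torus_smooth (inv f)"

definition torus_deriv :: "('n::finite torus \<Rightarrow> 'n torus) \<Rightarrow> 'n torus \<Rightarrow> real^'n \<Rightarrow> real^'n" where
  "torus_deriv f p =
     (THE D. \<exists>F x. torus_lift F f \<and> torus_proj x = p \<and> (F has_derivative D) (at x))"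

lemma torus_lift_unique:
  fixes F G :: "real^'n \<Rightarrow> real^'n"
  assumes F: "torus_lift F f" and G: "torus_lift G f" and m: "torus_proj m = torus_proj 0"
  shows "\<exists>c. \<forall>x. G (x + m) = F x + c"
proof -
  let ?d = "\<lambda>i x. (G (x + m) - F x) $ i"
  have int: "?d i x \<in> \<int>" for i x
  proof -
    have "torus_proj (x + m) = torus_proj x"
      using m by (simp add: torus_proj_eq_iff)
    then have "torus_proj (G (x + m)) = torus_proj (F x)"
      using F G unfolding torus_lift_def by metis
    then show ?thesis
      by (simp add: torus_proj_eq_iff)
  qed
  have cont: "continuous_on UNIV (?d i)" for i
    using F G unfolding torus_lift_def
    by (auto intro!: continuous_intros intro: continuous_on_compose2[where g = G])
  have "?d i constant_on UNIV" for i
  proof (rule continuous_discrete_range_constant[OF _ cont])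
    fix x :: "real^'n"
    have "1 \<le> norm (?d i y - ?d i x)" if ne: "?d i y \<noteq> ?d i x" for y
    proof -
      have "?d i y - ?d i x \<in> \<int>" "?d i y - ?d i x \<noteq> 0"
        using Ints_diff[OF int int] ne by auto
      then show ?thesis
        using Ints_nonzero_abs_ge1 by (metis real_norm_def)
    qed
    then show "\<exists>e>0. \<forall>y. y \<in> UNIV \<and> ?d i y \<noteq> ?d i x \<longrightarrow> e \<le> norm (?d i y - ?d i x)"
      by (intro exI[of _ 1]) auto
  qed (rule connected_UNIV)
  then have "\<exists>c. \<forall>x. ?d i x = c" for i
    by (simp add: constant_on_def)
  then obtain c where "\<And>i x. ?d i x = c i"
    by metis
  then have "G (x + m) = F x + (\<chi> i. c i)" for x
    by (simp add: vec_eq_iff algebra_simps) (metis add_diff_cancel_left' diff_add_cancel)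
  then show ?thesis
    by blast
qed

lemma torus_deriv_eq:
  assumes F: "torus_lift F f" and D: "(F has_derivative D) (at x)"
  shows "torus_deriv f (torus_proj x) = D"
  unfolding torus_deriv_def
proof (rule the_equality)
  show "\<exists>F' x'. torus_lift F' f \<and> torus_proj x' = torus_proj x \<and> (F' has_derivative D) (at x')"
    using F D by blast
  fix D' assume "\<exists>F' x'. torus_lift F' f \<and> torus_proj x' = torus_proj x \<and> (F' has_derivative D') (at x')"
  then obtain G y where G: "torus_lift G f" "torus_proj y = torus_proj x" "(G has_derivative D') (at y)"
    by blast
  have "torus_proj (y - x) = torus_proj 0"
    using G(2) by (simp add: torus_proj_eq_iff)
  then obtain c where c: "\<And>z. G (z + (y - x)) = F z + c"
    using torus_lift_unique[OF F G(1)] by blast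
  have "(G has_derivative D') (at (x + (y - x)))"
    using G(3) by simp
  then have "((\<lambda>z. G (z + (y - x))) has_derivative D') (at x)"
    by (rule has_derivative_compose[where f = "\<lambda>z. z + (y - x)" and f' = "\<lambda>z. z", rotated])
       (auto intro!: derivative_eq_intros)
  then have "((\<lambda>z. F z + c) has_derivative D') (at x)"
    by (simp only: c)
  from has_derivative_diff[OF this has_derivative_const[of c]]
  have "(F has_derivative D') (at x)"
    by simp
  then show "D' = D"
    using D by (rule has_derivative_unique)
qed

definition torus_C1_close ::
  "real \<Rightarrow> ('n::finite torus \<Rightarrow> 'n torus) \<Rightarrow> ('n torus \<Rightarrow> 'n torus) \<Rightarrow> bool" where
  "torus_C1_close \<epsilon> f g \<longleftrightarrow>
     (\<forall>p. dist (f p) (g p) < \<epsilon> \<and> onorm (\<lambda>v. torus_deriv f p v - torus_deriv g p v) < \<epsilon>)"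


section \<open>Hyperbolic toral automorphisms\<close>

lift_definition toral_endo :: "int^'n^'n \<Rightarrow> 'n::finite torus \<Rightarrow> 'n torus" is
  "\<lambda>A x. map_matrix real_of_int A *v x"
proof -
  fix A :: "int^'n^'n" and x y :: "real^'n"
  assume "lattice_equiv x y"
  then have "(map_matrix real_of_int A *v (x - y)) $ i \<in> \<int>" for i
    by (auto simp: lattice_equiv_def matrix_vector_mult_def)
  then show "lattice_equiv (map_matrix real_of_int A *v x) (map_matrix real_of_int A *v y)"
    by (simp add: lattice_equiv_def matrix_vector_mult_diff_distrib)
qed

lemma torus_lift_toral_endo: "torus_lift ((*v) (map_matrix real_of_int A)) (toral_endo A)"
  unfolding torus_lift_def by (simp add: toral_endo.abs_eq matrix_vector_mult_linear_continuous_on)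

lemma torus_deriv_toral_endo: "torus_deriv (toral_endo A) p = (*v) (map_matrix real_of_int A)"
proof -
  obtain x where "torus_proj x = p"
    using torus_proj_surj by blast
  moreover have "((*v) (map_matrix real_of_int A) has_derivative (*v) (map_matrix real_of_int A)) (at x)"
    by (intro bounded_linear_imp_has_derivative matrix_vector_mul_bounded_linear)
  ultimately show ?thesis
    using torus_deriv_eq[OF torus_lift_toral_endo] by metis
qed

text \<open>Invertibility is over the integers, i.e. \<open>A \<in> GL(n, \<int>)\<close>.\<close>

definition hyperbolic_automorphism :: "int^'n^'n \<Rightarrow> bool" where
  "hyperbolic_automorphism A \<longleftrightarrow> invertible A \<and>
     (\<forall>(z::complex) v. v \<noteq> 0 \<and> map_matrix of_int A *v v = z *s v \<longrightarrow> cmod z \<noteq> 1)"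

definition charpoly :: "'a::comm_ring_1^'n^'n \<Rightarrow> 'a poly" where
  "charpoly A = det (mat [:0, 1:] - map_matrix (\<lambda>a. [:a:]) A)"


section \<open>Conjugacies and periodic data\<close>

definition torus_conjugacy ::
  "('n::finite torus \<Rightarrow> 'n torus) \<Rightarrow> ('n torus \<Rightarrow> 'n torus) \<Rightarrow> ('n torus \<Rightarrow> 'n torus) \<Rightarrow> bool" where
  "torus_conjugacy f g h \<longleftrightarrow> (\<exists>k. homeomorphism UNIV UNIV h k) \<and> h \<circ> f = g \<circ> h"

text \<open>\<open>h\<close> is the only conjugacy in the \<open>C\<^sup>0\<close>-ball of radius \<open>\<eta>\<close> around the identity.\<close>

definition the_conjugacy_near_id ::
  "real \<Rightarrow> ('n::finite torus \<Rightarrow> 'n torus) \<Rightarrow> ('n torus \<Rightarrow> 'n torus) \<Rightarrow> ('n torus \<Rightarrow> 'n torus) \<Rightarrow> bool" where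
  "the_conjugacy_near_id \<eta> f g h \<longleftrightarrow>
     torus_conjugacy f g h \<and> (\<forall>p. dist (h p) p < \<eta>) \<and>
     (\<forall>h'. torus_conjugacy f g h' \<and> (\<forall>p. dist (h' p) p < \<eta>) \<longrightarrow> h' = h)"

definition conjugate_linear_maps :: "(real^'n \<Rightarrow> real^'n) \<Rightarrow> (real^'n \<Rightarrow> real^'n) \<Rightarrow> bool" where
  "conjugate_linear_maps S T \<longleftrightarrow> (\<exists>P. linear P \<and> bij P \<and> P \<circ> S = T \<circ> P)"

definition same_periodic_data ::
  "('n::finite torus \<Rightarrow> 'n torus) \<Rightarrow> ('n torus \<Rightarrow> 'n torus) \<Rightarrow> ('n torus \<Rightarrow> 'n torus) \<Rightarrow> bool" where
  "same_periodic_data f g h \<longleftrightarrow>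
     (\<forall>x p. p > 0 \<and> (f ^^ p) x = x \<longrightarrow>
        conjugate_linear_maps (torus_deriv (f ^^ p) x) (torus_deriv (g ^^ p) (h x)))"

end

theory Submission
  imports
    Defs
    "HOL-Computational_Algebra.Fundamental_Theorem_Algebra"
    "HOL-Computational_Algebra.Field_as_Ring"
begin

text \<open>
  Write \<open>L\<close> for the linear map of \<open>A\<close>. Both diffeomorphisms are shears, \<open>f z = L z + \<delta> sin (2\<pi> m\<cdot>z) a\<close> and the same
  with \<open>b\<close> for \<open>g\<close>, where \<open>m\<close> is an integer covector whose iterates \<open>m L\<^sup>k\<close> annihilate \<open>a\<close> and \<open>b\<close>. Hence \<open>m\<close> sees
  only the linear map along orbits of \<open>f\<close> and \<open>g\<close>. If \<open>b - a = 2 Re v\<close> for an eigenvector \<open>v\<close> with eigenvalue \<open>\<alpha>\<close>,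
  \<open>\<bar>\<alpha>\<bar> > 1\<close>, then \<open>h z = z - 2 \<delta> Re (\<Psi> z v)\<close> conjugates \<open>f\<close> to \<open>g\<close>, where \<open>\<Psi> z = \<Sum>k. \<alpha>\<^bsup>-k-1\<^esup> sin (2\<pi> m L\<^sup>k z)\<close>
  (\<open>conjugacy_equation\<close>).

  This \<open>\<Psi>\<close> is a Weierstrass function. If it were Lipschitz, Bessel's inequality for its difference quotients would
  make \<open>\<alpha>\<^bsup>-k\<^esup> m L\<^sup>k\<close> square summable (\<open>lacunary_lipschitz_coefficients\<close>). That is impossible if the orbit of \<open>m\<close> has a
  component along an eigenvalue \<open>\<mu>\<close> with \<open>\<bar>\<mu>\<bar> \<ge> \<bar>\<alpha>\<bar>\<close>. So let \<open>\<mu>\<close> be an eigenvalue of largest modulus and \<open>p\<close> its minimal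
  polynomial. As the characteristic polynomial is reducible, the degree of \<open>p\<close> is less than the dimension, and an
  integer covector \<open>m \<noteq> 0\<close> with \<open>m p(L) = 0\<close> spans under \<open>L\<close> a proper invariant subspace. Irreducibility of \<open>p\<close> makes \<open>m\<close>
  see \<open>\<mu>\<close> (\<open>orbit_growth\<close>). The common kernel of the iterates of \<open>m\<close> contains a nonzero integer vector, and therefore
  an unstable eigenvector \<open>v\<close>: otherwise \<open>L\<^sup>k\<close> would contract that integer vector to 0.

  It remains to choose \<open>m\<close>, \<open>a\<close>, \<open>b\<close> so that the derivatives of \<open>f\<^sup>n\<close> and \<open>g\<^sup>n\<close> are conjugate along corresponding
  orbits (\<open>resonant_shears_exist\<close>). A linear map \<open>P\<close> with \<open>P L = L P\<close>, \<open>m P = m\<close>, \<open>P a = b\<close> does this at once. If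
  \<open>p(L)\<^sup>2 \<noteq> 0\<close>, take \<open>P = 1 + s p(L)\<close>. If \<open>p(L) = 0\<close>, then \<open>L\<close> is semisimple and \<open>P\<close> is 1 plus the projection to the real
  span of \<open>v\<close> and its conjugate. If \<open>p(L) \<noteq> 0 = p(L)\<^sup>2\<close>, take \<open>a = 0\<close>, with \<open>m\<close> and \<open>v\<close> in the images of \<open>p(L)\<close>: the Jordan
  blocks of \<open>L\<^sup>n\<close> survive a small shear, by a conjugating map that depends on the orbit.

  For uniqueness (\<open>shear_conjugacy_unique\<close>) let \<open>d\<close> be the difference of two lifted conjugacies along a two-sided
  orbit. It is bounded, and \<open>m\<cdot>d\<close> satisfies a linear recurrence without characteristic roots on the unit circle, so
  \<open>m\<cdot>d = 0\<close>; then \<open>d\<close> is a bounded orbit of \<open>L\<close> and vanishes by hyperbolicity.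
\<close>

section \<open>Polynomials acting through an endomorphism\<close>

text \<open>The value of a polynomial at an endomorphism, applied to a vector. Scalar multiplication is a
  parameter so that one definition serves integer, real and complex vectors, between which the
  argument moves back and forth.\<close>

definition poly_act :: "('a::comm_ring_1 \<Rightarrow> 'b \<Rightarrow> 'b) \<Rightarrow> ('b \<Rightarrow> 'b) \<Rightarrow> 'a poly \<Rightarrow> 'b::ab_group_add \<Rightarrow> 'b" where
  "poly_act sc T q x = fold_coeffs (\<lambda>a y. sc a x + T y) q 0"

locale module_endo = module sc
  for sc :: "'a::comm_ring_1 \<Rightarrow> 'b::ab_group_add \<Rightarrow> 'b" (infixr "*\<^sub>m" 75) +
  fixes T :: "'b \<Rightarrow> 'b"
  assumes T_add: "T (x + y) = T x + T y"
    and T_scale: "T (a *\<^sub>m x) = a *\<^sub>m T x"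
begin

abbreviation act :: "'a poly \<Rightarrow> 'b \<Rightarrow> 'b" where
  "act \<equiv> poly_act sc T"

lemma T_0 [simp]: "T 0 = 0"
  using T_scale[of 0 0] by simp

lemma act_0 [simp]: "act 0 x = 0"
  by (simp add: poly_act_def)

lemma act_pCons: "act (pCons a q) x = a *\<^sub>m x + T (act q x)"
  by (cases "pCons a q = 0") (auto simp: poly_act_def)

lemma act_const [simp]: "act [:a:] x = a *\<^sub>m x"
  by (simp add: act_pCons)

lemma act_1 [simp]: "act 1 x = x"
  by (simp add: one_pCons)

lemma act_linear_factor: "act [:-a, 1:] x = T x - a *\<^sub>m x"
  by (simp add: act_pCons)

lemma T_minus: "T (x - y) = T x - T y"
  by (metis T_add add_diff_cancel eq_diff_eq)

lemma T_power_add: "(T ^^ k) (x + y) = (T ^^ k) x + (T ^^ k) y"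
  by (induction k) (simp_all add: T_add)

lemma T_power_scale: "(T ^^ k) (a *\<^sub>m x) = a *\<^sub>m (T ^^ k) x"
  by (induction k) (simp_all add: T_scale)

lemma T_power_0 [simp]: "(T ^^ k) 0 = 0"
  by (induction k) simp_all

lemma act_add_right: "act q (x + y) = act q x + act q y"
  by (induction q) (simp_all add: act_pCons T_add scale_right_distrib algebra_simps)

lemma act_scale_right: "act q (a *\<^sub>m x) = a *\<^sub>m act q x"
  by (induction q) (simp_all add: act_pCons T_scale scale_right_distrib algebra_simps)

lemma act_0_right [simp]: "act q 0 = 0"
  using act_scale_right[of q 0 0] by simp

lemma act_sum_right: "act q (sum f S) = (\<Sum>i\<in>S. act q (f i))"
  by (induction S rule: infinite_finite_induct) (simp_all add: act_add_right)

lemma act_T: "act q (T x) = T (act q x)"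
  by (induction q) (simp_all add: act_pCons T_add T_scale)

lemma act_T_power: "act q ((T ^^ k) x) = (T ^^ k) (act q x)"
  by (induction k) (simp_all add: act_T)

lemma act_add_left: "act (p + q) x = act p x + act q x"
  by (induction p q rule: poly_induct2) (simp_all add: act_pCons T_add scale_left_distrib algebra_simps)

lemma act_smult_left: "act (smult a q) x = a *\<^sub>m act q x"
  by (induction q) (simp_all add: act_pCons T_scale scale_right_distrib)

lemma act_mult: "act (p * q) x = act p (act q x)"
  by (induction p) (simp_all add: act_pCons act_add_left act_smult_left)

lemma act_commute: "act p (act q x) = act q (act p x)"
  by (metis act_mult mult.commute)

lemma act_sum_left: "act (sum f S) x = (\<Sum>i\<in>S. act (f i) x)"
  by (induction S rule: infinite_finite_induct) (simp_all add: act_add_left)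

lemma act_monom: "act (monom a k) x = a *\<^sub>m (T ^^ k) x"
  by (induction k) (simp_all add: monom_0 monom_Suc act_pCons T_scale)

lemma act_eigen:
  assumes "T x = a *\<^sub>m x"
  shows "act q x = poly q a *\<^sub>m x"
  by (induction q) (simp_all add: act_pCons T_scale assms scale_left_distrib mult.commute)

lemma T_power_eigen:
  assumes "T x = a *\<^sub>m x"
  shows "(T ^^ k) x = a ^ k *\<^sub>m x"
  by (induction k) (simp_all add: T_scale assms mult.commute)

lemma act_dvd_eq_0:
  assumes "p dvd q" "act p x = 0"
  shows "act q x = 0"
  using assms by (auto simp: act_mult act_commute dvd_def)

end

interpretation mat_act: module_endo "(*s)" "(*v) A" for A :: "'a::comm_ring_1^'n^'n"
  by unfold_locales
     (simp_all add: vec_eq_iff matrix_vector_mult_def algebra_simps sum.distrib sum_distrib_left)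

abbreviation mact :: "'a::comm_ring_1^'n^'n \<Rightarrow> 'a poly \<Rightarrow> 'a^'n \<Rightarrow> 'a^'n" where
  "mact A \<equiv> poly_act (*s) ((*v) A)"

lemma nat_family_dependent:
  fixes f :: "nat \<Rightarrow> 'a::euclidean_space"
  shows "\<exists>c. (\<exists>k\<le>DIM('a). c k \<noteq> 0) \<and> (\<Sum>k\<le>DIM('a). c k *\<^sub>R f k) = 0"
proof (cases "inj_on f {..DIM('a)}")
  case True
  let ?S = "f ` {..DIM('a)}"
  have "card ?S > DIM('a)"
    using card_image[OF True] by simp
  then have "dependent ?S"
    using independent_bound[of ?S] by fastforce
  then obtain u v where u: "v \<in> ?S" "u v \<noteq> 0" "(\<Sum>v\<in>?S. u v *\<^sub>R v) = 0"
    using dependent_finite[of ?S] by auto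
  have "(\<Sum>k\<le>DIM('a). u (f k) *\<^sub>R f k) = 0"
    using u(3) sum.reindex[OF True, of "\<lambda>v. u v *\<^sub>R v"] by simp
  then show ?thesis
    using u(1,2) by (intro exI[of _ "\<lambda>k. u (f k)"]) auto
next
  case False
  then obtain i j where ij: "i \<le> DIM('a)" "j \<le> DIM('a)" "i \<noteq> j" "f i = f j"
    by (auto simp: inj_on_def)
  let ?c = "\<lambda>k. if k = i then 1 else if k = j then - 1 else (0::real)"
  have "(\<Sum>k\<le>DIM('a). ?c k *\<^sub>R f k) = (\<Sum>k\<in>{i, j}. ?c k *\<^sub>R f k)"
    using ij by (intro sum.mono_neutral_right) auto
  also have "\<dots> = 0"
    using ij by simp
  finally show ?thesis
    using ij by (intro exI[of _ ?c]) auto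
qed

text \<open>Real dependence of the iterates is enough: complex space has finite real dimension.\<close>

lemma vector_annihilator_exists:
  fixes B :: "complex^'n^'n"
  shows "\<exists>q. q \<noteq> 0 \<and> mact B q x = 0"
proof -
  let ?d = "DIM(complex^'n)"
  obtain c k where c: "k \<le> ?d" "c k \<noteq> 0" "(\<Sum>k\<le>?d. c k *\<^sub>R (((*v) B) ^^ k) x) = 0"
    using nat_family_dependent[of "\<lambda>k. (((*v) B) ^^ k) x"] by blast
  let ?q = "\<Sum>k\<le>?d. monom (complex_of_real (c k)) k"
  have "coeff ?q k = c k"
    using c(1) by (simp add: coeff_sum)
  then have "?q \<noteq> 0"
    using c(2) by (metis coeff_0 of_real_eq_0_iff)
  moreover have "a *\<^sub>R y = complex_of_real a *s y" for a and y :: "complex^'n"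
    by (simp add: vec_eq_iff) (simp add: scaleR_conv_of_real)
  then have "mact B ?q x = 0"
    using c(3) by (simp add: mat_act.act_sum_left mat_act.act_monom)
  ultimately show ?thesis
    by blast
qed

text \<open>For an annihilator of minimal degree, cancelling the factor of a root \<open>\<alpha>\<close> leaves a polynomial
  that does not annihilate \<open>x\<close>; its value at \<open>x\<close> is an eigenvector. The eigenvector thus lies in the
  cyclic subspace generated by \<open>x\<close>, which is what later keeps it inside a prescribed invariant
  subspace.\<close>

lemma annihilator_of_vector_roots:
  fixes B :: "complex^'n^'n"
  shows "\<exists>q. q \<noteq> 0 \<and> mact B q x = 0 \<and>
    (\<forall>\<alpha>. poly q \<alpha> = 0 \<longrightarrow> (\<exists>r. mact B r x \<noteq> 0 \<and> B *v mact B r x = \<alpha> *s mact B r x))"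
proof -
  let ?P = "\<lambda>q. q \<noteq> 0 \<and> mact B q x = 0"
  obtain q where q: "?P q" and min: "\<And>r. ?P r \<Longrightarrow> degree q \<le> degree r"
    using ex_has_least_nat[of ?P _ degree] vector_annihilator_exists[of B x] by metis
  have "\<exists>r. mact B r x \<noteq> 0 \<and> B *v mact B r x = \<alpha> *s mact B r x" if "poly q \<alpha> = 0" for \<alpha>
  proof -
    obtain r where r: "q = [:-\<alpha>, 1:] * r"
      using \<open>poly q \<alpha> = 0\<close> unfolding poly_eq_0_iff_dvd dvd_def by blast
    have "r \<noteq> 0"
      using r q by auto
    then have "degree q = Suc (degree r)"
      unfolding r by (subst degree_mult_eq) auto
    then have "mact B r x \<noteq> 0"
      using min[of r] \<open>r \<noteq> 0\<close> by auto
    moreover have "B *v mact B r x - \<alpha> *s mact B r x = 0"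
      using q unfolding r mat_act.act_mult mat_act.act_linear_factor by simp
    ultimately show ?thesis
      by auto
  qed
  then show ?thesis
    using q by blast
qed

lemma vec_expand_axis: "x = (\<Sum>i\<in>UNIV. x $ i *s axis i (1::'a::comm_ring_1))"
  by (simp add: vec_eq_iff axis_def sum.If_cases if_distrib[of "\<lambda>z. _ * z"] cong: if_cong)

text \<open>This takes the place of the Cayley-Hamilton theorem: all that matters about the annihilating
  polynomial is that its roots are eigenvalues.\<close>

lemma annihilator_roots_eigenvalues:
  fixes B :: "complex^'n^'n"
  shows "\<exists>Q. Q \<noteq> 0 \<and> (\<forall>x. mact B Q x = 0) \<and>
    (\<forall>\<alpha>. poly Q \<alpha> = 0 \<longrightarrow> (\<exists>v. v \<noteq> 0 \<and> B *v v = \<alpha> *s v))"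
proof -
  obtain q where q: "\<And>x. q x \<noteq> 0" "\<And>x. mact B (q x) x = 0"
    and root: "\<And>x \<alpha>. poly (q x) \<alpha> = 0 \<Longrightarrow> \<exists>v. v \<noteq> 0 \<and> B *v v = \<alpha> *s v"
    using annihilator_of_vector_roots[of B] by metis
  define Q where "Q = (\<Prod>i\<in>UNIV. q (axis i 1))"
  have "mact B Q x = 0" for x
  proof -
    have "mact B Q (axis i 1) = 0" for i
      by (rule mat_act.act_dvd_eq_0[OF _ q(2)]) (simp add: Q_def dvd_prodI[of _ _ "\<lambda>i. q (axis i 1)"])
    then show ?thesis
      by (subst vec_expand_axis[of x]) (simp add: mat_act.act_sum_right mat_act.act_scale_right)
  qed
  moreover have "Q \<noteq> 0"
    using q(1) by (simp add: Q_def)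
  moreover have "\<exists>v. v \<noteq> 0 \<and> B *v v = \<alpha> *s v" if "poly Q \<alpha> = 0" for \<alpha>
    using that root by (auto simp: Q_def poly_prod)
  ultimately show ?thesis
    by blast
qed

lemma tendsto_0_of_recurrence:
  fixes x :: "nat \<Rightarrow> complex"
  assumes a: "cmod \<alpha> < 1" and y: "(\<lambda>k. x (Suc k) - \<alpha> * x k) \<longlonglongrightarrow> 0"
  shows "x \<longlonglongrightarrow> 0"
proof (rule LIMSEQ_I)
  fix e :: real assume "e > 0"
  define h where "h = e / 2"
  have e: "h > 0" "e = h + h"
    using \<open>e > 0\<close> by (simp_all add: h_def)
  let ?d = "h * (1 - cmod \<alpha>)"
  have "?d > 0"
    using a e by simp
  then obtain N where N: "\<And>k. k \<ge> N \<Longrightarrow> cmod (x (Suc k) - \<alpha> * x k) < ?d"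
    using LIMSEQ_D[OF y] by fastforce
  have bound: "cmod (x (N + j)) \<le> cmod \<alpha> ^ j * cmod (x N) + h" for j
  proof (induction j)
    case (Suc j)
    have "cmod (x (N + Suc j)) \<le> cmod (x (Suc (N + j)) - \<alpha> * x (N + j)) + cmod \<alpha> * cmod (x (N + j))"
      using norm_triangle_sub[of "x (Suc (N + j))" "\<alpha> * x (N + j)"] by (simp add: norm_mult)
    also have "\<dots> \<le> ?d + cmod \<alpha> * (cmod \<alpha> ^ j * cmod (x N) + h)"
      using N[of "N + j"] Suc by (intro add_mono mult_left_mono) auto
    also have "\<dots> = cmod \<alpha> ^ Suc j * cmod (x N) + h"
      by (simp add: algebra_simps)
    finally show ?case .
  qed (use e in auto)
  have "(\<lambda>j. cmod \<alpha> ^ j * cmod (x N)) \<longlonglongrightarrow> 0"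
    using a by (intro tendsto_mult_left_zero LIMSEQ_realpow_zero) auto
  then obtain M where M: "\<And>j. j \<ge> M \<Longrightarrow> cmod \<alpha> ^ j * cmod (x N) < h"
    using LIMSEQ_D[of _ 0 h] e(1) by fastforce
  have "cmod (x k) < e" if "k \<ge> N + M" for k
  proof -
    have "M \<le> k - N" "N + (k - N) = k"
      using that by auto
    then show ?thesis
      using bound[of "k - N"] M[of "k - N"] e(2) by simp
  qed
  then show "\<exists>no. \<forall>n\<ge>no. norm (x n - 0) < e"
    by auto
qed

section \<open>Integer vectors under a hyperbolic automorphism\<close>

definition int_vec :: "int^'n \<Rightarrow> 'a::ring_1^'n" where
  "int_vec x = (\<chi> i. of_int (x $ i))"

lemma int_vec_nth [simp]: "int_vec x $ i = of_int (x $ i)"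
  by (simp add: int_vec_def)

lemma int_vec_eq_0_iff [simp]: "int_vec x = (0::'a::ring_char_0^'n) \<longleftrightarrow> x = 0"
  by (simp add: vec_eq_iff)

lemma int_vec_0 [simp]: "int_vec 0 = 0"
  by (simp add: vec_eq_iff)

lemma int_vec_add: "int_vec (x + y) = int_vec x + int_vec y"
  by (simp add: vec_eq_iff)

lemma int_vec_scale: "int_vec (a *s x) = of_int a *s int_vec x"
  by (simp add: vec_eq_iff)

lemma int_vec_mult: "map_matrix of_int A *v int_vec x = int_vec (A *v x)"
  by (simp add: vec_eq_iff matrix_vector_mult_def)

lemma int_vec_mult_power:
  fixes A :: "int^'n^'n"
  shows "((*v) (map_matrix of_int A) ^^ k) (int_vec x) = int_vec (((*v) A ^^ k) x)"
  by (induction k) (simp_all add: int_vec_mult)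

lemma int_vec_mact:
  "mact (map_matrix of_int A) (map_poly of_int q) (int_vec x) = int_vec (mact A q x)"
  by (induction q)
     (simp_all add: map_poly_pCons mat_act.act_pCons int_vec_add int_vec_scale flip: int_vec_mult)

lemma invertible_mult_eq_0D:
  assumes "invertible A" "A *v x = (0::'a::comm_ring_1^'n)"
  shows "x = 0"
proof -
  obtain B where "B ** A = mat 1"
    using assms(1) by (auto simp: invertible_def)
  then have "x = B *v (A *v x)"
    by (simp add: matrix_vector_mul_assoc)
  then show ?thesis
    using assms(2) by simp
qed

lemma invertible_power_eq_0D:
  fixes A :: "'a::comm_ring_1^'n^'n"
  assumes "invertible A" "((*v) A ^^ k) x = 0"
  shows "x = 0"
  using assms(2) by (induction k) (auto dest: invertible_mult_eq_0D[OF assms(1)])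

text \<open>Induction on the degree: splitting off one root \<open>\<alpha>\<close> replaces \<open>y\<close> by \<open>B y - \<alpha> y\<close>, and a
  sequence whose \<open>\<alpha>\<close>-difference tends to 0 with \<open>\<bar>\<alpha>\<bar> < 1\<close> tends to 0 itself.\<close>

lemma powers_tendsto_0:
  fixes B :: "complex^'n^'n"
  assumes "q \<noteq> 0" "mact B q y = 0" "\<And>\<alpha>. poly q \<alpha> = 0 \<Longrightarrow> cmod \<alpha> < 1"
  shows "(\<lambda>k. ((*v) B ^^ k) y $ i) \<longlonglongrightarrow> 0"
  using assms
proof (induction "degree q" arbitrary: q y)
  case 0
  then have "q = [:coeff q 0:]" "coeff q 0 \<noteq> 0"
    by (metis degree_eq_zeroE coeff_pCons_0, metis degree_eq_zeroE coeff_pCons_0 pCons_0_0)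
  then have "y = 0"
    using 0(3) by (metis mat_act.act_const vector_mul_eq_0)
  then show ?case
    by simp
next
  case (Suc d)
  then obtain \<alpha> where \<alpha>: "poly q \<alpha> = 0"
    using fundamental_theorem_of_algebra_alt[of q] by (metis degree_0 degree_pCons_0 nat.distinct(1) pCons_0_0)
  then obtain r where r: "q = [:-\<alpha>, 1:] * r"
    unfolding poly_eq_0_iff_dvd dvd_def by blast
  have "r \<noteq> 0"
    using r Suc by auto
  then have deg: "degree q = Suc (degree r)"
    unfolding r by (subst degree_mult_eq) auto
  have "(\<lambda>k. ((*v) B ^^ k) (B *v y - \<alpha> *s y) $ i) \<longlonglongrightarrow> 0"
  proof (rule Suc(1))
    show "mact B r (B *v y - \<alpha> *s y) = 0"
      using Suc.prems(2) unfolding r mat_act.act_mult mat_act.act_linear_factor[symmetric]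
      by (simp add: mat_act.act_commute)
    show "\<And>\<beta>. poly r \<beta> = 0 \<Longrightarrow> cmod \<beta> < 1"
      using Suc.prems(3) by (simp add: r)
  qed (use deg Suc(2) \<open>r \<noteq> 0\<close> in auto)
  moreover have "((*v) B ^^ k) (B *v y - \<alpha> *s y) = ((*v) B ^^ Suc k) y - \<alpha> *s ((*v) B ^^ k) y" for k
    using mat_act.T_power_add[of k B "B *v y - \<alpha> *s y" "\<alpha> *s y"]
    by (simp add: mat_act.T_power_scale funpow_swap1)
  ultimately have "(\<lambda>k. ((*v) B ^^ Suc k) y $ i - \<alpha> * ((*v) B ^^ k) y $ i) \<longlonglongrightarrow> 0"
    by simp
  with Suc.prems(3)[OF \<alpha>] show ?case
    by (rule tendsto_0_of_recurrence)
qed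

text \<open>If every eigenvalue seen by \<open>x\<close> were stable, the integer vectors \<open>A\<^sup>k x\<close> would tend to 0 and
  hence vanish eventually, although \<open>A\<close> is injective. So every nonzero rational invariant subspace
  contains an unstable eigenvector.\<close>

lemma integer_vector_has_unstable_eigenvector:
  fixes A :: "int^'n^'n" and x :: "int^'n"
  assumes A: "hyperbolic_automorphism A" and x: "x \<noteq> 0"
  shows "\<exists>r \<alpha>. 1 < cmod \<alpha> \<and> mact (map_matrix of_int A) r (int_vec x) \<noteq> 0 \<and>
    map_matrix of_int A *v mact (map_matrix of_int A) r (int_vec x) =
      \<alpha> *s mact (map_matrix of_int A) r (int_vec x)"
proof -
  let ?C = "map_matrix complex_of_int A"
  obtain q where q: "q \<noteq> 0" "mact ?C q (int_vec x) = 0"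
    and root: "\<And>\<alpha>. poly q \<alpha> = 0 \<Longrightarrow>
      \<exists>r. mact ?C r (int_vec x) \<noteq> 0 \<and> ?C *v mact ?C r (int_vec x) = \<alpha> *s mact ?C r (int_vec x)"
    using annihilator_of_vector_roots[of ?C "int_vec x"] by blast
  have "\<exists>\<alpha>. poly q \<alpha> = 0 \<and> \<not> cmod \<alpha> < 1"
  proof (rule ccontr)
    assume "\<not> ?thesis"
    then have "(\<lambda>k. ((*v) ?C ^^ k) (int_vec x) $ i) \<longlonglongrightarrow> 0" for i
      using powers_tendsto_0[OF q] by blast
    then have "(\<lambda>k. complex_of_int (((*v) A ^^ k) x $ i)) \<longlonglongrightarrow> 0" for i
      by (simp add: int_vec_mult_power)
    then have "eventually (\<lambda>k. ((*v) A ^^ k) x $ i = 0) sequentially" for i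
    proof -
      have "(\<lambda>k. cmod (complex_of_int (((*v) A ^^ k) x $ i))) \<longlonglongrightarrow> 0"
        using tendsto_norm[OF \<open>\<And>i. (\<lambda>k. complex_of_int (((*v) A ^^ k) x $ i)) \<longlonglongrightarrow> 0\<close>[of i]] by simp
      from order_tendstoD(2)[OF this, of 1] show ?thesis
        by (auto elim!: eventually_mono simp: norm_of_int)
    qed
    then have "eventually (\<lambda>k. \<forall>i. ((*v) A ^^ k) x $ i = 0) sequentially"
      by (simp add: eventually_all_finite)
    then obtain k where "((*v) A ^^ k) x = 0"
      by (auto simp: eventually_sequentially vec_eq_iff)
    then show False
      using A x invertible_power_eq_0D by (auto simp: hyperbolic_automorphism_def)
  qed
  then obtain \<alpha> where \<alpha>: "poly q \<alpha> = 0" "1 \<le> cmod \<alpha>"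
    by force
  obtain r where r: "mact ?C r (int_vec x) \<noteq> 0"
      "?C *v mact ?C r (int_vec x) = \<alpha> *s mact ?C r (int_vec x)"
    using root[OF \<alpha>(1)] by blast
  then have "cmod \<alpha> \<noteq> 1"
    using A by (auto simp: hyperbolic_automorphism_def)
  then show ?thesis
    using \<alpha>(2) r by (intro exI[of _ r] exI[of _ \<alpha>]) auto
qed

section \<open>Descent from complex to rational coefficients\<close>

text \<open>Applied to the coordinates of a complex solution of a linear system with integer coefficients,
  such a functional produces a rational solution, and it can be chosen not to lose a given nonzero
  coordinate.\<close>

lemma rat_linear_functional_exists:
  assumes "c \<noteq> (0::complex)"
  shows "\<exists>\<theta>::complex \<Rightarrow> rat. (\<forall>x y. \<theta> (x + y) = \<theta> x + \<theta> y) \<and>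
    (\<forall>q x. \<theta> (of_rat q * x) = q * \<theta> x) \<and> \<theta> c \<noteq> 0"
proof -
  \<comment> \<open>\<open>\<complex>\<close> as a vector space over the rationals: a functional on one line extends.\<close>
  interpret cq: vector_space "\<lambda>(q::rat) (x::complex). of_rat q * x"
    by unfold_locales (simp_all add: algebra_simps of_rat_add of_rat_mult)
  interpret vector_space_pair "\<lambda>(q::rat) (x::complex). of_rat q * x" "(*) :: rat \<Rightarrow> rat \<Rightarrow> rat"
    by unfold_locales
  have "cq.independent {c}"
    using assms by simp
  then obtain \<theta> where \<theta>: "Vector_Spaces.linear (\<lambda>(q::rat) (x::complex). of_rat q * x) (*) \<theta>" "\<theta> c = 1"
    using linear_independent_extend[of "{c}" "\<lambda>_. 1"] by auto
  then show ?thesis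
    unfolding Vector_Spaces.linear_iff by (intro exI[of _ \<theta>]) simp
qed

lemma common_denominator:
  fixes y :: "'i \<Rightarrow> rat"
  assumes "finite S"
  shows "\<exists>D::int. D > 0 \<and> (\<forall>i\<in>S. \<exists>z::int. of_int D * y i = of_int z)"
proof -
  obtain a b where ab: "\<And>i. y i = of_int (a i) / of_int (b i)" "\<And>i. b i > (0::int)"
  proof (rule that)
    show "y i = of_int (fst (quotient_of (y i))) / of_int (snd (quotient_of (y i)))" for i
      by (rule quotient_of_div) simp
    show "snd (quotient_of (y i)) > 0" for i
      by (rule quotient_of_denom_pos')
  qed
  let ?D = "\<Prod>i\<in>S. b i"
  have "of_int ?D * y i = of_int ((\<Prod>j\<in>S - {i}. b j) * a i)" if "i \<in> S" for i
    using ab(2)[of i] assms that by (subst prod.remove[of _ i]) (auto simp: ab(1))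
  moreover have "?D > 0"
    using ab(2) by (simp add: prod_pos)
  ultimately show ?thesis
    by metis
qed

lemma integer_solution_of_complex_solution:
  fixes x :: "complex^'n"
  assumes "x \<noteq> 0"
  shows "\<exists>z::int^'n. z \<noteq> 0 \<and>
    (\<forall>w::int^'n. (\<Sum>i\<in>UNIV. of_int (w $ i) * x $ i) = 0 \<longrightarrow> (\<Sum>i\<in>UNIV. w $ i * z $ i) = 0)"
proof -
  obtain i0 where "x $ i0 \<noteq> 0"
    using assms by (auto simp: vec_eq_iff)
  then obtain \<theta> :: "complex \<Rightarrow> rat" where add: "\<And>x y. \<theta> (x + y) = \<theta> x + \<theta> y"
    and scale: "\<And>q x. \<theta> (of_rat q * x) = q * \<theta> x" and ne: "\<theta> (x $ i0) \<noteq> 0"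
    using rat_linear_functional_exists[of "x $ i0"] by auto
  have "\<theta> 0 = 0"
    using scale[of 0 0] by simp
  then have sum: "\<theta> (\<Sum>i\<in>S. f i) = (\<Sum>i\<in>S. \<theta> (f i))" for f and S :: "'n set"
    by (induction S rule: infinite_finite_induct) (simp_all add: add)
  obtain D :: int where D: "D > 0" "\<And>i. \<exists>z::int. of_int D * \<theta> (x $ i) = of_int z"
    using common_denominator[of UNIV "\<lambda>i. \<theta> (x $ i)"] by auto
  then obtain z where z: "\<And>i. of_int D * \<theta> (x $ i) = of_int (z i)"
    by metis
  have "(\<Sum>i\<in>UNIV. w $ i * z i) = 0" if "(\<Sum>i\<in>UNIV. of_int (w $ i) * x $ i) = 0" for w :: "int^'n"
  proof -
    have "of_int (\<Sum>i\<in>UNIV. w $ i * z i) = (\<Sum>i\<in>UNIV. of_int D * \<theta> (of_rat (of_int (w $ i)) * x $ i))"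
      by (simp add: scale z[symmetric] mult.left_commute del: of_rat_of_int_eq)
    also have "\<dots> = of_int D * \<theta> (\<Sum>i\<in>UNIV. of_int (w $ i) * x $ i)"
      by (simp add: sum_distrib_left sum mult.commute)
    also have "\<dots> = 0"
      using that \<open>\<theta> 0 = 0\<close> by simp
    finally show ?thesis
      by (simp only: of_int_eq_0_iff)
  qed
  moreover have "z i0 \<noteq> 0"
    using z[of i0] D(1) ne by auto
  ultimately show ?thesis
    by (intro exI[of _ "\<chi> i. z i"]) (auto simp: vec_eq_iff)
qed

section \<open>Covectors and polynomials with integer coefficients\<close>

text \<open>Bilinear also over the complex numbers, unlike the inner product, so that it pairs covectors
  with complex eigenvectors.\<close>

definition dotp :: "'a::comm_ring_1^'n \<Rightarrow> 'a^'n \<Rightarrow> 'a" where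
  "dotp u w = (\<Sum>i\<in>UNIV. u $ i * w $ i)"

lemma dotp_add_left: "dotp (u + u') w = dotp u w + dotp u' w"
  and dotp_add_right: "dotp u (w + w') = dotp u w + dotp u w'"
  and dotp_scale_left: "dotp (a *s u) w = a * dotp u w"
  and dotp_scale_right: "dotp u (a *s w) = a * dotp u w"
  by (simp_all add: dotp_def algebra_simps sum.distrib sum_distrib_left)

lemma dotp_0_left [simp]: "dotp 0 w = 0"
  and dotp_0_right [simp]: "dotp u 0 = 0"
  by (simp_all add: dotp_def)

lemma dotp_commute: "dotp u w = dotp w u"
  by (simp add: dotp_def mult.commute)

lemma dotp_axis_left: "dotp (axis i 1) w = w $ i"
  by (simp add: dotp_def axis_def if_distrib[of "\<lambda>z. z * _"] cong: if_cong)

lemma dotp_int_vec: "dotp (int_vec u) (int_vec w) = of_int (dotp u w)"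
  by (simp add: dotp_def)

lemma dotp_transpose:
  fixes A :: "'a::comm_ring_1^'n^'n"
  assumes "T = transpose A"
  shows "dotp (T *v u) w = dotp u (A *v w)"
  unfolding dotp_def matrix_vector_mult_def assms transpose_def
  by (simp add: sum_distrib_left sum_distrib_right mult_ac) (subst sum.swap, simp)

lemma dotp_transpose_power:
  fixes A :: "'a::comm_ring_1^'n^'n"
  assumes "T = transpose A"
  shows "dotp (((*v) T ^^ k) u) w = dotp u (((*v) A ^^ k) w)"
  proof (induction k arbitrary: w)
  case (Suc k)
  then show ?case
    by (simp add: dotp_transpose[OF assms]) (simp add: funpow_swap1)
qed simp

lemma dotp_mact:
  fixes A :: "'a::comm_ring_1^'n^'n"
  assumes "T = transpose A"
  shows "dotp (mact T q u) w = dotp u (mact A q w)"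
  by (induction q arbitrary: w)
     (simp_all add: mat_act.act_pCons dotp_add_left dotp_add_right dotp_scale_left dotp_scale_right
        dotp_transpose[OF assms] mat_act.act_T)

lemma integer_kernel_vector:
  fixes x :: "complex^'n"
  assumes "x \<noteq> 0"
  shows "\<exists>z::int^'n. z \<noteq> 0 \<and> (\<forall>w. dotp (int_vec w) x = 0 \<longrightarrow> dotp w z = 0)"
  using integer_solution_of_complex_solution[OF assms] by (simp add: dotp_def)

lemma map_poly_hom_add:
  assumes "f 0 = 0" "\<And>x y. f (x + y) = f x + f y"
  shows "map_poly f (p + q) = map_poly f p + map_poly f q"
  by (simp add: poly_eq_iff coeff_map_poly assms)

lemma map_poly_hom_mult:
  fixes f :: "'a::comm_semiring_1 \<Rightarrow> 'b::comm_semiring_1"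
  assumes "f 0 = 0" "\<And>x y. f (x + y) = f x + f y" "\<And>x y. f (x * y) = f x * f y"
  shows "map_poly f (p * q) = map_poly f p * map_poly f q"
  by (induction p) (simp_all add: map_poly_pCons map_poly_hom_add map_poly_smult assms)

abbreviation of_int_poly :: "int poly \<Rightarrow> 'a::comm_ring_1 poly" where
  "of_int_poly \<equiv> map_poly of_int"

lemma of_int_poly_mult: "of_int_poly (p * q) = of_int_poly p * (of_int_poly q :: 'a::comm_ring_1 poly)"
  and of_int_poly_add: "of_int_poly (p + q) = of_int_poly p + (of_int_poly q :: 'a::comm_ring_1 poly)"
  and of_int_poly_smult: "of_int_poly (smult a q) = smult (of_int a) (of_int_poly q :: 'a::comm_ring_1 poly)"
  by (simp_all add: map_poly_hom_mult map_poly_hom_add map_poly_smult)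

lemma of_int_poly_eq_0_iff [simp]: "of_int_poly p = (0::'a::{comm_ring_1,ring_char_0} poly) \<longleftrightarrow> p = 0"
  by (intro map_poly_eq_0_iff) auto

lemma degree_of_int_poly [simp]: "degree (of_int_poly p :: 'a::{comm_ring_1,ring_char_0} poly) = degree p"
  by (rule degree_map_poly) auto

section \<open>Integer polynomials of minimal degree\<close>

text \<open>A minimal polynomial over the rationals up to a factor. Its irreducibility is only ever used
  through comparison of degrees, for which pseudo-division of integer polynomials suffices.\<close>

definition minimal_int_poly :: "complex \<Rightarrow> int poly \<Rightarrow> bool" where
  "minimal_int_poly \<mu> p \<longleftrightarrow> p \<noteq> 0 \<and> poly (of_int_poly p) \<mu> = 0 \<and>
     (\<forall>q. q \<noteq> 0 \<and> poly (of_int_poly q) \<mu> = 0 \<longrightarrow> degree p \<le> degree q)"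

lemma minimal_int_poly_degree_pos:
  assumes "minimal_int_poly \<mu> p"
  shows "degree p > 0"
proof (rule ccontr)
  assume "\<not> ?thesis"
  then obtain c where "p = [:c:]"
    by (auto elim: degree_eq_zeroE)
  then show False
    using assms by (auto simp: minimal_int_poly_def map_poly_pCons)
qed

lemma minimal_int_poly_exists:
  assumes "q \<noteq> 0" "poly (of_int_poly q) \<mu> = 0"
  shows "\<exists>p. minimal_int_poly \<mu> p"
  using ex_has_least_nat[of "\<lambda>q. q \<noteq> 0 \<and> poly (of_int_poly q) \<mu> = 0" q degree] assms
  unfolding minimal_int_poly_def by blast

lemma pseudo_divide:
  fixes f g :: "int poly"
  assumes "g \<noteq> 0"
  obtains a q r where "a \<noteq> 0" "smult a f = g * q + r" "r = 0 \<or> degree r < degree g"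
  using pseudo_mod[OF assms] by blast

text \<open>One of the two factors vanishes at \<open>\<mu>\<close> and therefore has full degree.\<close>

lemma minimal_int_poly_factor_degree:
  assumes p: "minimal_int_poly \<mu> p" and eq: "smult c p = q * k" and c: "c \<noteq> 0"
    and less: "degree q < degree p"
  shows "degree q = 0"
proof -
  have "p \<noteq> 0"
    using p by (simp add: minimal_int_poly_def)
  then have ne: "q \<noteq> 0" "k \<noteq> 0"
    using eq c by (metis mult_zero_left mult_zero_right smult_eq_0_iff)+
  have "poly (of_int_poly q * of_int_poly k) \<mu> = 0"
    using p unfolding of_int_poly_mult[symmetric] eq[symmetric] of_int_poly_smult
    by (simp add: minimal_int_poly_def)
  then have "poly (of_int_poly q) \<mu> = 0 \<or> poly (of_int_poly k) \<mu> = 0"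
    by simp
  then have "degree p \<le> degree k"
    using p ne less by (auto simp: minimal_int_poly_def)
  moreover have "degree p = degree q + degree k"
    using degree_mult_eq[OF ne] eq c by (metis degree_smult_eq)
  ultimately show ?thesis
    by simp
qed

lemma minimal_int_poly_other_root:
  assumes p: "minimal_int_poly \<mu> p" and root: "poly (of_int_poly p) \<nu> = 0"
  shows "minimal_int_poly \<nu> p"
proof -
  have "p \<noteq> 0"
    using p by (simp add: minimal_int_poly_def)
  then obtain q where q: "minimal_int_poly \<nu> q"
    using minimal_int_poly_exists[OF _ root] by blast
  then have "q \<noteq> 0"
    by (simp add: minimal_int_poly_def)
  then obtain a k r where dec: "a \<noteq> 0" "smult a p = q * k + r" "r = 0 \<or> degree r < degree q"
    by (rule pseudo_divide)
  have "poly (of_int_poly (smult a p)) \<nu> = poly (of_int_poly r) \<nu>"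
    using q unfolding dec(2) by (simp add: of_int_poly_add of_int_poly_mult minimal_int_poly_def)
  then have "r = 0"
    using dec(3) q root by (force simp: of_int_poly_smult minimal_int_poly_def)
  then have "degree q < degree p \<Longrightarrow> degree q = 0"
    using minimal_int_poly_factor_degree[OF p _ dec(1), of q k] dec(2) by simp
  then have "degree p \<le> degree q"
    using minimal_int_poly_degree_pos[OF q] by linarith
  then show ?thesis
    using q root \<open>p \<noteq> 0\<close> unfolding minimal_int_poly_def by (meson order_trans)
qed

text \<open>At a double root the derivative would be a polynomial of smaller degree with the same root.\<close>

lemma minimal_int_poly_simple_root:
  assumes p: "minimal_int_poly \<mu> p" and r: "of_int_poly p = [:-\<mu>, 1:] * r"
  shows "poly r \<mu> \<noteq> 0"
proof
  assume "poly r \<mu> = 0"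
  have "pderiv (of_int_poly p) = (of_int_poly (pderiv p) :: complex poly)"
    by (simp add: poly_eq_iff coeff_map_poly coeff_pderiv)
  moreover have "poly (pderiv (of_int_poly p)) \<mu> = 0"
    using \<open>poly r \<mu> = 0\<close> unfolding r pderiv_mult by (simp add: pderiv_pCons)
  ultimately have "poly (of_int_poly (pderiv p)) \<mu> = 0"
    by simp
  moreover have "degree (pderiv p) < degree p" "pderiv p \<noteq> 0"
    using minimal_int_poly_degree_pos[OF p] by (auto simp: degree_pderiv pderiv_eq_0_iff)
  ultimately show False
    using p by (auto simp: minimal_int_poly_def)
qed

lemma integer_vector_minimal_annihilator:
  fixes T :: "int^'n^'n" and m :: "int^'n"
  assumes p: "minimal_int_poly \<mu> p" and m: "m \<noteq> 0" and ann: "mact T p m = 0"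
    and q: "q \<noteq> 0" "mact T q m = 0"
  shows "degree p \<le> degree q"
proof -
  let ?P = "\<lambda>q. q \<noteq> 0 \<and> mact T q m = 0"
  obtain g where g: "?P g" and min: "\<And>r. ?P r \<Longrightarrow> degree g \<le> degree r"
    using ex_has_least_nat[of ?P q degree] q by blast
  obtain a k r where dec: "a \<noteq> 0" "smult a p = g * k + r" "r = 0 \<or> degree r < degree g"
    using pseudo_divide[of g p] g by blast
  have "mact T r m = mact T (smult a p) m - mact T (k * g) m"
    by (simp add: dec(2) mat_act.act_add_left mult.commute)
  then have "mact T r m = 0"
    using ann g by (simp add: mat_act.act_smult_left mat_act.act_mult)
  then have "r = 0"
    using min[of r] dec(3) by force
  then have "degree g < degree p \<Longrightarrow> degree g = 0"
    using minimal_int_poly_factor_degree[OF p _ dec(1), of g k] dec(2) by simp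
  moreover have "degree g \<noteq> 0"
  proof
    assume "degree g = 0"
    then obtain c where c: "g = [:c:]"
      by (auto elim: degree_eq_zeroE)
    then have "c \<noteq> 0" "c *s m = 0"
      using g by auto
    then show False
      using m by (auto simp: vec_eq_iff)
  qed
  ultimately show ?thesis
    using min[OF conjI[OF q]] by linarith
qed

text \<open>The vectors \<open>T\<^sup>j m\<close> with \<open>j < degree p\<close> are linearly independent over the rationals, and
  therefore over the complex numbers. For \<open>r = p / (X - \<mu>)\<close> this says that the integer vector \<open>m\<close>
  has a nonzero component in the eigenspace of \<open>\<mu>\<close>: an integer vector annihilated by \<open>p\<close> cannot
  avoid any root of \<open>p\<close>.\<close>

lemma cofactor_image_nonzero:
  fixes T :: "int^'n^'n" and m :: "int^'n"
  assumes p: "minimal_int_poly \<mu> p" and m: "m \<noteq> 0" and ann: "mact T p m = 0"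
    and r: "r \<noteq> 0" "degree r < degree p"
  shows "mact (map_matrix of_int T) r (int_vec m) \<noteq> (0::complex^'n)"
proof
  assume zero: "mact (map_matrix of_int T) r (int_vec m) = 0"
  let ?C = "map_matrix complex_of_int T"
  obtain j0 where "coeff r j0 \<noteq> 0"
    using r(1) by (metis leading_coeff_0_iff)
  then obtain \<theta> :: "complex \<Rightarrow> rat" where add: "\<And>x y. \<theta> (x + y) = \<theta> x + \<theta> y"
    and scale: "\<And>q x. \<theta> (of_rat q * x) = q * \<theta> x" and ne: "\<theta> (coeff r j0) \<noteq> 0"
    using rat_linear_functional_exists[of "coeff r j0"] by auto
  have \<theta>0: "\<theta> 0 = 0"
    using scale[of 0 0] by simp
  then have sum: "\<theta> (\<Sum>i\<in>S. f i) = (\<Sum>i\<in>S. \<theta> (f i))" for f and S :: "nat set"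
    by (induction S rule: infinite_finite_induct) (simp_all add: add)
  obtain D :: int where D: "D > 0" "\<And>j. j \<le> degree r \<Longrightarrow> \<exists>z::int. of_int D * \<theta> (coeff r j) = of_int z"
    using common_denominator[of "{..degree r}" "\<lambda>j. \<theta> (coeff r j)"] by auto
  then obtain z where z: "\<And>j. j \<le> degree r \<Longrightarrow> of_int D * \<theta> (coeff r j) = of_int (z j)"
    by metis
  define q where "q = (\<Sum>j\<le>degree r. monom (z j) j)"
  have q: "coeff q j = (if j \<le> degree r then z j else 0)" for j
    by (simp add: q_def coeff_sum)
  have "z j0 \<noteq> 0" "j0 \<le> degree r"
    using z[of j0] D(1) ne \<open>coeff r j0 \<noteq> 0\<close> by (auto simp: le_degree)
  then have "q \<noteq> 0"
    using q[of j0] by (metis coeff_0)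
  have "degree q \<le> degree r"
    by (rule degree_le) (simp add: q)
  have "mact T q m $ i = 0" for i
  proof -
    let ?w = "\<lambda>j. ((*v) T ^^ j) m $ i"
    have "(\<Sum>j\<le>degree r. coeff r j * of_int (?w j)) = mact ?C (\<Sum>j\<le>degree r. monom (coeff r j) j) (int_vec m) $ i"
      by (simp add: mat_act.act_sum_left mat_act.act_monom int_vec_mult_power)
    also have "\<dots> = 0"
      using zero by (simp add: poly_as_sum_of_monoms)
    finally have "0 = of_int D * \<theta> (\<Sum>j\<le>degree r. of_rat (of_int (?w j)) * coeff r j)"
      using \<theta>0 by (simp add: mult.commute)
    also have "\<dots> = (\<Sum>j\<le>degree r. of_int (?w j) * (of_int D * \<theta> (coeff r j)))"
      by (simp add: sum scale sum_distrib_left mult.left_commute del: of_rat_of_int_eq)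
    also have "\<dots> = of_int (\<Sum>j\<le>degree r. z j * ?w j)"
      by (simp add: z mult.commute)
    finally have "(\<Sum>j\<le>degree r. z j * ?w j) = 0"
      by (metis of_int_eq_0_iff)
    then show ?thesis
      by (simp add: q_def mat_act.act_sum_left mat_act.act_monom)
  qed
  then have "mact T q m = 0"
    by (simp add: vec_eq_iff)
  then show False
    using integer_vector_minimal_annihilator[OF p m ann \<open>q \<noteq> 0\<close>] \<open>degree q \<le> degree r\<close> r(2) by simp
qed

section \<open>The characteristic polynomial\<close>

lemma det_hom:
  fixes h :: "'a::comm_ring_1 \<Rightarrow> 'b::comm_ring_1"
  assumes "\<And>x y. h (x + y) = h x + h y" "\<And>x y. h (x * y) = h x * h y" "h 1 = 1"
  shows "h (det M) = det (map_matrix h M)"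
proof -
  have h0: "h 0 = 0"
    using assms(1)[of 0 0] by simp
  have hm: "h (- 1) = - 1"
    using assms(1)[of 1 "- 1"] h0 assms(3) by (simp add: eq_neg_iff_add_eq_0 add.commute)
  have sum: "h (\<Sum>i\<in>S. f i) = (\<Sum>i\<in>S. h (f i))" for f and S :: "('c \<Rightarrow> 'c) set"
    by (induction S rule: infinite_finite_induct) (simp_all add: assms h0)
  have prod: "h (\<Prod>i\<in>S. f i) = (\<Prod>i\<in>S. h (f i))" for f and S :: "'c set"
    by (induction S rule: infinite_finite_induct) (simp_all add: assms)
  have sgn: "h (of_int (sign q)) = of_int (sign q)" for q :: "'c \<Rightarrow> 'c"
    by (simp add: sign_def hm assms)
  show ?thesis
    by (simp add: det_def sum prod sgn assms)
qed

lemma of_rat_poly_mult: "map_poly of_rat (p * q) = map_poly of_rat p * (map_poly of_rat q :: complex poly)"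
  by (rule map_poly_hom_mult) (simp_all add: of_rat_add of_rat_mult)

text \<open>Evaluation at \<open>z\<close> is a ring homomorphism and commutes with the determinant.\<close>

lemma poly_charpoly:
  fixes A :: "int^'n^'n"
  shows "poly (map_poly of_rat (charpoly (map_matrix rat_of_int A))) (z::complex) =
    det (mat z - map_matrix of_int A)"
proof -
  let ?h = "\<lambda>q. poly (map_poly of_rat q) z"
  have "?h (charpoly (map_matrix rat_of_int A)) =
      det (map_matrix ?h (mat [:0, 1:] - map_matrix (\<lambda>a. [:a:]) (map_matrix rat_of_int A)))"
    unfolding charpoly_def
    by (rule det_hom) (simp_all add: map_poly_hom_add of_rat_add of_rat_poly_mult)
  also have "map_matrix ?h (mat [:0, 1:] - map_matrix (\<lambda>a. [:a:]) (map_matrix rat_of_int A)) =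
      mat z - map_matrix of_int A"
    by (simp add: vec_eq_iff mat_def map_poly_pCons of_rat_minus)
  finally show ?thesis .
qed

lemma degree_charpoly_le: "degree (charpoly (M::'a::comm_ring_1^'n^'n)) \<le> CARD('n)"
  unfolding charpoly_def det_def
proof (rule degree_sum_le)
  fix q :: "'n \<Rightarrow> 'n"
  let ?E = "\<lambda>i. (mat [:0, 1:] - map_matrix (\<lambda>a. [:a:]) M) $ i $ q i"
  have "degree (?E i) \<le> 1" for i
    by (simp add: mat_def)
  then have "degree (\<Prod>i\<in>UNIV. ?E i) \<le> (\<Sum>i\<in>(UNIV::'n set). 1)"
    by (intro order_trans[OF degree_prod_sum_le] sum_mono) auto
  then show "degree (of_int (sign q) * (\<Prod>i\<in>UNIV. ?E i)) \<le> CARD('n)"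
    by (intro order_trans[OF degree_mult_le]) (simp add: of_int_poly)
qed simp

lemma det_eq_0_iff_eigenvalue:
  fixes C :: "complex^'n^'n"
  shows "det (mat z - C) = 0 \<longleftrightarrow> (\<exists>v. v \<noteq> 0 \<and> C *v v = z *s v)"
proof -
  have "(mat z - C) *v v = z *s v - C *v v" for v
    by (simp add: vec_eq_iff matrix_vector_mult_def mat_def left_diff_distrib sum_subtractf
        if_distrib[of "\<lambda>x. x * _"] cong: if_cong)
  then show ?thesis
    using matrix_left_invertible_ker[of "mat z - C"] invertible_det_nz[of "mat z - C"]
    by (auto simp: invertible_left_inverse)
qed

lemma charpoly_root_iff_eigenvalue:
  fixes A :: "int^'n^'n"
  shows "poly (map_poly of_rat (charpoly (map_matrix rat_of_int A))) (z::complex) = 0 \<longleftrightarrow>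
    (\<exists>v. v \<noteq> 0 \<and> map_matrix of_int A *v v = z *s v)"
  by (simp add: poly_charpoly det_eq_0_iff_eigenvalue)

lemma eigenvalue_transpose:
  fixes A :: "int^'n^'n"
  assumes "v \<noteq> 0" "map_matrix of_int A *v v = z *s v"
  shows "\<exists>w. w \<noteq> (0::complex^'n) \<and> map_matrix of_int (transpose A) *v w = z *s w"
proof -
  have "transpose (mat z - map_matrix of_int A) = mat z - map_matrix complex_of_int (transpose A)"
    by (auto simp: vec_eq_iff transpose_def mat_def)
  then have "det (mat z - map_matrix complex_of_int (transpose A)) = 0"
    using det_transpose[of "mat z - map_matrix complex_of_int A"] det_eq_0_iff_eigenvalue assms by metis
  then show ?thesis
    by (simp add: det_eq_0_iff_eigenvalue)
qed

lemma charpoly_nonzero: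
  assumes "hyperbolic_automorphism A"
  shows "charpoly (map_matrix rat_of_int A) \<noteq> 0"
proof
  assume "charpoly (map_matrix rat_of_int A) = 0"
  then show False
    using assms charpoly_root_iff_eigenvalue[of A 1] unfolding hyperbolic_automorphism_def by (metis map_poly_0 norm_one poly_0)
qed

lemma integer_multiple_of_rat_poly:
  fixes a :: "rat poly"
  assumes "a \<noteq> 0"
  shows "\<exists>q. q \<noteq> 0 \<and> degree q \<le> degree a \<and>
    (\<forall>z::complex. poly (map_poly of_rat a) z = 0 \<longrightarrow> poly (of_int_poly q) z = 0)"
proof -
  obtain D :: int where D: "D > 0" "\<And>j. j \<le> degree a \<Longrightarrow> \<exists>z::int. of_int D * coeff a j = of_int z"
    using common_denominator[of "{..degree a}" "coeff a"] by auto
  then obtain z where z: "\<And>j. j \<le> degree a \<Longrightarrow> of_int D * coeff a j = of_int (z j)"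
    by metis
  define q where "q = (\<Sum>j\<le>degree a. monom (z j) j)"
  have coeff_q: "rat_of_int (coeff q j) = of_int D * coeff a j" for j
    using z[of j] by (simp add: q_def coeff_sum coeff_eq_0)
  have "coeff q j = 0 \<longleftrightarrow> coeff a j = 0" for j
    using coeff_q[of j] D(1) by (metis less_numeral_extra(3) mult_eq_0_iff of_int_eq_0_iff)
  then have "q \<noteq> 0" "degree q \<le> degree a"
    using assms by (metis poly_eq_iff coeff_0, metis degree_le coeff_eq_0)
  moreover have "complex_of_int (coeff q j) = of_int D * of_rat (coeff a j)" for j
    using arg_cong[OF coeff_q[of j], of of_rat] by (simp add: of_rat_mult)
  then have "of_int_poly q = smult (of_int D) (map_poly of_rat a :: complex poly)"
    by (simp add: poly_eq_iff coeff_map_poly)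
  ultimately show ?thesis
    by (intro exI[of _ q]) auto
qed

text \<open>Every eigenvalue is a root of one of the two proper factors. This is where reducibility
  enters.\<close>

lemma reducible_charpoly_minimal_degree:
  fixes A :: "int^'n^'n"
  assumes A: "hyperbolic_automorphism A" "\<not> irreducible (charpoly (map_matrix rat_of_int A))"
    and v: "v \<noteq> 0" "map_matrix of_int A *v v = \<mu> *s v"
  shows "\<exists>p. minimal_int_poly \<mu> p \<and> degree p < CARD('n)"
proof -
  let ?\<chi> = "charpoly (map_matrix rat_of_int A)"
  have root: "poly (map_poly of_rat ?\<chi>) \<mu> = 0"
    using v charpoly_root_iff_eigenvalue by blast
  have ne: "?\<chi> \<noteq> 0"
    using charpoly_nonzero[OF A(1)] .
  have "\<not> ?\<chi> dvd 1"
  proof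
    assume "?\<chi> dvd 1"
    then obtain c where "?\<chi> = [:c:]"
      using ne is_unit_iff_degree degree_eq_zeroE by metis
    then show False
      using root ne by (simp add: map_poly_pCons)
  qed
  then obtain a b where ab: "?\<chi> = a * b" "\<not> a dvd 1" "\<not> b dvd 1"
    using A(2) ne unfolding irreducible_def by blast
  then have "a \<noteq> 0" "b \<noteq> 0"
    using ne by auto
  then have "degree a > 0" "degree b > 0" "degree ?\<chi> = degree a + degree b"
    using ab by (auto simp: is_unit_iff_degree degree_mult_eq)
  then have deg: "degree a < CARD('n)" "degree b < CARD('n)"
    using degree_charpoly_le[of "map_matrix rat_of_int A"] by auto
  have "poly (map_poly of_rat a) \<mu> = 0 \<or> poly (map_poly of_rat b) \<mu> = 0"
    using root by (simp add: ab(1) of_rat_poly_mult)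
  then obtain c where c: "c \<noteq> 0" "degree c < CARD('n)" "poly (map_poly of_rat c) \<mu> = 0"
    using deg \<open>a \<noteq> 0\<close> \<open>b \<noteq> 0\<close> by blast
  then obtain q where q: "q \<noteq> 0" "degree q \<le> degree c" "poly (of_int_poly q) \<mu> = 0"
    using integer_multiple_of_rat_poly by blast
  then obtain p where p: "minimal_int_poly \<mu> p"
    using minimal_int_poly_exists by blast
  then have "degree p \<le> degree q"
    using q by (auto simp: minimal_int_poly_def)
  then show ?thesis
    using p q c by auto
qed

text \<open>An eigenvalue of largest modulus is the one to build the covector from: whatever unstable
  eigenvector is found later, the modulus of its eigenvalue does not exceed the growth rate of the
  covector, which is what destroys the Lipschitz property.\<close>

lemma dominant_eigenvalue_exists:
  fixes A :: "int^'n^'n"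
  assumes A: "hyperbolic_automorphism A"
  shows "\<exists>\<mu> v. v \<noteq> 0 \<and> map_matrix of_int A *v v = \<mu> *s v \<and>
    (\<forall>\<alpha> w. w \<noteq> 0 \<and> map_matrix of_int A *v w = \<alpha> *s w \<longrightarrow> cmod \<alpha> \<le> cmod \<mu>)"
proof -
  let ?E = "{z::complex. \<exists>v. v \<noteq> 0 \<and> map_matrix of_int A *v v = z *s v}"
  have "?E = {z. poly (map_poly of_rat (charpoly (map_matrix rat_of_int A))) z = 0}"
    by (simp add: charpoly_root_iff_eigenvalue)
  moreover have "map_poly of_rat (charpoly (map_matrix rat_of_int A)) \<noteq> (0::complex poly)"
    using charpoly_nonzero[OF A] by (subst map_poly_eq_0_iff) auto
  ultimately have fin: "finite ?E"
    using poly_roots_finite by metis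
  have "axis undefined 1 \<noteq> (0::int^'n)"
    by (simp add: axis_eq_0_iff)
  then have "?E \<noteq> {}"
    using integer_vector_has_unstable_eigenvector[OF A] by blast
  then have "Max (cmod ` ?E) \<in> cmod ` ?E"
    using fin by (intro Max_in) auto
  then obtain \<mu> where \<mu>: "\<mu> \<in> ?E" "Max (cmod ` ?E) = cmod \<mu>"
    by blast
  have "cmod z \<le> cmod \<mu>" if "z \<in> ?E" for z
    unfolding \<mu>(2)[symmetric] using fin that by (intro Max_ge) auto
  then show ?thesis
    using \<mu>(1) by blast
qed

section \<open>Growth of the orbit of an integer covector\<close>

context
  fixes T :: "int^'n^'n" and m :: "int^'n" and p :: "int poly" and \<mu> :: complex
  assumes p: "minimal_int_poly \<mu> p" and m: "m \<noteq> 0" "mact T p m = 0" and \<mu>: "1 < cmod \<mu>"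
begin

text \<open>The cofactor of \<open>\<mu>\<close> in \<open>p\<close> maps \<open>m\<close> to an eigenvector. Distinctness and growth of the orbit
  are read off from this image, which is multiplied by \<open>\<mu>\<close> in each step.\<close>

lemma orbit_eigenprojection_exists:
  "\<exists>r l. l \<noteq> 0 \<and> (\<forall>k. mact (map_matrix of_int T) r (int_vec (((*v) T ^^ k) m)) = \<mu> ^ k *s l)"
proof -
  let ?C = "map_matrix complex_of_int T"
  have "poly (of_int_poly p) \<mu> = 0" "p \<noteq> 0"
    using p by (auto simp: minimal_int_poly_def)
  then obtain r where r: "of_int_poly p = [:-\<mu>, 1:] * r"
    unfolding poly_eq_0_iff_dvd dvd_def by blast
  then have "r \<noteq> 0"
    using \<open>p \<noteq> 0\<close> by (metis mult_zero_right of_int_poly_eq_0_iff)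
  then have "degree (of_int_poly p :: complex poly) = Suc (degree r)"
    unfolding r by (subst degree_mult_eq) auto
  then have ne: "mact ?C r (int_vec m) \<noteq> 0"
    by (intro cofactor_image_nonzero[OF p m \<open>r \<noteq> 0\<close>]) simp
  have "?C *v mact ?C r (int_vec m) - \<mu> *s mact ?C r (int_vec m) = mact ?C (of_int_poly p) (int_vec m)"
    unfolding r mat_act.act_mult mat_act.act_linear_factor by simp
  also have "\<dots> = 0"
    using m(2) by (simp add: int_vec_mact)
  finally have "?C *v mact ?C r (int_vec m) = \<mu> *s mact ?C r (int_vec m)"
    by simp
  then have "mact ?C r (int_vec (((*v) T ^^ k) m)) = \<mu> ^ k *s mact ?C r (int_vec m)" for k
    by (simp add: mat_act.act_T_power mat_act.T_power_eigen flip: int_vec_mult_power)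
  then show ?thesis
    using ne by blast
qed

lemma orbit_distinct:
  assumes "j \<noteq> k"
  shows "((*v) T ^^ j) m \<noteq> ((*v) T ^^ k) m" "((*v) T ^^ j) m \<noteq> - ((*v) T ^^ k) m"
proof -
  obtain r l where l: "l \<noteq> 0"
    and eig: "\<And>k. mact (map_matrix of_int T) r (int_vec (((*v) T ^^ k) m)) = \<mu> ^ k *s l"
    using orbit_eigenprojection_exists by auto
  obtain i where i: "l $ i \<noteq> 0"
    using l by (auto simp: vec_eq_iff)
  have pow: "cmod \<mu> ^ j \<noteq> cmod \<mu> ^ k"
    using assms \<mu> by (simp add: power_inject_exp)
  show "((*v) T ^^ j) m \<noteq> ((*v) T ^^ k) m"
  proof
    assume "((*v) T ^^ j) m = ((*v) T ^^ k) m"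
    then have "\<mu> ^ j *s l = \<mu> ^ k *s l"
      using eig by metis
    then have "\<mu> ^ j = \<mu> ^ k"
      using i by (auto simp: vec_eq_iff)
    then show False
      using pow by (metis norm_power)
  qed
  show "((*v) T ^^ j) m \<noteq> - ((*v) T ^^ k) m"
  proof
    assume "((*v) T ^^ j) m = - ((*v) T ^^ k) m"
    then have "((*v) T ^^ j) m = (- 1) *s ((*v) T ^^ k) m"
      by (simp add: vec_eq_iff)
    then have "\<mu> ^ j *s l = (- 1) *s (\<mu> ^ k *s l)"
      using eig[of j] eig[of k] by (simp only: int_vec_scale mat_act.act_scale_right) simp
    then have "\<mu> ^ j * l $ i = - (\<mu> ^ k) * l $ i"
      by (simp add: vec_eq_iff)
    then have "\<mu> ^ j = - (\<mu> ^ k)"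
      using i mult_right_cancel by blast
    then show False
      using pow by (metis norm_minus_cancel norm_power)
  qed
qed

lemma orbit_nonzero: "((*v) T ^^ k) m \<noteq> 0"
proof
  assume 0: "((*v) T ^^ k) m = 0"
  then have "((*v) T ^^ Suc k) m = 0"
    by simp
  then show False
    using 0 orbit_distinct(1)[of k "Suc k"] by simp
qed

lemma orbit_growth:
  assumes \<alpha>: "\<alpha> \<noteq> 0" "cmod \<alpha> \<le> cmod \<mu>"
  shows "\<exists>i. \<not> (\<lambda>k. of_int (((*v) T ^^ k) m $ i) / cmod \<alpha> ^ k) \<longlonglongrightarrow> (0::real)"
proof (rule ccontr)
  assume "\<not> ?thesis"
  then have lim: "(\<lambda>k. of_int (((*v) T ^^ k) m $ i) / cmod \<alpha> ^ k) \<longlonglongrightarrow> (0::real)" for i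
    by blast
  let ?C = "map_matrix complex_of_int T"
  let ?K = "\<lambda>k. int_vec (((*v) T ^^ k) m) :: complex^'n"
  obtain r l where l: "l \<noteq> 0" and eig: "\<And>k. mact ?C r (?K k) = \<mu> ^ k *s l"
    using orbit_eigenprojection_exists by auto
  obtain i where i: "l $ i \<noteq> 0"
    using l by (auto simp: vec_eq_iff)
  let ?a = "\<lambda>j. mact ?C r (axis j 1) $ i"
  have comp: "mact ?C r x $ i = (\<Sum>j\<in>UNIV. x $ j * ?a j)" for x
    by (subst vec_expand_axis[of x]) (simp add: mat_act.act_sum_right mat_act.act_scale_right)
  have "(\<lambda>k. complex_of_real (of_int (((*v) T ^^ k) m $ j) / cmod \<alpha> ^ k)) \<longlonglongrightarrow> 0" for j
    using tendsto_of_real[OF lim[of j], where 'a = complex] unfolding of_real_0 .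
  then have "(\<lambda>k. \<Sum>j\<in>UNIV. complex_of_real (of_int (((*v) T ^^ k) m $ j) / cmod \<alpha> ^ k) * ?a j) \<longlonglongrightarrow> 0"
    by (intro tendsto_null_sum tendsto_mult_left_zero)
  moreover have "(\<Sum>j\<in>UNIV. complex_of_real (of_int (((*v) T ^^ k) m $ j) / cmod \<alpha> ^ k) * ?a j) =
      \<mu> ^ k * l $ i / of_real (cmod \<alpha> ^ k)" for k
  proof -
    have "(\<Sum>j\<in>UNIV. complex_of_real (of_int (((*v) T ^^ k) m $ j) / cmod \<alpha> ^ k) * ?a j) =
        (\<Sum>j\<in>UNIV. ?K k $ j * ?a j) / of_real (cmod \<alpha> ^ k)"
      by (simp add: sum_divide_distrib)
    also have "\<dots> = (\<mu> ^ k *s l) $ i / of_real (cmod \<alpha> ^ k)"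
      unfolding comp[symmetric] eig ..
    finally show ?thesis
      by simp
  qed
  ultimately have "(\<lambda>k. \<mu> ^ k * l $ i / of_real (cmod \<alpha> ^ k)) \<longlonglongrightarrow> 0"
    by simp
  from order_tendstoD(2)[OF tendsto_norm[OF this], of "cmod (l $ i)"]
  have "eventually (\<lambda>k. cmod (\<mu> ^ k * l $ i / of_real (cmod \<alpha> ^ k)) < cmod (l $ i)) sequentially"
    using i by simp
  then obtain k where "cmod (\<mu> ^ k * l $ i / of_real (cmod \<alpha> ^ k)) < cmod (l $ i)"
    using eventually_happens'[OF sequentially_bot] by blast
  moreover have "cmod (l $ i) \<le> cmod (\<mu> ^ k * l $ i / of_real (cmod \<alpha> ^ k))"
  proof -
    have "cmod \<alpha> ^ k * cmod (l $ i) \<le> cmod \<mu> ^ k * cmod (l $ i)"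
      using \<alpha> by (intro mult_right_mono power_mono) auto
    then show ?thesis
      using \<alpha>(1) by (simp add: norm_mult norm_divide norm_power field_simps)
  qed
  ultimately show False
    by simp
qed

end

section \<open>A Bezout identity for complex polynomials\<close>

lemma power_minus_const_squarefree:
  fixes h k :: "complex poly"
  assumes g: "monom 1 n - [:c:] = h * k" and n: "n > 0" and c: "c \<noteq> 0"
  shows "coprime h k"
proof (rule ccontr)
  assume "\<not> coprime h k"
  then obtain d where d: "d dvd h" "d dvd k" "\<not> d dvd 1"
    by (auto simp: coprime_def)
  have "h * k \<noteq> 0"
  proof
    assume "h * k = 0"
    then have "coeff (monom 1 n - [:c:]) 0 = 0"
      by (simp only: g \<open>h * k = 0\<close> coeff_0)
    then show False
      using n c by simp
  qed
  then have "d \<noteq> 0"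
    using d by auto
  then have "degree d \<noteq> 0"
    using d(3) is_unit_iff_degree by blast
  then obtain \<alpha> where "poly d \<alpha> = 0"
    using fundamental_theorem_of_algebra_alt[of d] by (metis degree_pCons_0 degree_0)
  then have root: "poly h \<alpha> = 0" "poly k \<alpha> = 0"
    using d by (auto simp: dvd_def)
  have "poly (pderiv (monom 1 n - [:c:])) \<alpha> = 0"
    unfolding g pderiv_mult using root by simp
  then have "of_nat n * \<alpha> ^ (n - 1) = 0"
    by (simp add: pderiv_diff pderiv_monom poly_monom pderiv_pCons)
  then have "\<alpha> = 0"
    using n by simp
  moreover have "\<alpha> ^ n = c"
    using arg_cong[OF g, of "\<lambda>q. poly q \<alpha>"] root by (simp add: poly_monom)
  ultimately show False
    using n c by (simp add: power_0_left)
qed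

text \<open>A polynomial and its square have the same common divisor with a squarefree polynomial. With
  \<open>c\<close> the \<open>n\<close>-th power of an eigenvalue this solves \<open>\<kappa> (B\<^sup>n - c) = \<omega>\<close> explicitly for those covectors
  \<open>\<omega>\<close> that are needed, see \<open>isospectral_shears_of_jordan_chain\<close>.\<close>

lemma combination_of_square_and_power:
  fixes p :: "complex poly"
  assumes n: "n > 0" and c: "c \<noteq> 0"
  shows "\<exists>a b. p = a * (p * p) + b * (monom 1 n - [:c:])"
proof -
  let ?g = "monom 1 n - [:c:]"
  have "?g \<noteq> 0"
  proof
    assume "?g = 0"
    then have "coeff ?g 0 = 0"
      by simp
    then show False
      using n c by simp
  qed
  then have "gcd p ?g \<noteq> 0"
    by simp
  then obtain l k where lk: "p = l * gcd p ?g" "?g = k * gcd p ?g" "coprime l k"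
    using gcd_coprime_exists[of p ?g] by blast
  define h where "h = gcd p ?g"
  have ph: "p = h * l" and gh: "?g = h * k"
    using lk unfolding h_def by (simp_all add: mult.commute)
  have "coprime h k"
    by (rule power_minus_const_squarefree[OF gh n c])
  then have "coprime (h * (l * l)) k"
    using lk(3) by simp
  then obtain a b where "a * (h * (l * l)) + b * k = 1"
    by (metis bezout_coefficients_fst_snd coprime_imp_gcd_eq_1)
  then have "l * (h * (a * (h * (l * l)) + b * k)) = l * h"
    by simp
  then have "p = (l * a) * (p * p) + (l * b) * ?g"
    unfolding gh unfolding ph by (simp add: algebra_simps)
  then show ?thesis
    by blast
qed

section \<open>Real parts of complex vectors\<close>

text \<open>The real vector \<open>v + cnj v\<close>. Working with it treats real and nonreal eigenvalues alike.\<close>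

definition re2 :: "complex^'n \<Rightarrow> real^'n" where
  "re2 v = (\<chi> i. 2 * Re (v $ i))"

definition cvec :: "real^'n \<Rightarrow> complex^'n" where
  "cvec x = (\<chi> i. complex_of_real (x $ i))"

definition cnjv :: "complex^'n \<Rightarrow> complex^'n" where
  "cnjv v = (\<chi> i. cnj (v $ i))"

lemma re2_nth [simp]: "re2 v $ i = 2 * Re (v $ i)"
  and cvec_nth [simp]: "cvec x $ i = complex_of_real (x $ i)"
  and cnjv_nth [simp]: "cnjv v $ i = cnj (v $ i)"
  by (simp_all add: re2_def cvec_def cnjv_def)

lemma re2_0 [simp]: "re2 0 = 0"
  and re2_add: "re2 (u + v) = re2 u + re2 v"
  and re2_scale: "re2 (of_real r *s v) = r *s re2 v"
  by (simp_all add: vec_eq_iff)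

lemma cvec_add: "cvec (x + y) = cvec x + cvec y"
  and cvec_scale: "cvec (r *s x) = of_real r *s cvec x"
  and cvec_scaleR: "cvec (r *\<^sub>R x) = of_real r *s cvec x"
  and cvec_re2: "cvec (re2 v) = v + cnjv v"
  by (simp_all add: vec_eq_iff complex_add_cnj)

lemma map_matrix_cvec: "map_matrix of_int A *v cvec x = cvec (map_matrix of_int A *v x)"
  and map_matrix_re2: "map_matrix of_int A *v re2 v = re2 (map_matrix of_int A *v v)"
  and map_matrix_cnjv: "map_matrix of_int A *v cnjv v = cnjv (map_matrix of_int A *v v)"
  by (simp_all add: vec_eq_iff matrix_vector_mult_def sum_distrib_left mult.left_commute)

lemma map_matrix_power_cvec:
  fixes A :: "int^'n^'n"
  shows "((*v) (map_matrix of_int A) ^^ k) (cvec x) = cvec (((*v) (map_matrix of_int A) ^^ k) x)"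
  and map_matrix_power_re2:
    "((*v) (map_matrix of_int A) ^^ k) (re2 v) = re2 (((*v) (map_matrix of_int A) ^^ k) v)"
  by (induction k) (simp_all add: map_matrix_cvec map_matrix_re2)

lemma mact_re2:
  "mact (map_matrix of_int A) (of_int_poly q) (re2 v) = re2 (mact (map_matrix of_int A) (of_int_poly q) v)"
proof (induction q)
  case (pCons a q)
  have "of_int a *s re2 v = re2 (of_int a *s v)"
    by (simp add: vec_eq_iff)
  with pCons show ?case
    by (simp add: map_poly_pCons mat_act.act_pCons re2_add map_matrix_re2)
qed simp

lemma dotp_re2: "dotp (int_vec m) (re2 v) = 2 * Re (dotp (int_vec m) v)"
  and dotp_cvec: "dotp (int_vec m) (cvec x) = of_real (dotp (int_vec m) x)"
  and dotp_cnjv: "dotp (int_vec m) (cnjv v) = cnj (dotp (int_vec m) v)"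
  by (simp_all add: dotp_def sum_distrib_left mult.left_commute)

lemma map_matrix_transpose: "map_matrix f (transpose A) = transpose (map_matrix f A)"
  by (simp add: vec_eq_iff transpose_def)

section \<open>Shears with conjugate derivative cocycles\<close>

text \<open>The derivative of the \<open>n\<close>-th iterate of the shear \<open>z \<mapsto> A z + \<delta> sin (2\<pi> m\<cdot>z) a\<close> along an orbit,
  where \<open>e j\<close> is the value of \<open>2\<pi>\<delta> cos (2\<pi> m\<cdot>z)\<close> at the \<open>j\<close>-th point.\<close>

primrec shear_cocycle :: "int^'n^'n \<Rightarrow> int^'n \<Rightarrow> real^'n \<Rightarrow> (nat \<Rightarrow> real) \<Rightarrow> nat \<Rightarrow> real^'n \<Rightarrow> real^'n" where
  "shear_cocycle A m a e 0 x = x"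
| "shear_cocycle A m a e (Suc n) x = map_matrix of_int A *v shear_cocycle A m a e n x +
     (e n * dotp (int_vec m) (shear_cocycle A m a e n x)) *s a"

text \<open>The conjugating map may depend on \<open>e\<close> and \<open>n\<close>, that is, on the periodic orbit. The bound \<open>\<kappa>\<close>
  makes room for cases in which it is invertible only for small shears.\<close>

definition isospectral_shears :: "int^'n^'n \<Rightarrow> int^'n \<Rightarrow> real^'n \<Rightarrow> real^'n \<Rightarrow> bool" where
  "isospectral_shears A m a b \<longleftrightarrow>
     (\<exists>\<kappa>>0. \<forall>e n. (\<forall>j. \<bar>e j\<bar> \<le> \<kappa>) \<longrightarrow>
        conjugate_linear_maps (shear_cocycle A m a e n) (shear_cocycle A m b e n))"

text \<open>The first condition keeps \<open>m\<close> and all its iterates unaware of the shear; the second says the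
  same of the preimage of \<open>a\<close>, which makes the shear invertible with an inverse of the same form.\<close>

definition shear_vector :: "int^'n^'n \<Rightarrow> int^'n \<Rightarrow> real^'n \<Rightarrow> bool" where
  "shear_vector A m a \<longleftrightarrow>
     (\<forall>k. dotp (int_vec m) (((*v) (map_matrix of_int A) ^^ k) a) = 0) \<and>
     (\<exists>a'. map_matrix of_int A *v a' = a \<and> dotp (int_vec m) a' = 0)"

text \<open>What a pair of shears needs, apart from the growth of the orbit of \<open>m\<close>, to be a
  counterexample. The factor \<open>c\<close> is left free because the real part of a complex function may be
  Lipschitz when the function is not; in that case \<open>c = \<i>\<close> is used to select the imaginary part.\<close>

definition isospectral_resonance :: "int^'n^'n \<Rightarrow> int^'n \<Rightarrow> complex \<Rightarrow> complex^'n \<Rightarrow> bool" where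
  "isospectral_resonance A m \<alpha> v \<longleftrightarrow> 1 < cmod \<alpha> \<and> v \<noteq> 0 \<and>
     map_matrix of_int A *v v = \<alpha> *s v \<and> dotp (int_vec m) v = 0 \<and>
     (\<forall>c. \<exists>a b. b - a = re2 (c *s v) \<and> shear_vector A m a \<and> shear_vector A m b \<and> isospectral_shears A m a b)"

lemma injective_linear_imp_bij:
  fixes P :: "real^'n \<Rightarrow> real^'n"
  assumes "linear P" "\<And>x. P x = 0 \<Longrightarrow> x = 0"
  shows "bij P"
  using assms linear_injective_0[of P] linear_injective_imp_surjective[of P] by (auto simp: bij_def)

text \<open>Such a \<open>P\<close> intertwines the two cocycles step by step, with no reference to the orbit.\<close>

lemma isospectral_shears_of_commuting_map:
  assumes "linear P" "\<And>x. P x = 0 \<Longrightarrow> x = 0"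
    and "\<And>x. P (map_matrix of_int A *v x) = map_matrix of_int A *v P x"
    and "\<And>x. dotp (int_vec m) (P x) = dotp (int_vec m) x" and "P a = b"
  shows "isospectral_shears A m a b"
proof -
  have "P (r *s x) = r *s P x" for r x
    using linear_scale[OF assms(1)] by (simp add: scalar_mult_eq_scaleR)
  then have "P (shear_cocycle A m a e n x) = shear_cocycle A m b e n (P x)" for e n x
  proof (induction n)
    case (Suc n)
    have "dotp (int_vec m) (shear_cocycle A m b e n (P x)) = dotp (int_vec m) (shear_cocycle A m a e n x)"
      using assms(4) by (simp flip: Suc)
    with Suc show ?case
      by (simp add: linear_add[OF assms(1)] assms(3,5))
  qed simp
  then have "conjugate_linear_maps (shear_cocycle A m a e n) (shear_cocycle A m b e n)" for e n
    unfolding conjugate_linear_maps_def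
    using assms(1) injective_linear_imp_bij[OF assms(1,2)] by (intro exI[of _ P]) auto
  then show ?thesis
    unfolding isospectral_shears_def by (intro exI[of _ 1]) auto
qed

lemma shear_vector_eigen:
  assumes v: "map_matrix of_int A *v v = \<alpha> *s v" "\<alpha> \<noteq> 0" "dotp (int_vec m) v = 0"
  shows "shear_vector A m (re2 (c *s v))"
  unfolding shear_vector_def
proof (intro conjI allI exI[of _ "re2 ((c / \<alpha>) *s v)"])
  show "dotp (int_vec m) (((*v) (map_matrix of_int A) ^^ k) (re2 (c *s v))) = 0" for k
    using v by (simp add: map_matrix_power_re2 mat_act.T_power_scale mat_act.T_power_eigen[OF v(1)] dotp_re2 dotp_scale_right)
  show "map_matrix of_int A *v re2 ((c / \<alpha>) *s v) = re2 (c *s v)"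
    using v by (simp add: map_matrix_re2 mat_act.T_scale)
  show "dotp (int_vec m) (re2 ((c / \<alpha>) *s v)) = 0"
    using v by (simp add: dotp_re2 dotp_scale_right)
qed

lemma mact_expand_axis: "mact A q x = (\<Sum>j\<in>UNIV. x $ j *s mact A q (axis j 1))"
  by (subst vec_expand_axis[of x]) (simp only: mat_act.act_sum_right mat_act.act_scale_right)

text \<open>The kernel is cut out by integer equations.\<close>

lemma integer_poly_kernel_vector:
  fixes T :: "int^'n^'n"
  assumes l: "l \<noteq> (0::complex^'n)" "mact (map_matrix of_int T) (of_int_poly p) l = 0"
  shows "\<exists>m. m \<noteq> 0 \<and> mact T p m = 0"
proof -
  obtain m :: "int^'n" where m: "m \<noteq> 0" "\<And>w. dotp (int_vec w) l = 0 \<Longrightarrow> dotp w m = 0"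
    using integer_kernel_vector[OF l(1)] by blast
  have "mact T p m $ i = 0" for i
  proof -
    let ?w = "\<chi> j. mact T p (axis j 1) $ i"
    have int_axis: "int_vec (axis j 1) = (axis j 1 :: complex^'n)" for j
      by (simp add: vec_eq_iff axis_def)
    have axis_image: "mact (map_matrix of_int T) (of_int_poly p) (axis j 1) $ i =
        complex_of_int (mact T p (axis j 1) $ i)" for j
      by (simp only: int_axis[symmetric] int_vec_mact int_vec_nth)
    have int: "mact T p x $ i = dotp ?w x" for x
      unfolding mact_expand_axis[of T p x] by (simp add: dotp_def mult.commute)
    have "mact (map_matrix of_int T) (of_int_poly p) x $ i = dotp (int_vec ?w) x" for x :: "complex^'n"
      unfolding mact_expand_axis[of "map_matrix of_int T" _ x]
      by (simp add: dotp_def axis_image mult.commute)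
    from this[of l] have "dotp (int_vec ?w) l = 0"
      using arg_cong[OF l(2), of "\<lambda>y. y $ i"] by (metis zero_index)
    then show ?thesis
      by (rule trans[OF int m(2)])
  qed
  then show ?thesis
    using m(1) by (intro exI[of _ m]) (simp add: vec_eq_iff)
qed

lemma mact_eq_0_transpose:
  fixes A :: "'a::comm_ring_1^'n^'n"
  assumes "T = transpose A" "\<And>x. mact A q x = 0"
  shows "mact T q x = 0"
proof -
  have "mact T q x $ i = dotp (mact T q x) (axis i 1)" for i
    by (simp add: dotp_commute[of _ "axis i 1"] dotp_axis_left)
  then show ?thesis
    by (simp add: vec_eq_iff dotp_mact[OF assms(1)] assms(2))
qed

lemma mact_eq_0_complex:
  fixes A :: "int^'n^'n"
  assumes "\<And>x. mact A q x = 0"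
  shows "mact (map_matrix of_int A) (of_int_poly q) x = (0::'a::comm_ring_1^'n)"
proof -
  have "int_vec (axis j 1) = (axis j 1 :: 'a^'n)" for j
    by (simp add: vec_eq_iff axis_def)
  then have "mact (map_matrix of_int A) (of_int_poly q) (axis j 1) = (0::'a^'n)" for j
  proof -
    have "int_vec (mact A q (axis j 1)) = (0::'a^'n)"
      using assms by simp
    then show ?thesis
      by (simp only: \<open>\<And>j. int_vec (axis j 1) = (axis j 1 :: 'a^'n)\<close> flip: int_vec_mact)
  qed
  then show ?thesis
    unfolding mact_expand_axis[of _ _ x] by simp
qed

text \<open>Put \<open>N = p(A)\<close>. The covector is chosen with \<open>m N = 0\<close>, so \<open>P = 1 + s N\<close> commutes with \<open>A\<close> and
  preserves \<open>m\<close>; it moves \<open>a\<close> in the image of \<open>N\<close> by \<open>s N a\<close>. Since \<open>N\<^sup>2 \<noteq> 0\<close>, the image of \<open>N\<^sup>2\<close>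
  contains an unstable eigenvector, and \<open>a\<close> is chosen with \<open>s N a = 2 Re (c v)\<close>.\<close>

lemma isospectral_shears_of_nonnilpotent_square:
  fixes A :: "int^'n^'n"
  assumes A: "hyperbolic_automorphism A" and T: "T = transpose A"
    and l: "l \<noteq> (0::complex^'n)" "map_matrix of_int T *v l = \<mu> *s l" and p: "poly (of_int_poly p) \<mu> = 0"
    and x: "mact A p (mact A p x) \<noteq> 0"
  shows "\<exists>(m::int^'n) \<alpha> v. m \<noteq> 0 \<and> mact T p m = 0 \<and> isospectral_resonance A m \<alpha> v"
proof -
  let ?C = "map_matrix complex_of_int A" and ?L = "map_matrix real_of_int A"
  let ?N = "mact ?L (of_int_poly p)"
  have "mact (map_matrix of_int T) (of_int_poly p) l = 0"
    using mat_act.act_eigen[OF l(2), of "of_int_poly p"] p by simp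
  then obtain m where m: "m \<noteq> 0" "mact T p m = 0"
    using integer_poly_kernel_vector[OF l(1)] by blast
  have TL: "map_matrix real_of_int T = transpose ?L" and TC: "map_matrix complex_of_int T = transpose ?C"
    by (simp_all add: T map_matrix_transpose)
  have mN: "dotp (int_vec m) (?N z) = 0" for z
    using m(2) unfolding dotp_mact[OF TL, symmetric] by (simp add: int_vec_mact)
  have mNC: "dotp (int_vec m) (mact ?C (of_int_poly p) z) = 0" for z
    using m(2) unfolding dotp_mact[OF TC, symmetric] by (simp add: int_vec_mact)
  obtain r \<alpha> where \<alpha>: "1 < cmod \<alpha>" and ne: "mact ?C r (int_vec (mact A p (mact A p x))) \<noteq> 0"
    and eig: "?C *v mact ?C r (int_vec (mact A p (mact A p x))) = \<alpha> *s mact ?C r (int_vec (mact A p (mact A p x)))"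
    using integer_vector_has_unstable_eigenvector[OF A x] by blast
  define u where "u = mact ?C r (int_vec x)"
  define v where "v = mact ?C (of_int_poly p) (mact ?C (of_int_poly p) u)"
  have v: "v = mact ?C r (int_vec (mact A p (mact A p x)))"
    unfolding v_def u_def by (simp add: mat_act.act_commute flip: int_vec_mact)
  have lin: "linear ?N"
    by (rule linearI) (simp_all add: mat_act.act_add_right flip: scalar_mult_eq_scaleR mat_act.act_scale_right)
  then obtain K where K: "K > 0" "\<And>z. norm (?N z) \<le> K * norm z"
    using linear_bounded_pos by blast
  \<comment> \<open>Small enough for \<open>1 + s N\<close> to be injective.\<close>
  define s where "s = 1 / (2 * K)"
  have s: "s > 0" "s * K < 1"
    using K(1) by (simp_all add: s_def)
  define P where "P = (\<lambda>z. z + s *s ?N z)"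
  have P_inj: "z = 0" if "P z = 0" for z
  proof (rule ccontr)
    assume "z \<noteq> 0"
    have "norm z = s * norm (?N z)"
      using that s(1) unfolding P_def
      by (metis abs_of_pos add_eq_0_iff2 norm_minus_cancel norm_scaleR scalar_mult_eq_scaleR)
    also have "\<dots> \<le> s * (K * norm z)"
      using s(1) K(2) by (intro mult_left_mono) auto
    also have "\<dots> < norm z"
      using s(2) \<open>z \<noteq> 0\<close> by (simp add: mult.assoc[symmetric])
    finally show False
      by simp
  qed
  have P_lin: "linear P"
    by (rule linearI)
       (simp_all add: P_def linear_add[OF lin] linear_scale[OF lin] vec_eq_iff algebra_simps)
  have P_comm: "P (?L *v z) = ?L *v P z" for z
    by (simp add: P_def mat_act.act_T mat_act.T_add mat_act.T_scale)
  have P_m: "dotp (int_vec m) (P z) = dotp (int_vec m) z" for z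
    by (simp add: P_def dotp_add_right dotp_scale_right mN)
  obtain B where B: "?L *v (B *v z) = z" for z
  proof -
    obtain B0 where B0: "A ** B0 = mat 1"
      using A by (auto simp: hyperbolic_automorphism_def invertible_def)
    have "?L ** map_matrix of_int B0 = map_matrix of_int (A ** B0)"
      by (simp add: vec_eq_iff matrix_matrix_mult_def)
    also have "\<dots> = mat 1"
      by (simp add: B0) (simp add: vec_eq_iff mat_def)
    finally show ?thesis
      by (intro that[of "map_matrix of_int B0"]) (simp add: matrix_vector_mul_assoc)
  qed
  have shear: "shear_vector A m (?N z)" for z
    unfolding shear_vector_def
    using mN[of "B *v z"] mN B
    by (intro conjI allI exI[of _ "?N (B *v z)"]) (simp_all flip: mat_act.act_T mat_act.act_T_power)
  have "\<exists>a b. b - a = re2 (c *s v) \<and> shear_vector A m a \<and> shear_vector A m b \<and> isospectral_shears A m a b" for c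
  proof (intro exI conjI)
    let ?z = "re2 ((c / of_real s) *s u)"
    have "s *s ?N (?N ?z) = re2 (of_real s *s ((c / of_real s) *s v))"
      by (simp only: mact_re2 re2_scale mat_act.act_scale_right v_def)
    also have "of_real s *s ((c / of_real s) *s v) = c *s v"
      using s(1) by simp
    finally show "P (?N ?z) - ?N ?z = re2 (c *s v)"
      by (simp add: P_def)
    show "shear_vector A m (?N ?z)"
      by (rule shear)
    have "P (?N ?z) = ?N (P ?z)"
      by (simp add: P_def mat_act.act_add_right mat_act.act_scale_right)
    then show "shear_vector A m (P (?N ?z))"
      by (simp add: shear)
    show "isospectral_shears A m (?N ?z) (P (?N ?z))"
      by (rule isospectral_shears_of_commuting_map[OF P_lin P_inj P_comm P_m]) auto
  qed
  then show ?thesis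
    using m \<alpha> ne eig mNC v[symmetric] unfolding v_def
    by (intro exI[of _ m] exI[of _ \<alpha>] exI[of _ v]) (simp add: v_def isospectral_resonance_def)
qed

text \<open>The orbit of \<open>m\<close> spans at most \<open>degree p\<close> dimensions, so it has a real orthogonal vector, and
  then an integer one.\<close>

lemma integer_vector_orthogonal_to_orbit:
  fixes T :: "int^'n^'n"
  assumes p: "p \<noteq> 0" "degree p < CARD('n)" "mact T p m = 0"
  shows "\<exists>z. z \<noteq> 0 \<and> (\<forall>k. dotp (((*v) T ^^ k) m) z = 0)"
proof -
  let ?K = "\<lambda>k. int_vec (((*v) T ^^ k) m) :: real^'n"
  let ?S = "?K ` {..<degree p}"
  have "dim ?S \<le> card ?S"
    by (rule dim_le_card') simp
  also have "\<dots> \<le> degree p"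
    using card_image_le[of "{..<degree p}" ?K] by simp
  finally have "dim ?S < DIM(real^'n)"
    using p(2) by simp
  then obtain x where x: "x \<noteq> 0" "\<And>y. y \<in> span ?S \<Longrightarrow> orthogonal x y"
    using orthogonal_to_subspace_exists[of ?S] by blast
  have span: "?K k \<in> span ?S" for k
  proof -
    obtain a q r where dec: "a \<noteq> 0" "smult a (monom 1 k) = p * q + r" "r = 0 \<or> degree r < degree p"
      using pseudo_divide[OF p(1)] by blast
    have "a *s ((*v) T ^^ k) m = mact T (q * p + r) m"
      using arg_cong[OF dec(2), of "\<lambda>q. mact T q m"]
      by (simp add: mat_act.act_smult_left mat_act.act_monom mult.commute)
    also have "\<dots> = mact T r m"
      using p(3) by (simp add: mat_act.act_add_left mat_act.act_mult)
    also have "\<dots> = (\<Sum>j\<le>degree r. coeff r j *s ((*v) T ^^ j) m)"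
      by (subst poly_as_sum_of_monoms[of r, symmetric]) (simp only: mat_act.act_sum_left mat_act.act_monom)
    finally have "real_of_int a *s ?K k = int_vec (\<Sum>j\<le>degree r. coeff r j *s ((*v) T ^^ j) m)"
      by (simp flip: int_vec_scale)
    also have "\<dots> = (\<Sum>j\<le>degree r. real_of_int (coeff r j) *\<^sub>R ?K j)"
      by (simp add: vec_eq_iff)
    also have "\<dots> \<in> span ?S"
    proof (cases "r = 0")
      case False
      then show ?thesis
        using dec(3) by (intro span_sum span_scale span_base) auto
    qed (simp add: span_zero)
    finally have "(1 / of_int a) *\<^sub>R (real_of_int a *s ?K k) \<in> span ?S"
      by (rule span_scale)
    then show ?thesis
      using dec(1) by (simp add: scalar_mult_eq_scaleR)
  qed
  have "dotp (?K k) x = 0" for k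
    using x(2)[OF span[of k]] by (simp add: orthogonal_def inner_vec_def dotp_def mult.commute)
  then have "dotp (int_vec (((*v) T ^^ k) m)) (cvec x) = 0" for k
    by (simp add: dotp_cvec)
  moreover have "cvec x \<noteq> 0"
    using x(1) by (simp add: vec_eq_iff)
  ultimately show ?thesis
    using integer_kernel_vector[of "cvec x"] by blast
qed

text \<open>For a real eigenvalue the real or the imaginary part of an eigenvector is again an
  eigenvector.\<close>

lemma real_eigenvector_choice:
  fixes A :: "int^'n^'n"
  assumes v: "v \<noteq> 0" "map_matrix of_int A *v v = \<alpha> *s v" "dotp (int_vec m) v = 0"
  shows "\<exists>v. v \<noteq> 0 \<and> map_matrix of_int A *v v = \<alpha> *s v \<and> dotp (int_vec m) v = 0 \<and>
    (cnj \<alpha> = \<alpha> \<longrightarrow> cnjv v = v)"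
proof (cases "cnj \<alpha> = \<alpha>")
  case True
  have cand: "map_matrix of_int A *v cvec (re2 (c *s v)) = \<alpha> *s cvec (re2 (c *s v)) \<and>
      dotp (int_vec m) (cvec (re2 (c *s v))) = 0 \<and> cnjv (cvec (re2 (c *s v))) = cvec (re2 (c *s v))" for c
  proof (intro conjI)
    have "cnjv (\<alpha> *s (c *s v)) = \<alpha> *s cnjv (c *s v)"
      using True by (simp add: vec_eq_iff)
    then show "map_matrix of_int A *v cvec (re2 (c *s v)) = \<alpha> *s cvec (re2 (c *s v))"
      using v(2) by (simp add: cvec_re2 mat_act.T_add map_matrix_cnjv mat_act.T_scale vec.scale_right_distrib mult.commute)
    show "dotp (int_vec m) (cvec (re2 (c *s v))) = 0"
      using v(3) by (simp add: dotp_cvec dotp_re2 dotp_scale_right)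
    show "cnjv (cvec (re2 (c *s v))) = cvec (re2 (c *s v))"
      by (simp add: vec_eq_iff)
  qed
  obtain i where "v $ i \<noteq> 0"
    using v(1) by (auto simp: vec_eq_iff)
  then have "cvec (re2 (1 *s v)) $ i \<noteq> 0 \<or> cvec (re2 (\<i> *s v)) $ i \<noteq> 0"
    by (auto simp: complex_eq_iff)
  then show ?thesis
    using cand[of 1] cand[of \<i>] by (metis zero_index)
next
  case False
  then show ?thesis
    using v by blast
qed

text \<open>If \<open>p(A) = 0\<close>, every eigenvector \<open>v\<close> is split off by a left eigenvector \<open>l\<close> with \<open>l v \<noteq> 0\<close>,
  taken from a row of \<open>(p / (X - \<alpha>))(A)\<close>; it is nonzero on \<open>v\<close> because \<open>\<alpha>\<close> is a simple root. The
  rank one map \<open>v l\<close> plus its conjugate is a real projection \<open>R\<close> commuting with \<open>A\<close>, and \<open>P = 1 + R\<close>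
  doubles the vector \<open>2 Re (c v)\<close>.\<close>

lemma isospectral_shears_of_semisimple:
  fixes A :: "int^'n^'n"
  assumes A: "hyperbolic_automorphism A" and T: "T = transpose A"
    and p: "minimal_int_poly \<mu> p" "degree p < CARD('n)" and ann: "\<And>x. mact A p x = 0"
  shows "\<exists>(m::int^'n) \<alpha> v. m \<noteq> 0 \<and> mact T p m = 0 \<and> isospectral_resonance A m \<alpha> v"
proof -
  let ?C = "map_matrix complex_of_int A" and ?L = "map_matrix real_of_int A"
  define m :: "int^'n" where "m = axis undefined 1"
  have "m \<noteq> 0"
    by (simp add: m_def axis_eq_0_iff)
  have mT: "mact T p m = 0"
    by (rule mact_eq_0_transpose[OF T ann])
  have "p \<noteq> 0"
    using p(1) by (simp add: minimal_int_poly_def)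
  then obtain z where z: "z \<noteq> 0" "\<And>k. dotp (((*v) T ^^ k) m) z = 0"
    using integer_vector_orthogonal_to_orbit[OF _ p(2) mT] by blast
  obtain q \<alpha> where \<alpha>: "1 < cmod \<alpha>" and ne: "mact ?C q (int_vec z) \<noteq> 0"
    and eig: "?C *v mact ?C q (int_vec z) = \<alpha> *s mact ?C q (int_vec z)"
    using integer_vector_has_unstable_eigenvector[OF A z(1)] by blast
  have "dotp (int_vec m) (((*v) ?C ^^ k) (int_vec z)) = 0" for k
    using z(2)[of k] unfolding dotp_transpose_power[OF T] by (simp add: int_vec_mult_power dotp_int_vec)
  moreover have "dotp w (sum f S) = (\<Sum>i\<in>S. dotp w (f i))" for w :: "complex^'n" and f :: "nat \<Rightarrow> complex^'n" and S
    by (induction S rule: infinite_finite_induct) (simp_all add: dotp_add_right)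
  ultimately have "dotp (int_vec m) (mact ?C q (int_vec z)) = 0"
    by (subst poly_as_sum_of_monoms[of q, symmetric])
       (simp add: mat_act.act_sum_left mat_act.act_monom dotp_scale_right)
  then obtain v where v: "v \<noteq> 0" "?C *v v = \<alpha> *s v" "dotp (int_vec m) v = 0"
    and real: "cnj \<alpha> = \<alpha> \<Longrightarrow> cnjv v = v"
    using real_eigenvector_choice[OF ne eig] by blast
  obtain i where i: "v $ i \<noteq> 0"
    using v(1) by (auto simp: vec_eq_iff)
  have p0: "mact ?C (of_int_poly p) y = 0" for y
    by (rule mact_eq_0_complex[OF ann])
  have root: "poly (of_int_poly p) \<alpha> = 0"
    using p0[of v] i unfolding mat_act.act_eigen[OF v(2)] by (auto simp: vec_eq_iff)
  then obtain r where r: "of_int_poly p = [:-\<alpha>, 1:] * r"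
    unfolding poly_eq_0_iff_dvd dvd_def by blast
  have r\<alpha>: "poly r \<alpha> \<noteq> 0"
    by (rule minimal_int_poly_simple_root[OF minimal_int_poly_other_root[OF p(1) root] r])
  define l where "l = (\<lambda>y. mact ?C r y $ i)"
  have l_add: "l (x + y) = l x + l y" and l_scale: "l (b *s y) = b * l y" for x y b
    by (simp_all add: l_def mat_act.act_add_right mat_act.act_scale_right)
  have l_eig: "l (?C *v y) = \<alpha> * l y" for y
  proof -
    have "?C *v mact ?C r y - \<alpha> *s mact ?C r y = 0"
      using p0[of y] unfolding r mat_act.act_mult mat_act.act_linear_factor .
    then show ?thesis
      by (simp add: l_def mat_act.act_T)
  qed
  have lv: "l v \<noteq> 0"
    using r\<alpha> i by (simp add: l_def mat_act.act_eigen[OF v(2)])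
  have "cnjv (\<alpha> *s v) = cnj \<alpha> *s cnjv v"
    by (simp add: vec_eq_iff)
  then have "\<alpha> * l (cnjv v) = cnj \<alpha> * l (cnjv v)"
    by (metis l_eig[of "cnjv v"] map_matrix_cnjv v(2) l_scale)
  then have l_cnj: "l (cnjv v) = 0" if "cnj \<alpha> \<noteq> \<alpha>"
    using that \<open>\<alpha> * l (cnjv v) = cnj \<alpha> * l (cnjv v)\<close> by (metis mult_right_cancel)
  \<comment> \<open>For real \<open>\<alpha>\<close> the terms \<open>v l\<close> and its conjugate coincide, hence the factor 2.\<close>
  define s where "s = (if cnj \<alpha> = \<alpha> then 1 / (2 * l v) else 1 / l v)"
  define R where "R = (\<lambda>x. re2 ((s * l (cvec x)) *s v))"
  have R_fix: "R (re2 (c *s v)) = re2 (c *s v)" for c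
  proof -
    have "cnjv (c *s v) = cnj c *s cnjv v"
      by (simp add: vec_eq_iff)
    then have l_re2: "l (cvec (re2 (c *s v))) = c * l v + cnj c * l (cnjv v)"
      by (simp add: cvec_re2 l_add l_scale)
    show ?thesis
    proof (cases "cnj \<alpha> = \<alpha>")
      case True
      then have "v $ j \<in> \<real>" for j
        using real by (metis cnjv_nth Reals_cnj_iff)
      moreover have "s * l (cvec (re2 (c *s v))) = of_real (Re c)"
      proof -
        have "cnjv v = v"
          using real True .
        then have "l (cvec (re2 (c *s v))) = (c + cnj c) * l v"
          by (simp add: l_re2 distrib_right)
        also have "\<dots> = 2 * of_real (Re c) * l v"
          by (simp add: complex_add_cnj)
        finally show ?thesis
          using True lv by (simp add: s_def)
      qed
      ultimately show ?thesis
        by (simp add: R_def vec_eq_iff complex_is_Real_iff)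
    next
      case False
      then show ?thesis
        using lv by (simp add: R_def l_re2 s_def l_cnj)
    qed
  qed
  define P where "P = (\<lambda>x. x + R x)"
  have R_lin: "linear R"
    by (rule linearI)
       (simp_all add: R_def cvec_add cvec_scaleR l_add l_scale vec_eq_iff algebra_simps)
  have P_lin: "linear P"
    unfolding P_def by (intro linear_compose_add linear_ident R_lin)
  have P_inj: "x = 0" if "P x = 0" for x
  proof -
    have "R (R x) = R x"
      by (simp only: R_def[THEN fun_cong, of x] R_fix)
    moreover have "x = - R x"
      using that by (simp add: P_def eq_neg_iff_add_eq_0)
    ultimately have "R x = - R x"
      by (metis linear_neg R_lin)
    then have "R x = 0"
      by (simp add: vec_eq_iff)
    then show ?thesis
      using \<open>x = - R x\<close> by simp
  qed
  have P_comm: "P (?L *v x) = ?L *v P x" for x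
  proof -
    have "cvec (?L *v x) = ?C *v cvec x"
      by (simp add: map_matrix_cvec)
    then have "R (?L *v x) = ?L *v R x"
      by (simp add: R_def map_matrix_re2 l_eig mat_act.T_scale v(2) mult_ac)
    then show ?thesis
      by (simp add: P_def mat_act.T_add)
  qed
  have P_m: "dotp (int_vec m) (P x) = dotp (int_vec m) x" for x
    by (simp add: P_def R_def dotp_add_right dotp_re2 dotp_scale_right v(3))
  have "\<alpha> \<noteq> 0"
    using \<alpha> by auto
  have "\<exists>a b. b - a = re2 (c *s v) \<and> shear_vector A m a \<and> shear_vector A m b \<and> isospectral_shears A m a b" for c
  proof (intro exI conjI)
    let ?a = "re2 (c *s v)"
    show "P ?a - ?a = re2 (c *s v)"
      by (simp add: P_def R_fix)
    show "shear_vector A m ?a"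
      by (rule shear_vector_eigen[OF v(2) \<open>\<alpha> \<noteq> 0\<close> v(3)])
    have "P ?a = re2 ((2 * c) *s v)"
      by (simp add: P_def R_fix vec_eq_iff)
    then show "shear_vector A m (P ?a)"
      using shear_vector_eigen[OF v(2) \<open>\<alpha> \<noteq> 0\<close> v(3), of "2 * c"] by simp
    show "isospectral_shears A m ?a (P ?a)"
      by (rule isospectral_shears_of_commuting_map[OF P_lin P_inj P_comm P_m]) auto
  qed
  then show ?thesis
    unfolding isospectral_resonance_def using \<open>m \<noteq> 0\<close> mT \<alpha> v by blast
qed

text \<open>If \<open>v\<close> is an eigenvector, all shear terms of the cocycle are multiples of \<open>v\<close> and \<open>cnj v\<close>;
  this covector gives the coefficient of \<open>v\<close>.\<close>

primrec shear_functional :: "int^'n^'n \<Rightarrow> int^'n \<Rightarrow> complex \<Rightarrow> (nat \<Rightarrow> real) \<Rightarrow> nat \<Rightarrow> complex^'n" where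
  "shear_functional T m \<alpha> e 0 = 0"
| "shear_functional T m \<alpha> e (Suc n) = \<alpha> *s shear_functional T m \<alpha> e n +
     of_real (e n) *s int_vec (((*v) T ^^ n) m)"

lemma shear_functional_vanishes:
  assumes "\<And>k. dotp (int_vec (((*v) T ^^ k) m)) v = 0"
  shows "dotp (shear_functional T m \<alpha> e n) v = 0"
  by (induction n) (simp_all add: dotp_add_left dotp_scale_left assms)

lemma shear_functional_mact:
  fixes T :: "int^'n^'n"
  shows "shear_functional T (mact T p m) \<alpha> e n = mact (map_matrix of_int T) (of_int_poly p) (shear_functional T m \<alpha> e n)"
  by (induction n)
     (simp_all add: mat_act.act_add_right mat_act.act_scale_right int_vec_mact flip: mat_act.act_T_power)

lemma shear_cocycle_explicit:
  fixes A :: "int^'n^'n"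
  assumes T: "T = transpose A" and v: "map_matrix of_int A *v v = \<alpha> *s v" "dotp (int_vec m) v = 0"
  shows "shear_cocycle A m (re2 v) e n x =
    ((*v) (map_matrix of_int A) ^^ n) x + re2 (dotp (shear_functional T m \<alpha> e n) (cvec x) *s v)"
proof (induction n)
  case (Suc n)
  let ?L = "map_matrix real_of_int A" and ?w = "dotp (shear_functional T m \<alpha> e n) (cvec x)"
  let ?d = "dotp (int_vec m) (((*v) ?L ^^ n) x)"
  have "map_matrix real_of_int T = transpose ?L"
    by (simp add: T map_matrix_transpose)
  then have "dotp (int_vec (((*v) T ^^ n) m)) x = ?d"
    by (metis dotp_transpose_power int_vec_mult_power)
  then have "dotp (shear_functional T m \<alpha> e (Suc n)) (cvec x) = \<alpha> * ?w + of_real (e n * ?d)"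
    by (simp add: dotp_add_left dotp_scale_left dotp_cvec)
  then have "re2 (dotp (shear_functional T m \<alpha> e (Suc n)) (cvec x) *s v) =
      re2 (\<alpha> * ?w *s v) + (e n * ?d) *s re2 v"
    by (simp only: vec.scale_left_distrib re2_add re2_scale)
  moreover have "?L *v re2 (?w *s v) = re2 (\<alpha> * ?w *s v)"
    by (simp add: map_matrix_re2 mat_act.T_scale v(1) mult.commute)
  moreover have "dotp (int_vec m) (((*v) ?L ^^ n) x + re2 (?w *s v)) = ?d"
    by (simp add: dotp_add_right dotp_re2 dotp_scale_right v(2))
  ultimately show ?case
    using Suc by (simp add: mat_act.T_add)
qed simp

lemma jordan_chain_power:
  assumes w: "B *v w = \<beta> *s w + v" "B *v v = \<beta> *s (v :: complex^'n)"
  shows "((*v) B ^^ n) w = \<beta> ^ n *s w + (of_nat n * \<beta> ^ (n - 1)) *s v"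
proof (induction n)
  case (Suc n)
  have "((*v) B ^^ Suc n) w = \<beta> ^ n *s (\<beta> *s w + v) + (of_nat n * \<beta> ^ (n - 1)) *s (\<beta> *s v)"
    by (simp add: Suc mat_act.T_add mat_act.T_scale w)
  also have "\<dots> = \<beta> ^ Suc n *s w + (of_nat (Suc n) * \<beta> ^ (Suc n - 1)) *s v"
    by (cases n) (simp_all add: vec_eq_iff algebra_simps)
  finally show ?case .
qed simp

lemma shear_functional_bound:
  assumes "\<And>k. dotp (int_vec (((*v) T ^^ k) m)) w = \<beta> ^ k * d" and "cmod \<beta> = cmod \<alpha>" "\<alpha> \<noteq> 0"
    and e: "\<And>j. \<bar>e j\<bar> \<le> \<epsilon>"
  shows "cmod (dotp (shear_functional T m \<alpha> e n) w) \<le> real n * \<epsilon> * cmod d * cmod \<alpha> ^ (n - 1)"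
proof (induction n)
  case (Suc n)
  let ?s = "\<lambda>n. dotp (shear_functional T m \<alpha> e n) w"
  have "cmod (?s (Suc n)) \<le> cmod \<alpha> * cmod (?s n) + \<bar>e n\<bar> * (cmod \<alpha> ^ n * cmod d)"
    using norm_triangle_ineq[of "\<alpha> * ?s n" "of_real (e n) * (\<beta> ^ n * d)"]
    by (simp add: dotp_add_left dotp_scale_left assms norm_mult norm_power)
  also have "\<dots> \<le> cmod \<alpha> * (real n * \<epsilon> * cmod d * cmod \<alpha> ^ (n - 1)) + \<epsilon> * (cmod \<alpha> ^ n * cmod d)"
    using Suc e by (intro add_mono mult_left_mono mult_right_mono) auto
  also have "\<dots> = real (Suc n) * \<epsilon> * cmod d * cmod \<alpha> ^ (Suc n - 1)"
    by (cases n) (simp_all add: algebra_simps)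
  finally show ?case .
qed simp

text \<open>The shear along \<open>2 Re v\<close> is compared with \<open>A\<close> itself. Writing \<open>A\<^sup>n + 2 Re (v \<omega>)\<close> for the
  cocycle, \<open>P = 1 + 2 Re (v \<kappa>)\<close> conjugates it to \<open>A\<^sup>n\<close> as soon as \<open>\<kappa> (A\<^sup>n - \<alpha>\<^sup>n) = \<omega>\<close>. Because \<open>\<omega>\<close>
  is in the image of \<open>p(A)\<close> and \<open>p(A)\<^sup>2 = 0\<close>, such a \<open>\<kappa>\<close> is given by the polynomial identity above.
  \<open>P\<close> is invertible if \<open>\<kappa> v\<close> and \<open>\<kappa> (cnj v)\<close> are small, and the Jordan chain \<open>w, v\<close> shows this:
  \<open>(A\<^sup>n - \<alpha>\<^sup>n) w = n \<alpha>\<^bsup>n - 1\<^esup> v\<close> grows as fast as the \<open>n\<close> terms of \<open>\<omega> w\<close>, so \<open>\<kappa> v\<close> is an average of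
  the numbers \<open>e j\<close> times \<open>m w\<close>; \<open>\<kappa> (cnj v)\<close> vanishes or is bounded in the same way, uniformly in
  \<open>n\<close>.\<close>

lemma isospectral_shears_of_jordan_chain:
  fixes A :: "int^'n^'n" and m' :: "int^'n" and p :: "int poly"
  defines "m \<equiv> mact (transpose A) p m'"
  assumes sq: "\<And>x. mact A (p * p) x = 0" and \<alpha>: "\<alpha> \<noteq> 0"
    and v: "map_matrix of_int A *v v = \<alpha> *s v" and w: "map_matrix of_int A *v w = \<alpha> *s w + v"
    and mv: "dotp (int_vec m) v = 0"
  shows "isospectral_shears A m 0 (re2 v)"
proof -
  define T where "T = transpose A"
  let ?C = "map_matrix complex_of_int A" and ?L = "map_matrix real_of_int A"
  let ?D = "map_matrix complex_of_int T" and ?p = "of_int_poly p :: complex poly"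
  have m: "m = mact T p m'"
    by (simp only: m_def T_def)
  have TC: "?D = transpose ?C"
    by (simp add: T_def map_matrix_transpose)
  have "mact T (p * p) z = 0" for z
    by (rule mact_eq_0_transpose[OF T_def sq])
  then have sqD: "mact ?D (?p * ?p) z = 0" for z
    by (metis mact_eq_0_complex of_int_poly_mult)
  have power_T: "dotp (int_vec (((*v) T ^^ k) m)) z = dotp (int_vec m) (((*v) ?C ^^ k) z)" for k and z :: "complex^'n"
    using dotp_transpose_power[OF TC, of k "int_vec m" z] by (simp add: int_vec_mult_power)
  have cnj_scale: "cnjv (b *s z) = cnj b *s cnjv z" and cnj_add: "cnjv (y + z) = cnjv y + cnjv z" for b y z
    by (simp_all add: vec_eq_iff)
  have v': "?C *v cnjv v = cnj \<alpha> *s cnjv v" and w': "?C *v cnjv w = cnj \<alpha> *s cnjv w + cnjv v"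
    by (simp_all only: map_matrix_cnjv v w cnj_scale cnj_add)
  have mv': "dotp (int_vec m) (cnjv v) = 0"
    by (simp add: dotp_cnjv mv)
  define \<epsilon> where "\<epsilon> = 1 / (4 * (1 + cmod (dotp (int_vec m) w)))"
  have \<epsilon>: "\<epsilon> > 0" "2 * (\<epsilon> * cmod (dotp (int_vec m) w)) < 1"
  proof -
    have pos: "1 + cmod (dotp (int_vec m) w) > 0"
      by (intro add_pos_nonneg) auto
    then show "\<epsilon> > 0"
      by (simp add: \<epsilon>_def)
    then show "2 * (\<epsilon> * cmod (dotp (int_vec m) w)) < 1"
      using pos by (simp add: \<epsilon>_def divide_simps)
  qed
  have "conjugate_linear_maps (shear_cocycle A m 0 e n) (shear_cocycle A m (re2 v) e n)"
    if e: "\<And>j. \<bar>e j\<bar> \<le> \<epsilon>" for e n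
  proof (cases "n = 0")
    case True
    then show ?thesis
      unfolding conjugate_linear_maps_def
      by (intro exI[of _ id]) (auto simp: linear_id fun_eq_iff)
  next
    case False
    define u where "u = shear_functional T m \<alpha> e n"
    obtain a b where ab: "?p = a * (?p * ?p) + b * (monom 1 n - [:\<alpha> ^ n:])"
      using combination_of_square_and_power[of n "\<alpha> ^ n" ?p] False \<alpha> by auto
    \<comment> \<open>\<open>k\<close> is the covector \<open>\<kappa>\<close> and \<open>u\<close> is \<open>\<omega>\<close>.\<close>
    define k where "k = mact ?D b (shear_functional T m' \<alpha> e n)"
    have g: "mact B (monom 1 n - [:\<alpha> ^ n:]) z = ((*v) B ^^ n) z - \<alpha> ^ n *s z" for B and z :: "complex^'n"
    proof -
      have "monom 1 n - [:\<alpha> ^ n:] = monom 1 n + [:- (\<alpha> ^ n):]"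
        by simp
      then show ?thesis
        by (simp only: mat_act.act_add_left mat_act.act_monom mat_act.act_const) simp
    qed
    have "u = mact ?D ?p (shear_functional T m' \<alpha> e n)"
      unfolding u_def m by (rule shear_functional_mact)
    also have "\<dots> = mact ?D ((?p * ?p) * a) (shear_functional T m' \<alpha> e n) +
        mact ?D ((monom 1 n - [:\<alpha> ^ n:]) * b) (shear_functional T m' \<alpha> e n)"
      by (subst ab) (simp only: mat_act.act_add_left mult.commute)
    also have "\<dots> = mact ?D (monom 1 n - [:\<alpha> ^ n:]) k"
      by (simp only: mat_act.act_mult[of _ "?p * ?p"] mat_act.act_mult[of _ "monom 1 n - [:\<alpha> ^ n:]"]
          sqD k_def add_0_left)
    finally have uk: "u = mact ?D (monom 1 n - [:\<alpha> ^ n:]) k" .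
    have key: "dotp k (((*v) ?C ^^ n) z) = \<alpha> ^ n * dotp k z + dotp u z" for z
    proof -
      have "dotp u z = dotp k (((*v) ?C ^^ n) z - \<alpha> ^ n *s z)"
        unfolding uk by (subst dotp_mact[OF TC]) (simp only: g)
      also have "\<dots> = dotp k (((*v) ?C ^^ n) z) - \<alpha> ^ n * dotp k z"
        by (simp add: dotp_def algebra_simps sum_subtractf sum_distrib_left)
      finally show ?thesis
        by simp
    qed
    \<comment> \<open>Stated for a general chain so as to apply to \<open>v\<close> and to \<open>cnj v\<close>, with eigenvalues \<open>\<alpha>\<close> and \<open>cnj \<alpha>\<close>.\<close>
    have small: "cmod (dotp k v1) \<le> \<epsilon> * cmod (dotp (int_vec m) w1)"
      if v1: "?C *v v1 = \<beta> *s v1" and w1: "?C *v w1 = \<beta> *s w1 + v1" and mv1: "dotp (int_vec m) v1 = 0"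
        and \<beta>: "cmod \<beta> = cmod \<alpha>" for v1 w1 \<beta>
    proof -
      have "dotp u v1 = 0"
        unfolding u_def
        by (rule shear_functional_vanishes)
           (simp add: power_T mat_act.T_power_eigen[OF v1] dotp_scale_right mv1)
      then have 1: "(\<beta> ^ n - \<alpha> ^ n) * dotp k v1 = 0"
        using key[of v1] by (simp add: mat_act.T_power_eigen[OF v1] dotp_scale_right algebra_simps)
      show ?thesis
      proof (cases "\<beta> ^ n = \<alpha> ^ n")
        case True
        have "\<beta> \<noteq> 0"
          using \<beta> \<alpha> by auto
        have "of_nat n * \<beta> ^ (n - 1) * dotp k v1 = dotp u w1"
          using key[of w1] True
          by (simp add: jordan_chain_power[OF w1 v1] dotp_add_right dotp_scale_right)
        moreover have "cmod (dotp u w1) \<le> real n * \<epsilon> * cmod (dotp (int_vec m) w1) * cmod \<alpha> ^ (n - 1)"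
          unfolding u_def
        proof (rule shear_functional_bound[OF _ \<beta> \<alpha> e])
          show "dotp (int_vec (((*v) T ^^ j) m)) w1 = \<beta> ^ j * dotp (int_vec m) w1" for j
            by (simp add: power_T jordan_chain_power[OF w1 v1] dotp_add_right dotp_scale_right mv1)
        qed
        ultimately have "real n * cmod \<alpha> ^ (n - 1) * cmod (dotp k v1) \<le>
            real n * cmod \<alpha> ^ (n - 1) * (\<epsilon> * cmod (dotp (int_vec m) w1))"
          by (metis (no_types, opaque_lifting) \<beta> mult.assoc mult.commute norm_mult norm_of_nat norm_power)
        then show ?thesis
          using False \<alpha> by (subst (asm) mult_le_cancel_left_pos) auto
      next
        case False
        then show ?thesis
          using 1 \<epsilon>(1) by simp
      qed
    qed
    have "cmod (dotp k v) + cmod (dotp k (cnjv v)) < 1"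
      using small[OF v w mv] small[OF v' w' mv'] \<epsilon>(2) by (simp add: dotp_cnjv)
    define P where "P = (\<lambda>x. x + re2 (dotp k (cvec x) *s v))"
    have P_lin: "linear P"
      by (rule linearI)
         (simp_all add: P_def cvec_add cvec_scaleR dotp_add_right dotp_scale_right vec_eq_iff algebra_simps)
    have P_inj: "x = 0" if "P x = 0" for x
    proof -
      let ?z = "dotp k (cvec x)"
      have "x + re2 (?z *s v) = 0"
        using that by (simp add: P_def)
      then have "cvec x + cvec (re2 (?z *s v)) = 0"
        by (metis cvec_add cvec_scale of_real_0 vec.scale_zero_left)
      then have "?z + (?z * dotp k v + cnj ?z * dotp k (cnjv v)) = 0"
        using arg_cong[of _ 0 "dotp k"]
        by (simp only: cvec_re2 cnj_scale) (metis dotp_0_right dotp_add_right dotp_scale_right)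
      then have "cmod ?z = cmod (?z * dotp k v + cnj ?z * dotp k (cnjv v))"
        by (metis add_eq_0_iff norm_minus_cancel)
      also have "\<dots> \<le> cmod ?z * (cmod (dotp k v) + cmod (dotp k (cnjv v)))"
        by (rule order_trans[OF norm_triangle_ineq]) (simp add: norm_mult distrib_left)
      finally have "cmod ?z * (1 - (cmod (dotp k v) + cmod (dotp k (cnjv v)))) \<le> 0"
        by (simp add: algebra_simps)
      then have "?z = 0"
        using \<open>cmod (dotp k v) + cmod (dotp k (cnjv v)) < 1\<close>
        by (simp add: mult_le_0_iff)
      then show ?thesis
        using that by (simp add: P_def)
    qed
    have "P (shear_cocycle A m 0 e n x) = shear_cocycle A m (re2 v) e n (P x)" for x
    proof -
      let ?z = "dotp k (cvec x)"
      have "shear_cocycle A m 0 e j x = ((*v) ?L ^^ j) x" for j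
        by (induction j) simp_all
      then have "P (shear_cocycle A m 0 e n x) = ((*v) ?L ^^ n) x + re2 ((\<alpha> ^ n * ?z + dotp u (cvec x)) *s v)"
        by (simp add: P_def key flip: map_matrix_power_cvec)
      moreover have "dotp u v = 0" "dotp u (cnjv v) = 0"
        unfolding u_def
        by (rule shear_functional_vanishes,
            simp add: power_T mat_act.T_power_eigen[OF v] mat_act.T_power_eigen[OF v'] dotp_scale_right mv mv')+
      then have "dotp u (cvec (P x)) = dotp u (cvec x)"
        by (simp add: P_def cvec_add cvec_re2 cnj_scale dotp_add_right dotp_scale_right)
      then have "shear_cocycle A m (re2 v) e n (P x) = ((*v) ?L ^^ n) (P x) + re2 (dotp u (cvec x) *s v)"
        unfolding shear_cocycle_explicit[OF T_def v mv] u_def by simp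
      moreover have "((*v) ?L ^^ n) (P x) = ((*v) ?L ^^ n) x + re2 ((\<alpha> ^ n * ?z) *s v)"
        by (simp add: P_def mat_act.T_power_add map_matrix_power_re2 mat_act.T_power_scale
            mat_act.T_power_eigen[OF v] mult.commute)
      ultimately show ?thesis
        by (simp add: re2_add vec.scale_left_distrib add.assoc)
    qed
    then show ?thesis
      unfolding conjugate_linear_maps_def
      using P_lin injective_linear_imp_bij[OF P_lin P_inj] by (intro exI[of _ P]) auto
  qed
  then show ?thesis
    unfolding isospectral_shears_def using \<epsilon>(1) by blast
qed

text \<open>Taking \<open>m\<close> and \<open>v\<close> in the images of \<open>p(A)\<close>, on the side of covectors and of vectors, makes \<open>v\<close>
  the bottom of a Jordan chain and puts \<open>m\<close> into the form required by the preceding lemma.\<close>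

lemma isospectral_shears_of_square_zero:
  fixes A :: "int^'n^'n"
  assumes A: "hyperbolic_automorphism A" and T: "T = transpose A"
    and sq: "\<And>x. mact A p (mact A p x) = 0" and x: "mact A p x \<noteq> 0"
  shows "\<exists>(m::int^'n) \<alpha> v. m \<noteq> 0 \<and> mact T p m = 0 \<and> isospectral_resonance A m \<alpha> v"
proof -
  let ?C = "map_matrix complex_of_int A" and ?L = "map_matrix real_of_int A"
  let ?D = "map_matrix complex_of_int T" and ?p = "of_int_poly p :: complex poly"
  have TC: "?D = transpose ?C"
    by (simp add: T map_matrix_transpose)
  have "\<exists>m'. mact T p m' \<noteq> 0"
  proof (rule ccontr)
    assume "\<not> ?thesis"
    moreover have "A = transpose T"
      by (simp add: T)
    ultimately show False
      using mact_eq_0_transpose[of A T p] x by blast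
  qed
  then obtain m' where m': "mact T p m' \<noteq> 0"
    by blast
  define m where "m = mact T p m'"
  have sqA: "mact A (p * p) y = 0" for y
    by (simp add: mat_act.act_mult sq)
  then have sqC: "mact ?C (?p * ?p) y = 0" for y
    by (metis mact_eq_0_complex of_int_poly_mult)
  have sqT: "mact T (p * p) y = 0" for y
    by (rule mact_eq_0_transpose[OF T sqA])
  obtain q \<alpha> where \<alpha>: "1 < cmod \<alpha>" and ne: "mact ?C q (int_vec (mact A p x)) \<noteq> 0"
    and eig: "?C *v mact ?C q (int_vec (mact A p x)) = \<alpha> *s mact ?C q (int_vec (mact A p x))"
    using integer_vector_has_unstable_eigenvector[OF A x] by blast
  define y where "y = mact ?C q (int_vec x)"
  define v where "v = mact ?C ?p y"
  have "v = mact ?C q (int_vec (mact A p x))"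
    unfolding v_def y_def by (simp add: mat_act.act_commute flip: int_vec_mact)
  then have v: "v \<noteq> 0" "?C *v v = \<alpha> *s v"
    using ne eig by auto
  have "poly ?p \<alpha> *s v = 0"
    using sqC[of y] mat_act.act_eigen[OF v(2), of ?p] by (simp add: v_def mat_act.act_mult)
  then have "poly ?p \<alpha> = 0"
    using v(1) by simp
  then obtain r where r: "?p = [:-\<alpha>, 1:] * r"
    unfolding poly_eq_0_iff_dvd dvd_def by blast
  define w where "w = mact ?C r y"
  have w: "?C *v w = \<alpha> *s w + v"
    using v_def unfolding r mat_act.act_mult mat_act.act_linear_factor w_def by (simp add: algebra_simps)
  have "int_vec m = mact ?D ?p (int_vec m')"
    by (simp add: m_def int_vec_mact)
  then have mv: "dotp (int_vec m) v = 0"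
    using sqC[of y] by (simp add: dotp_mact[OF TC] v_def mat_act.act_mult)
  have "\<alpha> \<noteq> 0"
    using \<alpha> by auto
  have "\<exists>a b. b - a = re2 (c *s v) \<and> shear_vector A m a \<and> shear_vector A m b \<and> isospectral_shears A m a b" for c
  proof (intro exI conjI)
    show "re2 (c *s v) - 0 = re2 (c *s v)"
      by simp
    show "shear_vector A m 0"
      unfolding shear_vector_def by (auto intro!: exI[of _ 0])
    show "shear_vector A m (re2 (c *s v))"
      by (rule shear_vector_eigen[OF v(2) \<open>\<alpha> \<noteq> 0\<close> mv])
    have "?C *v (c *s v) = \<alpha> *s (c *s v)" "?C *v (c *s w) = \<alpha> *s (c *s w) + c *s v"
      by (simp_all add: mat_act.T_scale v w vec.scale_right_distrib mult.commute)
    then show "isospectral_shears A m 0 (re2 (c *s v))"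
      using isospectral_shears_of_jordan_chain[OF sqA \<open>\<alpha> \<noteq> 0\<close>, of "c *s v" "c *s w" m'] mv
      unfolding T[symmetric] m_def[symmetric] by (simp add: dotp_scale_right)
  qed
  moreover have "m \<noteq> 0" "mact T p m = 0"
    using m' sqT[of m'] by (simp_all add: m_def mat_act.act_mult)
  ultimately show ?thesis
    unfolding isospectral_resonance_def using \<alpha> v mv by blast
qed

text \<open>The three cases are \<open>p(A)\<^sup>2 \<noteq> 0\<close>, \<open>p(A) = 0\<close> and \<open>p(A) \<noteq> 0 = p(A)\<^sup>2\<close>.\<close>

lemma resonant_shears_exist:
  fixes A :: "int^'n^'n"
  assumes A: "hyperbolic_automorphism A" and red: "\<not> irreducible (charpoly (map_matrix rat_of_int A))"
    and T: "T = transpose A"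
  shows "\<exists>m \<alpha> v. isospectral_resonance A m \<alpha> v \<and>
    (\<forall>j k. j \<noteq> k \<longrightarrow> ((*v) T ^^ j) m \<noteq> ((*v) T ^^ k) m \<and> ((*v) T ^^ j) m \<noteq> - ((*v) T ^^ k) m) \<and>
    (\<forall>k. ((*v) T ^^ k) m \<noteq> 0) \<and>
    (\<exists>i. \<not> (\<lambda>k. of_int (((*v) T ^^ k) m $ i) / cmod \<alpha> ^ k) \<longlonglongrightarrow> (0::real))"
proof -
  obtain \<mu> u where u: "u \<noteq> 0" "map_matrix of_int A *v u = \<mu> *s u"
    and dom: "\<And>\<beta> w. w \<noteq> 0 \<Longrightarrow> map_matrix of_int A *v w = \<beta> *s w \<Longrightarrow> cmod \<beta> \<le> cmod \<mu>"
    using dominant_eigenvalue_exists[OF A] by blast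
  obtain p where p: "minimal_int_poly \<mu> p" "degree p < CARD('n)"
    using reducible_charpoly_minimal_degree[OF A red u] by blast
  then have p0: "poly (of_int_poly p) \<mu> = 0"
    by (auto simp: minimal_int_poly_def)
  obtain l where l: "l \<noteq> (0::complex^'n)" "map_matrix of_int T *v l = \<mu> *s l"
    using eigenvalue_transpose[OF u] unfolding T[symmetric] by blast
  consider x where "mact A p (mact A p x) \<noteq> 0" | "\<And>x. mact A p x = 0"
    | x where "\<And>x. mact A p (mact A p x) = 0" "mact A p x \<noteq> 0"
    by metis
  then have "\<exists>(m::int^'n) \<alpha> v. m \<noteq> 0 \<and> mact T p m = 0 \<and> isospectral_resonance A m \<alpha> v"
  proof cases
    case 1
    then show ?thesis
      by (rule isospectral_shears_of_nonnilpotent_square[OF A T l p0])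
  next
    case 2
    then show ?thesis
      by (rule isospectral_shears_of_semisimple[OF A T p])
  next
    case 3
    then show ?thesis
      by (rule isospectral_shears_of_square_zero[OF A T])
  qed
  then obtain m :: "int^'n" and \<alpha> v where m: "m \<noteq> 0" "mact T p m = 0"
    and res: "isospectral_resonance A m \<alpha> v"
    by blast
  then have \<alpha>: "1 < cmod \<alpha>" and v: "v \<noteq> 0" "map_matrix of_int A *v v = \<alpha> *s v"
    by (simp_all add: isospectral_resonance_def)
  have le: "cmod \<alpha> \<le> cmod \<mu>"
    by (rule dom[OF v])
  then have \<mu>: "1 < cmod \<mu>" and "\<alpha> \<noteq> 0"
    using \<alpha> by auto
  show ?thesis
    using res orbit_distinct[OF p(1) m \<mu>] orbit_nonzero[OF p(1) m \<mu>]
      orbit_growth[OF p(1) m \<mu> \<open>\<alpha> \<noteq> 0\<close> le]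
    by (intro exI[of _ m] exI[of _ \<alpha>] exI[of _ v]) simp
qed

section \<open>Bessel's inequality on the torus\<close>

definition unit_interval_measure :: "real measure" where
  "unit_interval_measure = density lborel (indicator {0..1})"

lemma sets_unit_interval_measure [measurable_cong, simp]: "sets unit_interval_measure = sets borel"
  and space_unit_interval_measure [simp]: "space unit_interval_measure = UNIV"
  by (simp_all add: unit_interval_measure_def)

lemma emeasure_unit_interval_measure: "emeasure unit_interval_measure UNIV = 1"
  by (simp add: unit_interval_measure_def emeasure_density)

interpretation unit_interval: finite_measure unit_interval_measure
  by (rule finite_measureI) (simp add: emeasure_unit_interval_measure)

lemma integrable_unit_interval_cis: "integrable unit_interval_measure (\<lambda>x. cis (c * x))"
proof (rule unit_interval.integrable_const_bound[where B = 1])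
  have "(\<lambda>x. cis (c * x)) \<in> borel_measurable borel"
    unfolding cis_conv_exp by measurable
  then show "(\<lambda>x. cis (c * x)) \<in> borel_measurable unit_interval_measure"
    by (simp cong: measurable_cong_sets)
qed simp

lemma integral_unit_interval_cis:
  "(\<integral>x. cis (2 * pi * of_int n * x) \<partial>unit_interval_measure) = (if n = 0 then 1 else 0)"
proof -
  have 1: "(\<integral>x. cis (2 * pi * of_int n * x) \<partial>unit_interval_measure) =
      (\<integral>x. indicator {0..1} x *\<^sub>R cis (2 * pi * of_int n * x) \<partial>lborel)"
    unfolding unit_interval_measure_def
    by (subst integral_density[where g = "indicator {0..1}", symmetric])
       (auto simp: ennreal_indicator cis_conv_exp)
  show ?thesis
  proof (cases "n = 0")
    case True
    then show ?thesis
      unfolding 1 by (simp add: one_complex.code cis_zero)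
  next
    case False
    let ?F = "\<lambda>x. cis (2 * pi * of_int n * x) / (\<i> * of_real (2 * pi * of_int n))"
    have "(?F has_vector_derivative cis (2 * pi * of_int n * x)) (at x within {0..1})" for x
      using False unfolding cis_conv_exp
      by (auto intro!: derivative_eq_intros has_vector_derivative_real_field simp: field_simps)
    then have "(\<integral>x. indicator {0..1} x *\<^sub>R cis (2 * pi * of_int n * x) \<partial>lborel) = ?F 1 - ?F 0"
      by (intro integral_FTC_Icc) (auto intro!: continuous_intros)
    also have "cis (2 * pi * of_int n * 1) = 1"
      using cis_multiple_2pi[of "of_int n"] by (simp add: mult.commute)
    then have "?F 1 - ?F 0 = 0"
      by simp
    finally show ?thesis
      unfolding 1 using False by simp
  qed
qed

text \<open>The unit cube as a product measure, so that the integral of a character is a product of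
  integrals in one variable.\<close>

definition cube_measure :: "('n::finite \<Rightarrow> real) measure" where
  "cube_measure = Pi\<^sub>M UNIV (\<lambda>_. unit_interval_measure)"

interpretation cube_factor: product_sigma_finite "\<lambda>_::'n::finite. unit_interval_measure"
  by unfold_locales

lemma space_cube_measure [simp]: "space cube_measure = UNIV"
  by (simp add: cube_measure_def space_PiM)

lemma emeasure_cube_measure: "emeasure (cube_measure :: ('n::finite \<Rightarrow> real) measure) UNIV = 1"
proof -
  have "emeasure (cube_measure :: ('n \<Rightarrow> real) measure) (Pi\<^sub>E UNIV (\<lambda>_. UNIV)) = (\<Prod>i\<in>(UNIV::'n set). 1)"
    unfolding cube_measure_def
    by (subst cube_factor.emeasure_PiM) (auto simp: emeasure_unit_interval_measure)
  then show ?thesis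
    by (simp add: PiE_UNIV_domain)
qed

interpretation cube: finite_measure cube_measure
  by (rule finite_measureI) (simp add: emeasure_cube_measure)

lemma measurable_cube_component [measurable]: "(\<lambda>w. w i) \<in> borel_measurable cube_measure"
  unfolding cube_measure_def by measurable

lemma prod_cis: "(\<Prod>i\<in>S. cis (f i)) = cis (\<Sum>i\<in>S. f i)"
  by (induction S rule: infinite_finite_induct) (simp_all add: cis_mult)

lemma integral_cube_cis:
  fixes n :: "int^'n"
  shows "(\<integral>w. cis (2 * pi * dotp (int_vec n) (\<chi> i. w i)) \<partial>cube_measure) = (if n = 0 then 1 else 0)"
proof -
  have "cis (2 * pi * dotp (int_vec n) (\<chi> i. w i)) = (\<Prod>i\<in>UNIV. cis (2 * pi * of_int (n $ i) * w i))" for w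
    by (simp add: dotp_def sum_distrib_left mult.assoc prod_cis)
  then have "(\<integral>w. cis (2 * pi * dotp (int_vec n) (\<chi> i. w i)) \<partial>cube_measure) =
      (\<Prod>i\<in>UNIV. \<integral>x. cis (2 * pi * of_int (n $ i) * x) \<partial>unit_interval_measure)"
    unfolding cube_measure_def
    by (simp only:, subst cube_factor.product_integral_prod)
       (simp_all add: integrable_unit_interval_cis)
  also have "\<dots> = (if n = 0 then 1 else 0)"
    by (auto simp: integral_unit_interval_cis vec_eq_iff)
  finally show ?thesis .
qed

lemma integral_cube_trig:
  fixes n :: "int^'n"
  shows "(\<integral>w. cos (2 * pi * dotp (int_vec n) (\<chi> i. w i)) \<partial>cube_measure) = (if n = 0 then 1 else 0)"
    and "(\<integral>w. sin (2 * pi * dotp (int_vec n) (\<chi> i. w i)) \<partial>cube_measure) = 0"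
proof -
  let ?f = "\<lambda>w. cis (2 * pi * dotp (int_vec n) (\<chi> i. w i))"
  have int: "integrable cube_measure ?f"
    unfolding cis_conv_exp dotp_def
    by (rule cube.integrable_const_bound[where B = 1]) auto
  have "(\<integral>w. Re (?f w) \<partial>cube_measure) = Re (\<integral>w. ?f w \<partial>cube_measure)"
    "(\<integral>w. Im (?f w) \<partial>cube_measure) = Im (\<integral>w. ?f w \<partial>cube_measure)"
    by (rule integral_Re[OF int] integral_Im[OF int])+
  then show "(\<integral>w. cos (2 * pi * dotp (int_vec n) (\<chi> i. w i)) \<partial>cube_measure) = (if n = 0 then 1 else 0)"
    and "(\<integral>w. sin (2 * pi * dotp (int_vec n) (\<chi> i. w i)) \<partial>cube_measure) = 0"
    unfolding integral_cube_cis by auto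
qed

definition cube_cos :: "int^'n \<Rightarrow> ('n \<Rightarrow> real) \<Rightarrow> real" where
  "cube_cos n w = cos (2 * pi * dotp (int_vec n) (\<chi> i. w i))"

definition cube_sin :: "int^'n \<Rightarrow> ('n \<Rightarrow> real) \<Rightarrow> real" where
  "cube_sin n w = sin (2 * pi * dotp (int_vec n) (\<chi> i. w i))"

lemma measurable_cube_cos [measurable]: "cube_cos n \<in> borel_measurable cube_measure"
  and measurable_cube_sin [measurable]: "cube_sin n \<in> borel_measurable cube_measure"
  unfolding cube_cos_def cube_sin_def dotp_def by (simp_all, measurable)

lemma abs_cube_cos [simp]: "\<bar>cube_cos n w\<bar> \<le> 1" and abs_cube_sin [simp]: "\<bar>cube_sin n w\<bar> \<le> 1"
  by (simp_all add: cube_cos_def cube_sin_def)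

lemma dotp_int_vec_add: "dotp (int_vec (m + n)) x = dotp (int_vec m) x + dotp (int_vec n) x"
  and dotp_int_vec_diff: "dotp (int_vec (m - n)) x = dotp (int_vec m) x - dotp (int_vec n) x"
  by (simp_all add: dotp_def algebra_simps sum.distrib sum_subtractf)

lemma integrable_cube_trig [simp]: "integrable cube_measure (cube_cos n)" "integrable cube_measure (cube_sin n)"
  by (rule cube.integrable_const_bound[where B = 1]; simp)+

lemma integrable_cube_trig_mult:
  "integrable cube_measure (\<lambda>w. cube_cos m w * cube_cos n w)"
  "integrable cube_measure (\<lambda>w. cube_cos m w * cube_sin n w)"
proof -
  have "\<bar>cube_cos m w * cube_cos n w\<bar> \<le> 1" "\<bar>cube_cos m w * cube_sin n w\<bar> \<le> 1" for w
    by (simp_all only: abs_mult mult_le_one abs_cube_cos abs_cube_sin abs_ge_zero)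
  then show "integrable cube_measure (\<lambda>w. cube_cos m w * cube_cos n w)"
    "integrable cube_measure (\<lambda>w. cube_cos m w * cube_sin n w)"
    by (auto intro!: cube.integrable_const_bound[where B = 1])
qed

lemma cube_trig_orthogonality:
  shows "(\<integral>w. cube_cos m w * cube_cos n w \<partial>cube_measure) =
      ((if m = n then 1 else 0) + (if m = - n then 1 else 0)) / 2"
    and "(\<integral>w. cube_cos m w * cube_sin n w \<partial>cube_measure) = 0"
proof -
  have eq: "cube_cos m w * cube_cos n w = (cube_cos (m - n) w + cube_cos (m + n) w) / 2" for w
    by (simp add: cube_cos_def dotp_int_vec_add dotp_int_vec_diff cos_add cos_diff algebra_simps)
  have "(\<integral>w. cube_cos m w * cube_cos n w \<partial>cube_measure) =
      ((\<integral>w. cube_cos (m - n) w \<partial>cube_measure) + (\<integral>w. cube_cos (m + n) w \<partial>cube_measure)) / 2"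
    unfolding eq by simp
  also have "\<dots> = ((if m = n then 1 else 0) + (if m = - n then 1 else 0)) / 2"
    unfolding cube_cos_def integral_cube_trig by (simp add: eq_neg_iff_add_eq_0)
  finally show "(\<integral>w. cube_cos m w * cube_cos n w \<partial>cube_measure) =
      ((if m = n then 1 else 0) + (if m = - n then 1 else 0)) / 2" .
  have eq: "cube_cos m w * cube_sin n w = (cube_sin (m + n) w - cube_sin (m - n) w) / 2" for w
    by (simp add: cube_cos_def cube_sin_def dotp_int_vec_add dotp_int_vec_diff sin_add sin_diff algebra_simps)
  have "(\<integral>w. cube_cos m w * cube_sin n w \<partial>cube_measure) =
      ((\<integral>w. cube_sin (m + n) w \<partial>cube_measure) - (\<integral>w. cube_sin (m - n) w \<partial>cube_measure)) / 2"
    unfolding eq by simp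
  then show "(\<integral>w. cube_cos m w * cube_sin n w \<partial>cube_measure) = 0"
    unfolding cube_sin_def integral_cube_trig by simp
qed

text \<open>The function is expanded in two families, but only the cosine coefficients are estimated: the
  partial sum \<open>T\<close> of the cosine terms is orthogonal to all sine terms. The conditions on \<open>K\<close> make
  the characters \<open>\<plusminus>K k\<close> distinct.\<close>

lemma bessel_inequality:
  fixes K :: "nat \<Rightarrow> int^'n" and p q :: "nat \<Rightarrow> complex"
  assumes K: "\<And>j k. j \<noteq> k \<Longrightarrow> K j \<noteq> K k \<and> K j \<noteq> - K k" "\<And>k. K k \<noteq> 0"
    and p: "summable (\<lambda>k. cmod (p k))" and q: "summable (\<lambda>k. cmod (q k))"
    and F: "\<And>w. cmod (\<Sum>k. p k * cube_cos (K k) w + q k * cube_sin (K k) w) \<le> C"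
  shows "(\<Sum>k<N. (cmod (p k))\<^sup>2) \<le> 2 * C\<^sup>2"
proof -
  define f where "f = (\<lambda>k w. p k * cube_cos (K k) w + q k * cube_sin (K k) w)"
  define F where "F = (\<lambda>w. \<Sum>k. f k w)"
  define T where "T = (\<lambda>w. \<Sum>k<N. p k * cube_cos (K k) w)"
  define S where "S = (\<Sum>k<N. (cmod (p k))\<^sup>2)"
  have cc: "(\<integral>w. cube_cos (K j) w * cube_cos (K k) w \<partial>cube_measure) = (if j = k then 1 / 2 else 0)" for j k
  proof (cases "j = k")
    case True
    have "K k \<noteq> - K k"
      using K(2)[of k] by (simp add: vec_eq_iff)
    then show ?thesis
      using True by (simp add: cube_trig_orthogonality)
  qed (use K(1) in \<open>simp add: cube_trig_orthogonality\<close>)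
  have bound_f: "cmod (f k w) \<le> cmod (p k) + cmod (q k)" for k w
    unfolding f_def
    by (rule order_trans[OF norm_triangle_ineq])
       (auto simp: norm_mult intro!: add_mono mult_left_le)
  have sum_pq: "summable (\<lambda>k. cmod (p k) + cmod (q k))"
    using p q by (rule summable_add)
  have summable_f: "summable (\<lambda>k. norm (f k w))" for w
    by (rule summable_comparison_test'[OF sum_pq, of 0]) (use bound_f in auto)
  have [measurable]: "f k \<in> borel_measurable cube_measure" for k
    unfolding f_def by measurable
  have [measurable]: "F \<in> borel_measurable cube_measure" "T \<in> borel_measurable cube_measure"
    unfolding F_def T_def by measurable
  have FC: "cmod (F w) \<le> C" for w
    using F unfolding F_def f_def .
  have C: "0 \<le> C"
    using FC[of undefined] norm_ge_zero order_trans by blast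
  have T_bound: "cmod (T w) \<le> (\<Sum>k<N. cmod (p k))" for w
    unfolding T_def by (rule sum_norm_le) (auto simp: norm_mult intro!: mult_left_le)
  have cosF: "(\<integral>w. cube_cos (K j) w * F w \<partial>cube_measure) = p j / 2" for j
  proof -
    have le: "norm (complex_of_real (cube_cos (K j) w) * f k w) \<le> cmod (p k) + cmod (q k)" for k w
      using mult_mono[OF abs_cube_cos[of "K j" w] bound_f[of k w]] by (simp add: norm_mult)
    have int_c: "integrable cube_measure (\<lambda>w. complex_of_real (cube_cos (K j) w) * f k w)" for k
      by (rule cube.integrable_const_bound[where B = "cmod (p k) + cmod (q k)"])
         (use le[of _ k] in \<open>simp_all del: norm_mult\<close>)
    have coeff: "(\<integral>w. cube_cos (K j) w * f k w \<partial>cube_measure) = (if j = k then p k / 2 else 0)" for k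
    proof -
      have i1: "integrable cube_measure (\<lambda>w. complex_of_real (cube_cos (K j) w * cube_cos (K k) w))"
        and i2: "integrable cube_measure (\<lambda>w. complex_of_real (cube_cos (K j) w * cube_sin (K k) w))"
        using integrable_of_real[OF integrable_cube_trig_mult(1)] integrable_of_real[OF integrable_cube_trig_mult(2)] .
      have "(\<integral>w. cube_cos (K j) w * f k w \<partial>cube_measure) =
          (\<integral>w. p k * complex_of_real (cube_cos (K j) w * cube_cos (K k) w) +
            q k * complex_of_real (cube_cos (K j) w * cube_sin (K k) w) \<partial>cube_measure)"
        by (intro Bochner_Integration.integral_cong) (simp_all add: f_def algebra_simps)
      also have "\<dots> = p k * complex_of_real (\<integral>w. cube_cos (K j) w * cube_cos (K k) w \<partial>cube_measure) +
          q k * complex_of_real (\<integral>w. cube_cos (K j) w * cube_sin (K k) w \<partial>cube_measure)"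
        using i1 i2 by (subst Bochner_Integration.integral_add) (auto simp del: of_real_mult)
      finally show ?thesis
        by (simp add: cc cube_trig_orthogonality(2))
    qed
    have "(\<integral>w. cube_cos (K j) w * F w \<partial>cube_measure) = (\<integral>w. (\<Sum>k. cube_cos (K j) w * f k w) \<partial>cube_measure)"
      unfolding F_def using summable_f by (simp add: suminf_mult summable_norm_cancel)
    also have "\<dots> = (\<Sum>k. \<integral>w. cube_cos (K j) w * f k w \<partial>cube_measure)"
    proof (rule integral_suminf)
      show "integrable cube_measure (\<lambda>w. complex_of_real (cube_cos (K j) w) * f k w)" for k
        by (rule int_c)
      show "AE w in cube_measure. summable (\<lambda>k. norm (complex_of_real (cube_cos (K j) w) * f k w))"
        by (intro AE_I2 summable_comparison_test'[OF sum_pq, of 0]) (use le in simp)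
      have "(\<integral>w. norm (complex_of_real (cube_cos (K j) w) * f k w) \<partial>cube_measure) \<le> cmod (p k) + cmod (q k)" for k
      proof -
        have "(\<integral>w. norm (complex_of_real (cube_cos (K j) w) * f k w) \<partial>cube_measure) \<le>
            (\<integral>w. cmod (p k) + cmod (q k) \<partial>(cube_measure :: ('n \<Rightarrow> real) measure))"
          using le int_c[of k] by (intro integral_mono integrable_norm) auto
        then show ?thesis
          by (simp add: measure_def emeasure_cube_measure)
      qed
      then show "summable (\<lambda>k. \<integral>w. norm (complex_of_real (cube_cos (K j) w) * f k w) \<partial>cube_measure)"
        by (intro summable_comparison_test'[OF sum_pq, of 0]) simp
    qed
    also have "\<dots> = (\<Sum>k. if k = j then p j / 2 else 0)"
      unfolding coeff by (intro arg_cong[of _ _ suminf]) auto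
    also have "\<dots> = p j / 2"
      using sums_unique[OF sums_single[of j "\<lambda>_. p j / 2"]] by simp
    finally show ?thesis .
  qed
  have intF: "integrable cube_measure (\<lambda>w. (cmod (F w))\<^sup>2)"
    using FC by (intro cube.integrable_const_bound[where B = "C\<^sup>2"]) (auto intro!: power_mono)
  have intT: "integrable cube_measure (\<lambda>w. (cmod (T w))\<^sup>2)"
    using T_bound
    by (intro cube.integrable_const_bound[where B = "(\<Sum>k<N. cmod (p k))\<^sup>2"]) (auto intro!: power_mono)
  have intFc: "integrable cube_measure (\<lambda>w. complex_of_real (cube_cos (K j) w) * F w)" for j
    using mult_mono[OF abs_cube_cos FC]
    by (intro cube.integrable_const_bound[where B = C] AE_I2) (simp_all add: norm_mult)
  have "(\<integral>w. F w * cnj (T w) \<partial>cube_measure) = (\<integral>w. (\<Sum>k<N. cnj (p k) * (cube_cos (K k) w * F w)) \<partial>cube_measure)"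
    by (simp add: T_def sum_distrib_left mult_ac)
  also have "\<dots> = (\<Sum>k<N. cnj (p k) * (p k / 2))"
    using intFc by (subst Bochner_Integration.integral_sum) (auto simp: cosF)
  also have "\<dots> = of_real (S / 2)"
    by (simp add: S_def complex_norm_square mult.commute sum_divide_distrib del: of_real_power)
  finally have FT: "(\<integral>w. F w * cnj (T w) \<partial>cube_measure) = of_real (S / 2)" .
  have intcc: "integrable cube_measure (\<lambda>w. p k * complex_of_real (cube_cos (K j) w * cube_cos (K k) w))" for j k
    by (intro integrable_mult_right integrable_of_real integrable_cube_trig_mult)
  have cosT: "complex_of_real (cube_cos (K j) w) * T w = (\<Sum>k<N. p k * complex_of_real (cube_cos (K j) w * cube_cos (K k) w))" for j w
    by (simp add: T_def sum_distrib_left mult_ac)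
  have intcT: "integrable cube_measure (\<lambda>w. complex_of_real (cube_cos (K j) w) * T w)" for j
    unfolding cosT by (intro Bochner_Integration.integrable_sum intcc)
  have intTc: "(\<integral>w. cube_cos (K j) w * T w \<partial>cube_measure) = p j / 2" if "j < N" for j
  proof -
    have "(\<integral>w. cube_cos (K j) w * T w \<partial>cube_measure) =
        (\<Sum>k<N. p k * complex_of_real (\<integral>w. cube_cos (K j) w * cube_cos (K k) w \<partial>cube_measure))"
      unfolding cosT using intcc
      by (subst Bochner_Integration.integral_sum) (auto simp del: of_real_mult)
    also have "\<dots> = (\<Sum>k<N. if k = j then p j / 2 else 0)"
      unfolding cc by (intro sum.cong) auto
    finally show ?thesis
      using that by simp
  qed
  have "(\<integral>w. T w * cnj (T w) \<partial>cube_measure) = (\<integral>w. (\<Sum>k<N. cnj (p k) * (cube_cos (K k) w * T w)) \<partial>cube_measure)"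
    by (simp add: T_def[THEN fun_cong, of _, THEN arg_cong[of _ _ cnj]] sum_distrib_left mult_ac)
  also have "\<dots> = (\<Sum>k<N. cnj (p k) * (p k / 2))"
    using intcT by (subst Bochner_Integration.integral_sum) (auto simp: intTc)
  also have "\<dots> = of_real (S / 2)"
    by (simp add: S_def complex_norm_square mult.commute sum_divide_distrib del: of_real_power)
  finally have "complex_of_real (\<integral>w. (cmod (T w))\<^sup>2 \<partial>cube_measure) = of_real (S / 2)"
    by (simp add: complex_norm_square del: of_real_power flip: integral_complex_of_real)
  then have TT: "(\<integral>w. (cmod (T w))\<^sup>2 \<partial>cube_measure) = S / 2"
    by (simp only: of_real_eq_iff)
  have "(\<lambda>w. cnj (T w)) = (\<lambda>w. \<Sum>k<N. cnj (p k) * cube_cos (K k) w)"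
    by (simp add: T_def)
  then have [measurable]: "(\<lambda>w. cnj (T w)) \<in> borel_measurable cube_measure"
    by simp
  have int: "integrable cube_measure (\<lambda>w. F w * cnj (T w))"
    using mult_mono[OF FC T_bound C norm_ge_zero]
    by (intro cube.integrable_const_bound[where B = "C * (\<Sum>k<N. cmod (p k))"]) (auto simp: norm_mult)
  have intRe: "integrable cube_measure (\<lambda>w. Re (F w * cnj (T w)))"
    by (rule integrable_Re[OF int])
  have Re: "(\<integral>w. Re (F w * cnj (T w)) \<partial>cube_measure) = S / 2"
    unfolding integral_Re[OF int] FT by simp
  \<comment> \<open>Expanding the square gives \<open>0 \<le> \<integral>\<bar>F\<bar>\<^sup>2 - S / 2\<close>.\<close>
  have "0 \<le> (\<integral>w. (cmod (F w - T w))\<^sup>2 \<partial>cube_measure)"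
    by (rule integral_nonneg_AE) simp
  also have "\<dots> = (\<integral>w. (cmod (F w))\<^sup>2 - 2 * Re (F w * cnj (T w)) + (cmod (T w))\<^sup>2 \<partial>cube_measure)"
  proof (intro Bochner_Integration.integral_cong refl)
    show "(cmod (F w - T w))\<^sup>2 = (cmod (F w))\<^sup>2 - 2 * Re (F w * cnj (T w)) + (cmod (T w))\<^sup>2" for w
      unfolding cmod_power2 by (simp add: power2_eq_square algebra_simps)
  qed
  also have "\<dots> = (\<integral>w. (cmod (F w))\<^sup>2 \<partial>cube_measure) - S + S / 2"
    using Bochner_Integration.integral_add[OF Bochner_Integration.integrable_diff[OF intF integrable_mult_right[OF intRe, of 2]] intT]
      Bochner_Integration.integral_diff[OF intF integrable_mult_right[OF intRe, of 2]] Re TT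
    by (simp only: Bochner_Integration.integral_mult_right[OF intRe])
  also have "(\<integral>w. (cmod (F w))\<^sup>2 \<partial>cube_measure) \<le> (\<integral>w. C\<^sup>2 \<partial>(cube_measure :: ('n \<Rightarrow> real) measure))"
    using intF FC by (intro integral_mono) (auto intro!: power_mono)
  also have "\<dots> = C\<^sup>2"
    by (simp add: measure_def emeasure_cube_measure)
  finally show ?thesis
    by (simp add: S_def)
qed

text \<open>The difference quotients are bounded by \<open>C\<close> and have cosine coefficients
  \<open>c k * sin (2\<pi> t K k i) / t\<close>, which tend to \<open>2\<pi> c k * K k i\<close>. Bessel's inequality bounds their
  square sum uniformly in \<open>t\<close>. Square summability, rather than mere boundedness, is essential: the
  coefficients may have constant modulus.\<close>

lemma lacunary_lipschitz_coefficients: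
  fixes K :: "nat \<Rightarrow> int^'n" and c :: "nat \<Rightarrow> complex"
  assumes K: "\<And>j k. j \<noteq> k \<Longrightarrow> K j \<noteq> K k \<and> K j \<noteq> - K k" "\<And>k. K k \<noteq> 0"
    and c: "summable (\<lambda>k. cmod (c k))" and r: "r > 0"
    and lip: "\<And>x t. 0 < t \<Longrightarrow> t < r \<Longrightarrow>
      cmod ((\<Sum>k. c k * sin (2 * pi * dotp (int_vec (K k)) (x + t *s axis i 1))) -
        (\<Sum>k. c k * sin (2 * pi * dotp (int_vec (K k)) x))) \<le> C * t"
  shows "(\<lambda>k. cmod (c k) * of_int (K k $ i)) \<longlonglongrightarrow> 0"
proof -
  define a where "a = (\<lambda>k. 2 * pi * of_int (K k $ i))"
  have partial: "(\<Sum>k<N. (cmod (c k))\<^sup>2 * (sin (a k * t) / t)\<^sup>2) \<le> 2 * C\<^sup>2" if t: "0 < t" "t < r" for N t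
  proof -
    define p q where "p = (\<lambda>k. c k * of_real (sin (a k * t) / t))"
      and "q = (\<lambda>k. c k * of_real ((cos (a k * t) - 1) / t))"
    have abs_p: "\<bar>sin (a k * t) / t\<bar> \<le> 1 / t" and abs_q: "\<bar>(cos (a k * t) - 1) / t\<bar> \<le> 2 / t" for k
      using t cos_le_one[of "a k * t"] cos_ge_minus_one[of "a k * t"]
      by (simp_all add: divide_right_mono)
    have scaled: "summable (\<lambda>k. cmod (c k * of_real (f k)))" if "\<And>k. \<bar>f k\<bar> \<le> B" for f :: "nat \<Rightarrow> real" and B
    proof (rule summable_comparison_test'[of "\<lambda>k. cmod (c k) * B" 0])
      show "summable (\<lambda>k. cmod (c k) * B)"
        by (rule summable_mult2[OF c])
      show "norm (cmod (c k * of_real (f k))) \<le> cmod (c k) * B" for k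
        using that[of k] by (simp add: norm_mult mult_left_mono)
    qed
    have sump: "summable (\<lambda>k. cmod (p k))" and sumq: "summable (\<lambda>k. cmod (q k))"
      unfolding p_def q_def by (rule scaled[OF abs_p], rule scaled[OF abs_q])
    have "cmod (\<Sum>k. p k * cube_cos (K k) w + q k * cube_sin (K k) w) \<le> C" for w
    proof -
      let ?x = "\<chi> i. w i"
      let ?s = "\<lambda>x k. c k * complex_of_real (sin (2 * pi * dotp (int_vec (K k)) x))"
      have arg: "2 * pi * dotp (int_vec (K k)) (?x + t *s axis i 1) = 2 * pi * dotp (int_vec (K k)) ?x + a k * t" for k
        by (simp add: dotp_add_right dotp_scale_right dotp_commute[of _ "axis i 1"] dotp_axis_left a_def algebra_simps)
      have trig: "p k * cube_cos (K k) w + q k * cube_sin (K k) w = (?s (?x + t *s axis i 1) k - ?s ?x k) / of_real t" for k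
        unfolding arg p_def q_def cube_cos_def cube_sin_def
        using t by (simp add: sin_add field_simps)
      have summable_s: "summable (?s x)" for x
        by (rule summable_norm_cancel, rule scaled[of _ 1]) simp
      have "(\<Sum>k. p k * cube_cos (K k) w + q k * cube_sin (K k) w) =
          ((\<Sum>k. ?s (?x + t *s axis i 1) k) - (\<Sum>k. ?s ?x k)) / of_real t"
        unfolding trig
        by (simp add: suminf_divide suminf_diff summable_s summable_diff)
      then show ?thesis
        using lip[OF t, of ?x] t by (simp add: norm_divide divide_le_eq)
    qed
    from bessel_inequality[OF K sump sumq this, of N] show ?thesis
      by (simp add: p_def norm_mult power_mult_distrib norm_divide power_divide)
  qed
  have sin_lim: "((\<lambda>t. sin (b * t) / t) \<longlongrightarrow> b) (at_right 0)" for b :: real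
  proof -
    have "((\<lambda>t. sin (b * t)) has_real_derivative b) (at 0)"
      by (auto intro!: derivative_eq_intros)
    then show ?thesis
      by (simp add: has_field_derivative_iff filterlim_at_split)
  qed
  have "(\<Sum>k<N. (cmod (c k))\<^sup>2 * (a k)\<^sup>2) \<le> 2 * C\<^sup>2" for N
  proof (rule tendsto_upperbound)
    show "((\<lambda>t. \<Sum>k<N. (cmod (c k))\<^sup>2 * (sin (a k * t) / t)\<^sup>2) \<longlongrightarrow>
        (\<Sum>k<N. (cmod (c k))\<^sup>2 * (a k)\<^sup>2)) (at_right 0)"
      by (intro tendsto_intros sin_lim)
    show "\<forall>\<^sub>F t in at_right 0. (\<Sum>k<N. (cmod (c k))\<^sup>2 * (sin (a k * t) / t)\<^sup>2) \<le> 2 * C\<^sup>2"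
      using partial r unfolding eventually_at_right_field by blast
  qed simp
  then have "summable (\<lambda>k. (cmod (c k))\<^sup>2 * (a k)\<^sup>2)"
    by (intro summableI_nonneg_bounded) auto
  then have "(\<lambda>k. sqrt ((cmod (c k))\<^sup>2 * (a k)\<^sup>2)) \<longlonglongrightarrow> sqrt 0"
    by (intro tendsto_real_sqrt summable_LIMSEQ_zero)
  then have "(\<lambda>k. cmod (c k) * \<bar>a k\<bar>) \<longlonglongrightarrow> 0"
    by (simp add: real_sqrt_mult)
  then have "(\<lambda>k. \<bar>2 * pi * (cmod (c k) * of_int (K k $ i))\<bar>) \<longlonglongrightarrow> 0"
    by (simp add: a_def abs_mult mult_ac)
  then have "(\<lambda>k. (2 * pi) * (cmod (c k) * of_int (K k $ i))) \<longlonglongrightarrow> 0"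
    by (rule tendsto_rabs_zero_cancel)
  then show ?thesis
    using tendsto_mult_left[of "\<lambda>k. (2 * pi) * (cmod (c k) * of_int (K k $ i))" 0 sequentially "1 / (2 * pi)"]
    by simp
qed

section \<open>Maps of the torus and their lifts\<close>

lemma dotp_diff_right: "dotp u (w - w') = dotp u w - dotp u w'"
  by (simp add: dotp_def right_diff_distrib sum_subtractf)

lemma torus_proj_eq_int_vec: "torus_proj x = torus_proj y \<longleftrightarrow> (\<exists>k. x = y + int_vec k)"
proof
  assume "torus_proj x = torus_proj y"
  then have "\<forall>i. \<exists>k. (x - y) $ i = of_int k"
    by (auto simp: torus_proj_eq_iff elim!: Ints_cases)
  then obtain k where "\<And>i. (x - y) $ i = of_int (k i)"
    by metis
  then have "x = y + int_vec (\<chi> i. k i)"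
    by (simp add: vec_eq_iff algebra_simps)
  then show "\<exists>k. x = y + int_vec k"
    by blast
qed (auto simp: torus_proj_eq_iff)

lemma torus_proj_add_int_vec [simp]: "torus_proj (x + int_vec k) = torus_proj x"
  by (auto simp: torus_proj_eq_int_vec)

lemma torus_proj_rep [simp]: "torus_proj (rep_torus p) = p"
  by (rule Quotient_abs_rep[OF Quotient_torus])

lemma norm_int_vec_ge_1:
  assumes "k \<noteq> 0"
  shows "1 \<le> norm (int_vec k :: real^'n)"
proof -
  obtain i where "k $ i \<noteq> 0"
    using assms by (auto simp: vec_eq_iff)
  then have "1 \<le> \<bar>real_of_int (k $ i)\<bar>"
    by linarith
  also have "\<dots> \<le> norm (int_vec k :: real^'n)"
    using component_le_norm_cart[of "int_vec k" i] by simp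
  finally show ?thesis .
qed

lemma dist_torus_proj_lessD:
  assumes "dist (torus_proj x) q < d"
  obtains y where "torus_proj y = q" "norm (y - x) < d"
proof -
  obtain y where "y \<in> torus_fiber q" "infdist x (torus_fiber q) = dist x y"
    using infdist_attains_inf[OF closed_torus_fiber torus_fiber_nonempty] by metis
  then show ?thesis
    using assms that[of y] by (simp add: dist_torus_proj torus_fiber_def dist_norm norm_minus_commute)
qed

text \<open>Distinct points of a fibre are at distance at least 1.\<close>

lemma dist_torus_proj_eq:
  assumes "norm (x - y) < 1 / 2"
  shows "dist (torus_proj x) (torus_proj y) = norm (x - y)"
proof (rule antisym)
  show "dist (torus_proj x) (torus_proj y) \<le> norm (x - y)"
    using dist_torus_proj_le[of x y] by (simp add: dist_norm)
  obtain z where z: "z \<in> torus_fiber (torus_proj y)" "infdist x (torus_fiber (torus_proj y)) = dist x z"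
    using infdist_attains_inf[OF closed_torus_fiber torus_fiber_nonempty] by metis
  then obtain k where k: "z = y + int_vec k"
    by (auto simp: torus_fiber_def torus_proj_eq_int_vec)
  have "norm (x - y) \<le> norm (x - z)"
  proof (cases "k = 0")
    case False
    have "norm (int_vec k :: real^'a) \<le> norm (x - y) + norm (x - z)"
      unfolding k by norm
    then show ?thesis
      using norm_int_vec_ge_1[OF False] assms by (smt (verit) field_sum_of_halves)
  qed (simp add: k)
  then show "norm (x - y) \<le> dist (torus_proj x) (torus_proj y)"
    by (simp add: dist_torus_proj z(2) dist_norm)
qed

lemma continuous_on_torus_of_lift:
  fixes f :: "'n::finite torus \<Rightarrow> 'n torus"
  assumes "torus_lift F f"
  shows "continuous_on UNIV f"
proof (rule continuous_on_iff[THEN iffD2], intro ballI allI impI)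
  fix p :: "'n torus" and e :: real assume e: "e > 0"
  define x where "x = rep_torus p"
  obtain d where d: "d > 0" "\<And>y. dist y x < d \<Longrightarrow> dist (F y) (F x) < e"
    using assms e unfolding torus_lift_def continuous_on_iff by (metis UNIV_I)
  have "dist (f q) (f p) < e" if "dist q p < d" for q
  proof -
    have "dist (torus_proj x) q < d"
      using that by (simp add: x_def dist_commute)
    then obtain y where y: "torus_proj y = q" "norm (y - x) < d"
      by (rule dist_torus_proj_lessD)
    have "dist (f (torus_proj y)) (f (torus_proj x)) \<le> dist (F y) (F x)"
      using assms dist_torus_proj_le[of "F y" "F x"] by (simp add: torus_lift_def)
    also have "\<dots> < e"
      using d(2)[of y] y(2) by (simp add: dist_norm)
    finally show ?thesis
      by (simp add: y(1) x_def)
  qed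
  then show "\<exists>d>0. \<forall>q\<in>UNIV. dist q p < d \<longrightarrow> dist (f q) (f p) < e"
    using d(1) by blast
qed

definition torus_map :: "(real^'n \<Rightarrow> real^'n) \<Rightarrow> 'n::finite torus \<Rightarrow> 'n torus" where
  "torus_map F p = torus_proj (F (rep_torus p))"

definition lattice_equivariant :: "(real^'n \<Rightarrow> real^'n) \<Rightarrow> bool" where
  "lattice_equivariant F \<longleftrightarrow> (\<forall>x k. torus_proj (F (x + int_vec k)) = torus_proj (F x))"

lemma torus_map_proj:
  assumes "lattice_equivariant F"
  shows "torus_map F (torus_proj x) = torus_proj (F x)"
proof -
  obtain k where "rep_torus (torus_proj x) = x + int_vec k"
    using torus_proj_eq_int_vec torus_proj_rep by metis
  then show ?thesis
    using assms by (simp add: torus_map_def lattice_equivariant_def)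
qed

lemma torus_lift_torus_map:
  assumes "lattice_equivariant F" "continuous_on UNIV F"
  shows "torus_lift F (torus_map F)"
  using assms by (simp add: torus_lift_def torus_map_proj)

lemma torus_map_eqI:
  assumes "lattice_equivariant F" "lattice_equivariant G" "\<And>x. F (G x) = K x" "lattice_equivariant K"
  shows "torus_map F (torus_map G p) = torus_map K p"
proof -
  obtain x where "p = torus_proj x"
    using torus_proj_rep[of p] by metis
  then show ?thesis
    using assms by (simp add: torus_map_proj)
qed

lemma torus_lift_funpow:
  assumes "torus_lift F f"
  shows "torus_lift (F ^^ n) (f ^^ n)"
proof (induction n)
  case (Suc n)
  then show ?case
    using assms continuous_on_compose2[of UNIV F UNIV "F ^^ n"] unfolding torus_lift_def
    by (simp add: comp_def)
qed (simp add: torus_lift_def)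

section \<open>Shears as diffeomorphisms of the torus\<close>

text \<open>The constant and the phase are included to make the class closed under directional
  derivatives.\<close>

lemma k_smooth_sine_shear:
  fixes B :: "real^'n \<Rightarrow> real^'n" and \<kappa> :: "real^'n \<Rightarrow> real"
  assumes "bounded_linear B" "bounded_linear \<kappa>"
  shows "k_smooth k (\<lambda>z. c + B z + sin (\<kappa> z + \<theta>) *\<^sub>R a)"
  using assms(1)
proof (induction k arbitrary: c B \<theta> a)
  case 0
  then show ?case
    using assms(2) unfolding k_smooth.simps
    by (intro continuous_on_add continuous_on_scaleR continuous_on_sin continuous_on_const linear_continuous_on)
next
  case (Suc k)
  have D: "((\<lambda>z. c + B z + sin (\<kappa> z + \<theta>) *\<^sub>R a) has_derivative
      (\<lambda>v. B v + (cos (\<kappa> x + \<theta>) * \<kappa> v) *\<^sub>R a)) (at x)" for x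
    using bounded_linear_imp_has_derivative[OF Suc.prems] bounded_linear_imp_has_derivative[OF assms(2)]
    by (auto intro!: derivative_eq_intros simp: mult.commute)
  have "frechet_derivative (\<lambda>z. c + B z + sin (\<kappa> z + \<theta>) *\<^sub>R a) (at x) v =
      B v + 0 + sin (\<kappa> x + (\<theta> + pi / 2)) *\<^sub>R (\<kappa> v *\<^sub>R a)" for x v
    by (simp add: frechet_derivative_at[OF D, symmetric])
       (simp add: sin_add cos_add)
  moreover have "k_smooth k (\<lambda>x. B v + 0 + sin (\<kappa> x + (\<theta> + pi / 2)) *\<^sub>R (\<kappa> v *\<^sub>R a))" for v
    by (rule Suc.IH) simp
  moreover have "(\<lambda>z. c + B z + sin (\<kappa> z + \<theta>) *\<^sub>R a) differentiable (at x)" for x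
    unfolding differentiable_def using D by blast
  ultimately show ?case
    by simp
qed

definition shear_lift :: "int^'n^'n \<Rightarrow> int^'n \<Rightarrow> real \<Rightarrow> real^'n \<Rightarrow> real^'n \<Rightarrow> real^'n" where
  "shear_lift A m \<delta> a z = map_matrix of_int A *v z + (\<delta> * sin (2 * pi * dotp (int_vec m) z)) *s a"

definition shear_map :: "int^'n^'n \<Rightarrow> int^'n \<Rightarrow> real \<Rightarrow> real^'n \<Rightarrow> 'n::finite torus \<Rightarrow> 'n torus" where
  "shear_map A m \<delta> a = torus_map (shear_lift A m \<delta> a)"

lemma sin_add_int_multiple: "sin (x + 2 * pi * of_int k) = sin x"
  using sin.plus_of_int[of x k] by (simp add: mult.commute)

lemma lattice_equivariant_shear_lift: "lattice_equivariant (shear_lift A m \<delta> a)"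
proof -
  have "shear_lift A m \<delta> a (x + int_vec k) = shear_lift A m \<delta> a x + int_vec (A *v k)" for x k
    using sin_add_int_multiple[of "2 * pi * dotp (int_vec m) x" "dotp m k"]
    by (simp add: shear_lift_def dotp_add_right dotp_int_vec mat_act.T_add int_vec_mult distrib_left)
  then show ?thesis
    by (simp add: lattice_equivariant_def)
qed

lemma dotp_eq_inner: "dotp x y = x \<bullet> y"
  by (simp add: dotp_def inner_vec_def)

lemma bounded_linear_dotp: "bounded_linear (\<lambda>z::real^'n. r * dotp (int_vec m) z)"
  unfolding dotp_eq_inner by (intro bounded_linear_intros)

lemma k_smooth_shear_lift: "k_smooth k (shear_lift A m \<delta> a)"
proof -
  have eq: "shear_lift A m \<delta> a = (\<lambda>z. 0 + map_matrix of_int A *v z + sin (2 * pi * dotp (int_vec m) z + 0) *\<^sub>R (\<delta> *\<^sub>R a))"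
    by (simp add: fun_eq_iff shear_lift_def scalar_mult_eq_scaleR mult.commute)
  show ?thesis
    unfolding eq
    by (rule k_smooth_sine_shear[where \<kappa> = "\<lambda>z. 2 * pi * dotp (int_vec m) z"])
       (rule matrix_vector_mul_bounded_linear, rule bounded_linear_dotp)
qed

lemma torus_lift_shear_map: "torus_lift (shear_lift A m \<delta> a) (shear_map A m \<delta> a)"
  unfolding shear_map_def
  using k_smooth_shear_lift[of 0] by (intro torus_lift_torus_map lattice_equivariant_shear_lift) simp

lemma torus_smooth_shear_map: "torus_smooth (shear_map A m \<delta> a)"
  unfolding torus_smooth_def using torus_lift_shear_map k_smooth_shear_lift by blast

lemma shear_lift_has_derivative:
  "(shear_lift A m \<delta> a has_derivative (\<lambda>v. map_matrix of_int A *v v +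
     ((2 * pi * \<delta> * cos (2 * pi * dotp (int_vec m) z)) * dotp (int_vec m) v) *s a)) (at z)"
proof -
  have L: "((*v) (map_matrix real_of_int A) has_derivative (*v) (map_matrix of_int A)) (at z)"
    by (intro bounded_linear_imp_has_derivative matrix_vector_mul_bounded_linear)
  have "((\<lambda>z. 2 * pi * dotp (int_vec m) z) has_derivative (\<lambda>z. 2 * pi * dotp (int_vec m) z)) (at z)"
    by (rule bounded_linear_imp_has_derivative[OF bounded_linear_dotp])
  from has_derivative_mult_right[OF DERIV_compose_FDERIV[OF DERIV_sin this], of \<delta>]
  have "((\<lambda>z. (\<delta> * sin (2 * pi * dotp (int_vec m) z)) *\<^sub>R a) has_derivative
      (\<lambda>v. (\<delta> * (2 * pi * dotp (int_vec m) v * cos (2 * pi * dotp (int_vec m) z))) *\<^sub>R a)) (at z)"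
    by (rule has_derivative_scaleR_left)
  from has_derivative_add[OF L this] show ?thesis
    unfolding shear_lift_def[abs_def] scalar_mult_eq_scaleR by (simp only: mult_ac)
qed

text \<open>The inverse is the shear of the inverse matrix with the covector \<open>m\<close> transported by it, with
  the preimage of \<open>a\<close>, and with \<open>-\<delta>\<close>.\<close>

lemma torus_diffeo_shear_map:
  assumes A: "invertible A" and a: "shear_vector A m a"
  shows "torus_diffeo (shear_map A m \<delta> a)"
proof -
  obtain B where B: "A ** B = mat 1" "B ** A = mat 1"
    using A by (auto simp: invertible_def)
  let ?L = "map_matrix real_of_int A" and ?M = "map_matrix real_of_int B"
  have map_mult: "map_matrix real_of_int X ** map_matrix of_int Y = map_matrix of_int (X ** Y)" for X Y :: "int^'a^'a"
    by (simp add: vec_eq_iff matrix_matrix_mult_def)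
  have map_1: "map_matrix real_of_int (mat 1 :: int^'a^'a) = mat 1"
    by (simp add: vec_eq_iff mat_def)
  have LM: "?L *v (?M *v x) = x" and M_L: "?M *v (?L *v x) = x" for x
    by (simp_all add: matrix_vector_mul_assoc map_mult B map_1)
  obtain a' where a': "?L *v a' = a" "dotp (int_vec m) a' = 0"
    using a by (auto simp: shear_vector_def)
  define T where "T = transpose B"
  define m' where "m' = T *v m"
  have TM: "map_matrix real_of_int T = transpose ?M"
    by (simp add: T_def map_matrix_transpose)
  have "int_vec m' = map_matrix real_of_int T *v int_vec m"
    by (simp add: m'_def int_vec_mult)
  then have m': "dotp (int_vec m') x = dotp (int_vec m) (?M *v x)" for x
    by (simp only: dotp_transpose[OF TM])
  let ?F = "shear_lift A m \<delta> a" and ?G = "shear_lift B m' (- \<delta>) a'"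
  have Ma: "?M *v a = a'"
    using M_L[of a'] by (simp add: a'(1))
  have FG: "?F (?G x) = x" for x
  proof -
    have "dotp (int_vec m) (?G x) = dotp (int_vec m') x"
      by (simp add: shear_lift_def dotp_diff_right dotp_scale_right a'(2) m')
    then show ?thesis
      unfolding shear_lift_def[of A]
      by (simp add: shear_lift_def[of B] mat_act.T_minus mat_act.T_scale LM a'(1))
  qed
  have GF: "?G (?F x) = x" for x
  proof -
    have "dotp (int_vec m') (?F x) = dotp (int_vec m) x"
      by (simp add: m' shear_lift_def mat_act.T_add mat_act.T_scale M_L Ma dotp_add_right dotp_scale_right a'(2))
    then show ?thesis
      unfolding shear_lift_def[of B]
      by (simp add: shear_lift_def[of A] mat_act.T_add mat_act.T_scale M_L Ma)
  qed
  have id: "lattice_equivariant (\<lambda>x. x)" and id_map: "torus_map (\<lambda>x. x) p = p" for p :: "'a torus"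
    by (simp_all add: lattice_equivariant_def torus_map_def)
  have "shear_map A m \<delta> a (shear_map B m' (- \<delta>) a' p) = p"
    "shear_map B m' (- \<delta>) a' (shear_map A m \<delta> a p) = p" for p
    unfolding shear_map_def
    using torus_map_eqI[OF lattice_equivariant_shear_lift lattice_equivariant_shear_lift FG id]
      torus_map_eqI[OF lattice_equivariant_shear_lift lattice_equivariant_shear_lift GF id] id_map
    by simp_all
  then have "bij (shear_map A m \<delta> a)" "inv (shear_map A m \<delta> a) = shear_map B m' (- \<delta>) a'"
    by (metis bijI' , metis inv_equality)
  then show ?thesis
    by (simp add: torus_diffeo_def torus_smooth_shear_map)
qed

lemma norm_vec_scale: "norm (r *s (x :: real^'n)) = \<bar>r\<bar> * norm x"
  by (simp add: scalar_mult_eq_scaleR)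

text \<open>Both the displacement and its derivative are proportional to \<open>\<delta>\<close>.\<close>

lemma shear_map_C1_close:
  fixes A :: "int^'n^'n"
  shows "\<exists>c>0. \<forall>\<delta> \<epsilon>. \<bar>\<delta>\<bar> * c < \<epsilon> \<longrightarrow> torus_C1_close \<epsilon> (shear_map A m \<delta> a) (toral_endo A)"
proof (intro exI conjI allI impI)
  let ?M = "norm (int_vec m :: real^'n)"
  let ?c = "(1 + 2 * pi * ?M) * norm a + 1"
  show "?c > 0"
    by (simp add: add_nonneg_pos)
  fix \<delta> \<epsilon> :: real
  assume less: "\<bar>\<delta>\<bar> * ?c < \<epsilon>"
  have 1: "\<bar>\<delta>\<bar> * norm a < \<epsilon>" and 2: "\<bar>\<delta>\<bar> * (2 * pi * ?M * norm a) < \<epsilon>"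
    by (rule le_less_trans[OF mult_left_mono less]; simp add: algebra_simps)+
  show "torus_C1_close \<epsilon> (shear_map A m \<delta> a) (toral_endo A)"
    unfolding torus_C1_close_def
  proof (intro allI conjI)
    fix p :: "'n torus"
    define z where "z = rep_torus p"
    then have p: "p = torus_proj z"
      by simp
    have "dist (shear_map A m \<delta> a p) (toral_endo A p) \<le> dist (shear_lift A m \<delta> a z) (map_matrix of_int A *v z)"
      unfolding p using torus_lift_shear_map[of A m \<delta> a] torus_lift_toral_endo[of A] dist_torus_proj_le
      by (metis torus_lift_def)
    also have "\<dots> \<le> \<bar>\<delta>\<bar> * norm a"
      by (simp add: dist_norm shear_lift_def norm_vec_scale abs_mult mult_right_mono mult_left_le)
    finally show "dist (shear_map A m \<delta> a p) (toral_endo A p) < \<epsilon>"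
      using 1 by simp
    let ?t = "2 * pi * \<delta> * cos (2 * pi * dotp (int_vec m) z)"
    have "torus_deriv (shear_map A m \<delta> a) p v - torus_deriv (toral_endo A) p v = (?t * dotp (int_vec m) v) *s a" for v
      unfolding p torus_deriv_toral_endo
      by (simp add: torus_deriv_eq[OF torus_lift_shear_map shear_lift_has_derivative])
    moreover have "onorm (\<lambda>v. (?t * dotp (int_vec m) v) *s a) \<le> \<bar>\<delta>\<bar> * (2 * pi * ?M * norm a)"
    proof (rule onorm_le)
      fix v :: "real^'n"
      have "\<bar>?t\<bar> \<le> 2 * pi * \<bar>\<delta>\<bar>"
        by (simp add: abs_mult mult_left_le)
      moreover have "\<bar>dotp (int_vec m) v\<bar> \<le> ?M * norm v"
        unfolding dotp_eq_inner by (rule Cauchy_Schwarz_ineq2)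
      ultimately have "\<bar>?t\<bar> * \<bar>dotp (int_vec m) v\<bar> * norm a \<le> (2 * pi * \<bar>\<delta>\<bar>) * (?M * norm v) * norm a"
        by (intro mult_right_mono mult_mono) auto
      then show "norm ((?t * dotp (int_vec m) v) *s a) \<le> \<bar>\<delta>\<bar> * (2 * pi * ?M * norm a) * norm v"
        by (simp add: norm_vec_scale abs_mult mult_ac)
    qed
    ultimately show "onorm (\<lambda>v. torus_deriv (shear_map A m \<delta> a) p v - torus_deriv (toral_endo A) p v) < \<epsilon>"
      using 2 by simp
  qed
qed

lemma dotp_shear_lift_power:
  assumes "shear_vector A m a"
  shows "dotp (int_vec m) (((*v) (map_matrix of_int A) ^^ k) (shear_lift A m \<delta> a z)) =
    dotp (int_vec m) (((*v) (map_matrix of_int A) ^^ Suc k) z)"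
  using assms
  by (simp add: shear_lift_def shear_vector_def mat_act.T_power_add mat_act.T_power_scale dotp_add_right
      dotp_scale_right funpow_swap1)

lemma torus_deriv_shear_map_funpow:
  assumes a: "shear_vector A m a"
  shows "torus_deriv (shear_map A m \<delta> a ^^ n) (torus_proj z) =
    shear_cocycle A m a (\<lambda>j. 2 * pi * \<delta> * cos (2 * pi * dotp (int_vec m) (((*v) (map_matrix of_int A) ^^ j) z))) n"
    (is "_ = shear_cocycle A m a ?e n")
proof -
  let ?F = "shear_lift A m \<delta> a"
  have orbit: "dotp (int_vec m) (((*v) (map_matrix of_int A) ^^ k) ((?F ^^ n) z)) =
      dotp (int_vec m) (((*v) (map_matrix of_int A) ^^ (k + n)) z)" for n k
  proof (induction n arbitrary: k)
    case (Suc n)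
    then show ?case
      using dotp_shear_lift_power[OF a, of k \<delta> "(?F ^^ n) z"] Suc[of "Suc k"] by simp
  qed simp
  have "((?F ^^ n) has_derivative shear_cocycle A m a ?e n) (at z)" for n
  proof (induction n)
    case (Suc n)
    have "(?F has_derivative (\<lambda>v. map_matrix of_int A *v v + (?e n * dotp (int_vec m) v) *s a)) (at ((?F ^^ n) z))"
      using shear_lift_has_derivative[of A m \<delta> a "(?F ^^ n) z"] orbit[of 0 n] by simp
    from diff_chain_at[OF Suc this] show ?case
      by (simp add: comp_def)
  qed (simp add: id_def)
  then show ?thesis
    by (intro torus_deriv_eq[OF torus_lift_funpow[OF torus_lift_shear_map]])
qed

section \<open>Uniqueness of the conjugacy\<close>

lemma dotp_diff_left: "dotp (u - u') w = dotp u w - dotp u' w"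
  by (simp add: dotp_def left_diff_distrib sum_subtractf)

lemma abs_sin_diff_le: "\<bar>sin x - sin y\<bar> \<le> \<bar>x - y\<bar>" for x y :: real
proof -
  have "\<bar>sin x - sin y\<bar> = 2 * \<bar>sin ((x - y) / 2)\<bar> * \<bar>cos ((x + y) / 2)\<bar>"
    by (simp add: sin_diff_sin abs_mult)
  also have "\<dots> \<le> 2 * \<bar>(x - y) / 2\<bar> * 1"
    by (intro mult_mono abs_sin_x_le_abs_x) auto
  finally show ?thesis
    by simp
qed

lemma bounded_geometric_orbit_zero:
  fixes x :: "int \<Rightarrow> complex"
  assumes x: "\<And>n. x (n + 1) = \<beta> * x n" and M: "\<And>n. cmod (x n) \<le> M" and \<beta>: "cmod \<beta> \<noteq> 1"
  shows "x n = 0"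
proof -
  have iter: "x (n + int k) = \<beta> ^ k * x n" for n k
  proof (induction k)
    case (Suc k)
    have "x (n + int (Suc k)) = \<beta> * x (n + int k)"
      using x[of "n + int k"] by (simp add: add.assoc add.commute[of 1])
    then show ?case
      using Suc by simp
  qed simp
  show ?thesis
  proof (cases "cmod \<beta> < 1")
    case True
    have "cmod (x n) \<le> cmod \<beta> ^ k * M" for k
      using iter[of "n - int k" k] M[of "n - int k"] by (simp add: norm_mult norm_power mult_left_mono)
    moreover have "(\<lambda>k. cmod \<beta> ^ k * M) \<longlonglongrightarrow> 0"
      using True by (intro tendsto_mult_left_zero LIMSEQ_realpow_zero) auto
    ultimately have "cmod (x n) \<le> 0"
      by (meson LIMSEQ_le_const)
    then show ?thesis
      by simp
  next
    case False
    then have "1 < cmod \<beta>"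
      using \<beta> by simp
    show ?thesis
    proof (rule ccontr)
      assume "x n \<noteq> 0"
      then obtain k where "M / cmod (x n) < cmod \<beta> ^ k"
        using real_arch_pow[OF \<open>1 < cmod \<beta>\<close>] by blast
      then have "M < cmod (x (n + int k))"
        using \<open>x n \<noteq> 0\<close> by (simp add: iter norm_mult norm_power divide_less_eq)
      then show False
        using M[of "n + int k"] by simp
    qed
  qed
qed

text \<open>The orbit need not be linear in all directions, only as seen by the covectors \<open>q(D) w\<close>.
  Splitting off one root at a time reduces to a bounded two-sided geometric sequence whose ratio is
  off the unit circle.\<close>

lemma bounded_orbit_functional_zero:
  fixes C D :: "complex^'n^'n" and d :: "int \<Rightarrow> complex^'n"
  assumes D: "D = transpose C" and bounded: "\<And>y. \<exists>M. \<forall>n. cmod (dotp y (d n)) \<le> M"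
    and q: "q \<noteq> 0" "mact D q w = 0" "\<And>\<alpha>. poly q \<alpha> = 0 \<Longrightarrow> cmod \<alpha> \<noteq> 1"
    and orbit: "\<And>r n. dotp (mact D r w) (d (n + 1)) = dotp (mact D r w) (C *v d n)"
  shows "dotp w (d n) = 0"
  using q orbit
proof (induction "degree q" arbitrary: q w n)
  case 0
  then obtain c where "q = [:c:]"
    by (metis degree_eq_zeroE)
  then have "w = 0"
    using 0 by simp
  then show ?case
    by simp
next
  case (Suc j)
  then obtain \<beta> where \<beta>: "poly q \<beta> = 0"
    using fundamental_theorem_of_algebra_alt[of q] by (metis degree_0 degree_pCons_0 nat.distinct(1) pCons_0_0)
  then obtain r where r: "q = [:-\<beta>, 1:] * r"
    unfolding poly_eq_0_iff_dvd dvd_def by blast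
  have "r \<noteq> 0"
    using r Suc by auto
  then have deg: "degree q = Suc (degree r)"
    unfolding r by (subst degree_mult_eq) auto
  have "dotp (mact D [:-\<beta>, 1:] w) (d n) = 0" for n
  proof (rule Suc(1)[of r])
    show "mact D r (mact D [:-\<beta>, 1:] w) = 0"
      using Suc.prems(2) unfolding r mat_act.act_mult by (simp only: mat_act.act_commute)
    show "dotp (mact D s (mact D [:-\<beta>, 1:] w)) (d (n + 1)) = dotp (mact D s (mact D [:-\<beta>, 1:] w)) (C *v d n)" for s n
      unfolding mat_act.act_mult[symmetric] by (rule Suc.prems(4))
    show "cmod \<gamma> \<noteq> 1" if "poly r \<gamma> = 0" for \<gamma>
      using Suc.prems(3) that by (simp add: r)
  qed (use deg Suc(2) \<open>r \<noteq> 0\<close> in auto)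
  moreover have "dotp (mact D [:-\<beta>, 1:] w) (d n) = dotp w (d (n + 1)) - \<beta> * dotp w (d n)" for n
    using Suc.prems(4)[of 1 n]
    by (simp add: mat_act.act_linear_factor dotp_diff_left dotp_scale_left dotp_transpose[OF D])
  ultimately have "dotp w (d (n + 1)) = \<beta> * dotp w (d n)" for n
    by simp
  moreover obtain M where "\<And>n. cmod (dotp w (d n)) \<le> M"
    using bounded by blast
  ultimately show ?case
    using Suc.prems(3)[OF \<beta>] by (intro bounded_geometric_orbit_zero[of "\<lambda>n. dotp w (d n)" \<beta> M])
qed

lemma bij_orbit_exists:
  assumes "bij f"
  shows "\<exists>p::int \<Rightarrow> 'a. p 0 = x \<and> (\<forall>n. f (p n) = p (n + 1))"
proof -
  define p where "p = (\<lambda>n::int. if 0 \<le> n then (f ^^ nat n) x else (inv f ^^ nat (- n)) x)"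
  have "f (p n) = p (n + 1)" for n
  proof (cases "0 \<le> n")
    case True
    then have "nat (n + 1) = Suc (nat n)"
      by simp
    with True show ?thesis
      by (simp add: p_def)
  next
    case False
    then have "nat (- n) = Suc (nat (- (n + 1)))"
      by simp
    then have "f (p n) = (inv f ^^ nat (- (n + 1))) x"
      using False assms by (simp add: p_def bij_is_surj surj_f_inv_f)
    also have "\<dots> = p (n + 1)"
      using False by (cases "n = -1") (auto simp: p_def)
    finally show ?thesis .
  qed
  then show ?thesis
    by (intro exI[of _ p]) (simp add: p_def)
qed

text \<open>The nonlinear term of the difference of two orbits is a multiple of \<open>b\<close>, which \<open>m\<close> and its
  iterates do not see. So \<open>m\<cdot>d\<close> vanishes first; then the sines agree, the nonlinear term disappears,
  and \<open>d\<close> is a bounded orbit of a hyperbolic linear map.\<close>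

lemma shear_pseudo_expansive:
  fixes A :: "int^'n^'n" and d X :: "int \<Rightarrow> real^'n"
  assumes A: "hyperbolic_automorphism A" and b: "shear_vector A m b"
    and bounded: "\<And>n. norm (d n) \<le> M"
    and step: "\<And>n. shear_lift A m \<delta> b (X n + d n) - shear_lift A m \<delta> b (X n) = d (n + 1)"
  shows "d n = 0"
proof -
  let ?C = "map_matrix complex_of_int A" and ?L = "map_matrix real_of_int A"
  define D where "D = transpose ?C"
  define T where "T = transpose A"
  have DT: "D = map_matrix of_int T"
    by (simp add: D_def T_def map_matrix_transpose)
  obtain Q where Q: "Q \<noteq> 0" "\<And>x. mact ?C Q x = 0" "\<And>\<alpha>. poly Q \<alpha> = 0 \<Longrightarrow> \<exists>v. v \<noteq> 0 \<and> ?C *v v = \<alpha> *s v"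
    using annihilator_roots_eigenvalues[of ?C] by blast
  have QD: "mact D Q x = 0" for x
    by (rule mact_eq_0_transpose[OF D_def Q(2)])
  have roots: "cmod \<alpha> \<noteq> 1" if "poly Q \<alpha> = 0" for \<alpha>
    using Q(3)[OF that] A by (auto simp: hyperbolic_automorphism_def)
  have bdd: "\<exists>K. \<forall>n. cmod (dotp y (cvec (d n))) \<le> K" for y
  proof (intro exI allI)
    fix n
    have "cmod (dotp y (cvec (d n))) \<le> (\<Sum>i\<in>UNIV. cmod (y $ i) * \<bar>d n $ i\<bar>)"
      unfolding dotp_def by (rule order_trans[OF norm_sum]) (simp add: norm_mult)
    also have "\<dots> \<le> (\<Sum>i\<in>UNIV. cmod (y $ i) * M)"
      by (intro sum_mono mult_left_mono order_trans[OF component_le_norm_cart bounded]) auto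
    finally show "cmod (dotp y (cvec (d n))) \<le> (\<Sum>i\<in>UNIV. cmod (y $ i) * M)" .
  qed
  define s where "s = (\<lambda>n. \<delta> * (sin (2 * pi * dotp (int_vec m) (X n + d n)) - sin (2 * pi * dotp (int_vec m) (X n))))"
  have d_step: "d (n + 1) = ?L *v d n + s n *s b" for n
    unfolding step[symmetric] s_def
    by (simp add: shear_lift_def mat_act.T_add vec.scale_left_diff_distrib right_diff_distrib)
  then have cd_step: "cvec (d (n + 1)) = ?C *v cvec (d n) + of_real (s n) *s cvec b" for n
    by (simp add: cvec_add cvec_scale map_matrix_cvec)
  have m_b: "dotp (mact D r (int_vec m)) (cvec b) = 0" for r
  proof -
    have "dotp (int_vec m) (((*v) ?C ^^ k) (cvec b)) = 0" for k
      using b by (simp add: map_matrix_power_cvec dotp_cvec shear_vector_def)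
    then have "dotp (((*v) D ^^ k) (int_vec m)) (cvec b) = 0" for k
      by (simp add: dotp_transpose_power[OF D_def])
    moreover have "dotp (sum f S) w = (\<Sum>i\<in>S. dotp (f i) w)" for w :: "complex^'n" and f :: "nat \<Rightarrow> complex^'n" and S
      by (induction S rule: infinite_finite_induct) (simp_all add: dotp_add_left)
    ultimately show ?thesis
      by (subst poly_as_sum_of_monoms[of r, symmetric])
         (simp only: mat_act.act_sum_left mat_act.act_monom dotp_scale_left mult_zero_right sum.neutral_const)
  qed
  have "dotp (int_vec m) (cvec (d n)) = 0" for n
  proof (rule bounded_orbit_functional_zero[OF D_def bdd Q(1) QD roots])
    show "dotp (mact D r (int_vec m)) (cvec (d (n + 1))) = dotp (mact D r (int_vec m)) (?C *v cvec (d n))" for r n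
      by (simp add: cd_step dotp_add_right dotp_scale_right m_b)
  qed
  then have "s n = 0" for n
    by (simp add: s_def dotp_add_right dotp_cvec)
  then have lin: "cvec (d (n + 1)) = ?C *v cvec (d n)" for n
    by (simp add: cd_step)
  have "dotp (axis i 1) (cvec (d n)) = 0" for i
    by (rule bounded_orbit_functional_zero[OF D_def bdd Q(1) QD roots]) (simp_all add: lin)
  then show ?thesis
    by (simp add: vec_eq_iff dotp_axis_left)
qed

text \<open>Lifts of \<open>h\<close> and \<open>h'\<close> along a two-sided orbit stay closer than the lattice spacing, which
  makes the difference of the lifts an exact difference of two orbits.\<close>

lemma shear_conjugacy_unique:
  fixes A :: "int^'n^'n" and f h h' :: "'n::finite torus \<Rightarrow> 'n torus"
  assumes A: "hyperbolic_automorphism A" and b: "shear_vector A m b"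
    and N: "\<And>z::real^'n. norm (map_matrix of_int A *v z) \<le> N * norm z"
    and \<delta>: "2 * pi * \<bar>\<delta>\<bar> * norm (int_vec m :: real^'n) * norm b \<le> 1"
    and \<eta>: "2 * \<eta> * (N + 2) < 1"
    and f: "bij f" and h: "\<And>p. h (f p) = shear_map A m \<delta> b (h p)" "\<And>p. dist (h p) p < \<eta>"
    and h': "\<And>p. h' (f p) = shear_map A m \<delta> b (h' p)" "\<And>p. dist (h' p) p < \<eta>"
  shows "h' = h"
proof
  fix x
  let ?G = "shear_lift A m \<delta> b"
  obtain p :: "int \<Rightarrow> 'n torus" where p: "p 0 = x" "\<And>n. f (p n) = p (n + 1)"
    using bij_orbit_exists[OF f, of x] by blast
  define X where "X = (\<lambda>n. rep_torus (h (p n)))"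
  have X: "torus_proj (X n) = h (p n)" for n
    by (simp add: X_def)
  have "\<exists>y. torus_proj y = h' (p n) \<and> norm (y - X n) < 2 * \<eta>" for n
  proof -
    have "dist (torus_proj (X n)) (h' (p n)) < 2 * \<eta>"
      unfolding X using dist_triangle2[of "h (p n)" "h' (p n)" "p n"] h(2)[of "p n"] h'(2)[of "p n"] by simp
    then show ?thesis
      by (rule dist_torus_proj_lessD) blast
  qed
  then obtain Y where Y: "\<And>n. torus_proj (Y n) = h' (p n)" "\<And>n. norm (Y n - X n) < 2 * \<eta>"
    by metis
  define d where "d = (\<lambda>n. Y n - X n)"
  have N0: "0 \<le> N"
  proof -
    have "0 \<le> norm (map_matrix real_of_int A *v axis undefined 1)"
      by simp
    also have "\<dots> \<le> N * norm (axis undefined 1 :: real^'n)"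
      by (rule N)
    finally show ?thesis
      by (simp add: norm_axis_1)
  qed
  have G: "norm (?G y - ?G x) \<le> (N + 1) * norm (y - x)" for x y
  proof -
    let ?s = "\<lambda>x. sin (2 * pi * dotp (int_vec m) x)"
    have "\<bar>?s y - ?s x\<bar> \<le> \<bar>2 * pi * dotp (int_vec m) y - 2 * pi * dotp (int_vec m) x\<bar>"
      by (rule abs_sin_diff_le)
    also have "\<dots> = 2 * pi * \<bar>dotp (int_vec m) (y - x)\<bar>"
      by (simp add: dotp_diff_right abs_mult flip: right_diff_distrib)
    also have "\<dots> \<le> 2 * pi * (norm (int_vec m :: real^'n) * norm (y - x))"
      unfolding dotp_eq_inner by (intro mult_left_mono Cauchy_Schwarz_ineq2) simp
    finally have s: "\<bar>?s y - ?s x\<bar> \<le> 2 * pi * (norm (int_vec m :: real^'n) * norm (y - x))" .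
    have "?G y - ?G x = map_matrix of_int A *v (y - x) + (\<delta> * (?s y - ?s x)) *s b"
      by (simp add: shear_lift_def mat_act.T_minus vec.scale_left_diff_distrib right_diff_distrib)
    then have "norm (?G y - ?G x) \<le> N * norm (y - x) + \<bar>\<delta>\<bar> * \<bar>?s y - ?s x\<bar> * norm b"
      using norm_triangle_ineq[of "map_matrix of_int A *v (y - x)" "(\<delta> * (?s y - ?s x)) *s b"] N[of "y - x"]
      by (simp add: norm_vec_scale abs_mult)
    also have "\<dots> \<le> N * norm (y - x) + \<bar>\<delta>\<bar> * (2 * pi * (norm (int_vec m :: real^'n) * norm (y - x))) * norm b"
      using s by (intro add_left_mono mult_right_mono mult_left_mono) auto
    also have "\<dots> = N * norm (y - x) + (2 * pi * \<bar>\<delta>\<bar> * norm (int_vec m :: real^'n) * norm b) * norm (y - x)"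
      by (simp add: mult_ac)
    also have "\<dots> \<le> N * norm (y - x) + 1 * norm (y - x)"
      using \<delta> by (intro add_left_mono mult_right_mono) auto
    finally show ?thesis
      by (simp add: algebra_simps)
  qed
  have "d 0 = 0"
  proof (rule shear_pseudo_expansive[OF A b])
    show "norm (d n) \<le> 2 * \<eta>" for n
      using Y(2)[of n] by (simp add: d_def)
    show "?G (X n + d n) - ?G (X n) = d (n + 1)" for n
    proof -
      have "torus_proj (?G (X n)) = torus_proj (X (n + 1))" "torus_proj (?G (Y n)) = torus_proj (Y (n + 1))"
        using torus_lift_shear_map[of A m \<delta> b] X Y(1) h(1)[of "p n"] h'(1)[of "p n"] p(2)[of n]
        unfolding torus_lift_def by metis+
      then obtain k k' where k: "?G (X n) = X (n + 1) + int_vec k" "?G (Y n) = Y (n + 1) + int_vec k'"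
        unfolding torus_proj_eq_int_vec by blast
      have int: "int_vec (k' - k) = (?G (Y n) - ?G (X n)) - d (n + 1)"
        by (simp add: k d_def vec_eq_iff)
      have "norm (int_vec (k' - k) :: real^'n) \<le> (N + 1) * norm (d n) + norm (d (n + 1))"
        unfolding int using norm_triangle_ineq4[of "?G (Y n) - ?G (X n)" "d (n + 1)"] G[of "Y n" "X n"]
        by (simp add: d_def)
      also have "\<dots> \<le> (N + 1) * (2 * \<eta>) + 2 * \<eta>"
        using Y(2)[of n] Y(2)[of "n + 1"] N0 by (intro add_mono mult_left_mono) (auto simp: d_def)
      also have "\<dots> < 1"
        using \<eta> by (simp add: algebra_simps)
      finally have "k' - k = 0"
        using norm_int_vec_ge_1[of "k' - k"] by fastforce
      then have "int_vec (k' - k) = (0 :: real^'n)"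
        by simp
      then show ?thesis
        unfolding int by (simp add: d_def)
    qed
  qed
  then have "Y 0 = X 0"
    by (simp add: d_def)
  then show "h' x = h x"
    using X[of 0] Y(1)[of 0] p(1) by metis
qed

section \<open>The conjugacy\<close>

text \<open>The solution of the cohomological equation \<open>\<Psi> (A z) = \<alpha> \<Psi> z - sin (2\<pi> m\<cdot>z)\<close>, a series of
  Weierstrass type.\<close>

definition twisted_series :: "int^'n^'n \<Rightarrow> int^'n \<Rightarrow> complex \<Rightarrow> real^'n \<Rightarrow> complex" where
  "twisted_series A m \<alpha> z = (\<Sum>k. (1 / \<alpha> ^ Suc k) *
     sin (2 * pi * dotp (int_vec m) (((*v) (map_matrix of_int A) ^^ k) z)))"

context
  fixes A :: "int^'n^'n" and m :: "int^'n" and \<alpha> :: complex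
  assumes \<alpha>: "1 < cmod \<alpha>"
begin

lemma twisted_series_majorant: "summable (\<lambda>k. cmod (1 / \<alpha> ^ Suc k))"
proof -
  have "summable (\<lambda>k. (1 / cmod \<alpha>) * (1 / cmod \<alpha>) ^ k)"
  proof (intro summable_mult summable_geometric)
    have "1 / cmod \<alpha> < 1"
      using \<alpha> by (subst divide_less_eq_1_pos) auto
    then show "norm (1 / cmod \<alpha>) < 1"
      by simp
  qed
  then show ?thesis
    by (simp add: norm_divide norm_power norm_mult power_one_over)
qed

lemma twisted_series_term_bound:
  "cmod ((1 / \<alpha> ^ Suc k) * complex_of_real (sin x)) \<le> cmod (1 / \<alpha> ^ Suc k)"
  unfolding norm_mult norm_of_real by (intro mult_left_le) auto

lemma twisted_series_summable:
  "summable (\<lambda>k. (1 / \<alpha> ^ Suc k) * complex_of_real (sin (f k)))"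
  by (rule summable_comparison_test'[OF twisted_series_majorant, of 0]) (rule twisted_series_term_bound)

lemma twisted_series_bound: "cmod (twisted_series A m \<alpha> z) \<le> (\<Sum>k. cmod (1 / \<alpha> ^ Suc k))"
proof -
  have s: "summable (\<lambda>k. cmod ((1 / \<alpha> ^ Suc k) * complex_of_real (sin (f k))))" for f
    by (rule summable_comparison_test'[OF twisted_series_majorant, of 0])
       (simp only: real_norm_def abs_norm_cancel twisted_series_term_bound)
  show ?thesis
    unfolding twisted_series_def
    by (rule order_trans[OF summable_norm[OF s] suminf_le[OF twisted_series_term_bound s twisted_series_majorant]])
qed

lemma twisted_series_cong:
  assumes "\<And>k. dotp (int_vec m) (((*v) (map_matrix of_int A) ^^ k) z) =
    dotp (int_vec m) (((*v) (map_matrix of_int A) ^^ k) z') + of_int (n k)"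
  shows "twisted_series A m \<alpha> z = twisted_series A m \<alpha> z'"
  unfolding twisted_series_def assms distrib_left sin_add_int_multiple ..

lemma twisted_series_continuous: "continuous_on UNIV (twisted_series A m \<alpha>)"
proof (rule uniform_limit_theorem)
  show "uniform_limit UNIV (\<lambda>n z. \<Sum>k<n. (1 / \<alpha> ^ Suc k) *
      complex_of_real (sin (2 * pi * dotp (int_vec m) (((*v) (map_matrix of_int A) ^^ k) z))))
    (twisted_series A m \<alpha>) sequentially"
    unfolding twisted_series_def[abs_def]
    by (rule Weierstrass_m_test[OF twisted_series_term_bound twisted_series_majorant])
  have "continuous_on UNIV (((*v) (map_matrix real_of_int A) :: real^'n \<Rightarrow> real^'n) ^^ k)" for k
  proof (induction k)
    case (Suc k)
    then show ?case
      using continuous_on_compose[of UNIV "(*v) (map_matrix real_of_int A) ^^ k" "(*v) (map_matrix real_of_int A)"]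
      by (simp add: matrix_vector_mult_linear_continuous_on)
  qed (simp add: id_def)
  then have "continuous_on UNIV (\<lambda>z::real^'n. dotp (int_vec m) (((*v) (map_matrix of_int A) ^^ k) z))" for k
    unfolding dotp_eq_inner by (intro continuous_intros) (simp add: eta_contract_eq)
  then show "\<forall>\<^sub>F n in sequentially. continuous_on UNIV (\<lambda>z. \<Sum>k<n. (1 / \<alpha> ^ Suc k) *
      complex_of_real (sin (2 * pi * dotp (int_vec m) (((*v) (map_matrix of_int A) ^^ k) z))))"
    by (intro always_eventually allI continuous_intros)
qed simp

text \<open>The series depends on \<open>z\<close> only through \<open>m A\<^sup>k z\<close>, for which the shear acts like \<open>A\<close>; so the
  cohomological equation over \<open>A\<close> holds over the shear too.\<close>

lemma twisted_series_shear_lift: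
  assumes "shear_vector A m a"
  shows "twisted_series A m \<alpha> (shear_lift A m \<delta> a z) =
    \<alpha> * twisted_series A m \<alpha> z - of_real (sin (2 * pi * dotp (int_vec m) z))"
proof -
  let ?t = "\<lambda>k. (1 / \<alpha> ^ Suc k) * complex_of_real (sin (2 * pi * dotp (int_vec m) (((*v) (map_matrix of_int A) ^^ k) z)))"
  have ne: "\<alpha> \<noteq> 0"
    using \<alpha> by auto
  have "twisted_series A m \<alpha> (shear_lift A m \<delta> a z) = (\<Sum>k. \<alpha> * ?t (Suc k))"
    unfolding twisted_series_def dotp_shear_lift_power[OF assms] using ne by simp
  also have "\<dots> = \<alpha> * (\<Sum>k. ?t (Suc k))"
    by (rule suminf_mult) (subst summable_Suc_iff, rule twisted_series_summable)
  also have "(\<Sum>k. ?t (Suc k)) = twisted_series A m \<alpha> z - ?t 0"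
    unfolding twisted_series_def by (rule suminf_split_head[OF twisted_series_summable])
  finally show ?thesis
    using ne by (simp add: right_diff_distrib)
qed

lemma twisted_series_not_lipschitz:
  assumes T: "T = transpose A"
    and distinct: "\<And>j k. j \<noteq> k \<Longrightarrow> ((*v) T ^^ j) m \<noteq> ((*v) T ^^ k) m \<and> ((*v) T ^^ j) m \<noteq> - ((*v) T ^^ k) m"
    and nonzero: "\<And>k. ((*v) T ^^ k) m \<noteq> 0"
    and growth: "\<not> (\<lambda>k. of_int (((*v) T ^^ k) m $ i) / cmod \<alpha> ^ k) \<longlonglongrightarrow> (0::real)"
    and r: "r > 0"
  shows "\<exists>x t. 0 < t \<and> t < r \<and>
    B * t < cmod (twisted_series A m \<alpha> (x + t *s axis i 1) - twisted_series A m \<alpha> x)"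
proof (rule ccontr)
  assume contra: "\<not> ?thesis"
  have TL: "map_matrix real_of_int T = transpose (map_matrix of_int A)"
    by (simp add: T map_matrix_transpose)
  have "dotp (int_vec m) (((*v) (map_matrix of_int A) ^^ k) z) = dotp (int_vec (((*v) T ^^ k) m)) z" for k and z :: "real^'n"
    using dotp_transpose_power[OF TL, of k "int_vec m" z] by (simp add: int_vec_mult_power)
  then have series: "twisted_series A m \<alpha> z = (\<Sum>k. (1 / \<alpha> ^ Suc k) *
      complex_of_real (sin (2 * pi * dotp (int_vec (((*v) T ^^ k) m)) z)))" for z
    by (simp add: twisted_series_def)
  have lip: "cmod (twisted_series A m \<alpha> (x + t *s axis i 1) - twisted_series A m \<alpha> x) \<le> B * t"
    if "0 < t" "t < r" for x t
    using contra that by (meson not_less)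
  have lim: "(\<lambda>k. cmod (1 / \<alpha> ^ Suc k) * of_int (((*v) T ^^ k) m $ i)) \<longlonglongrightarrow> 0"
    by (rule lacunary_lipschitz_coefficients[where K = "\<lambda>k. ((*v) T ^^ k) m" and C = B,
          OF distinct nonzero twisted_series_majorant r lip[unfolded series]])
  have "\<alpha> \<noteq> 0"
    using \<alpha> by auto
  from tendsto_mult_left[OF lim, of "cmod \<alpha>"]
  have "(\<lambda>k. of_int (((*v) T ^^ k) m $ i) / cmod \<alpha> ^ k) \<longlonglongrightarrow> (0::real)"
    using \<open>\<alpha> \<noteq> 0\<close> by (simp add: norm_divide norm_mult norm_power)
  then show False
    using growth by contradiction
qed

end

definition conjugacy_lift :: "int^'n^'n \<Rightarrow> int^'n \<Rightarrow> complex \<Rightarrow> complex^'n \<Rightarrow> real \<Rightarrow> real^'n \<Rightarrow> real^'n" where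
  "conjugacy_lift A m \<alpha> v \<delta> z = z + re2 ((of_real \<delta> * twisted_series A m \<alpha> z) *s v)"

lemma norm_re2_scale_le: "norm (re2 (x *s v)) \<le> cmod x * (2 * (\<Sum>i\<in>UNIV. cmod (v $ i)))"
proof -
  have "norm (re2 (x *s v)) \<le> (\<Sum>i\<in>UNIV. \<bar>re2 (x *s v) $ i\<bar>)"
    by (rule norm_le_l1_cart)
  also have "\<dots> \<le> (\<Sum>i\<in>UNIV. 2 * (cmod x * cmod (v $ i)))"
  proof (rule sum_mono)
    show "\<bar>re2 (x *s v) $ i\<bar> \<le> 2 * (cmod x * cmod (v $ i))" for i
      using abs_Re_le_cmod[of "x * v $ i"] by (simp add: abs_mult norm_mult)
  qed
  finally show ?thesis
    by (simp add: sum_distrib_left mult_ac)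
qed

context
  fixes A :: "int^'n^'n" and m :: "int^'n" and \<alpha> :: complex and v :: "complex^'n"
  assumes \<alpha>: "1 < cmod \<alpha>" and v: "map_matrix of_int A *v v = \<alpha> *s v" "dotp (int_vec m) v = 0"
begin

lemma dotp_conjugacy_lift:
  "dotp (int_vec m) (((*v) (map_matrix of_int A) ^^ k) (conjugacy_lift A m \<alpha> v \<delta> z)) =
    dotp (int_vec m) (((*v) (map_matrix of_int A) ^^ k) z)"
  by (simp add: conjugacy_lift_def mat_act.T_power_add map_matrix_power_re2 mat_act.T_power_scale
      mat_act.T_power_eigen[OF v(1)] dotp_add_right dotp_re2 dotp_scale_right v(2))

lemma twisted_series_conjugacy_lift:
  "twisted_series A m \<alpha> (conjugacy_lift A m \<alpha> v \<delta> z) = twisted_series A m \<alpha> z"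
  by (rule twisted_series_cong[OF \<alpha>, of _ _ _ _ "\<lambda>_. 0"]) (simp add: dotp_conjugacy_lift)

text \<open>Moving along \<open>v\<close> and \<open>cnj v\<close> does not change the series.\<close>

lemma conjugacy_lift_inverse: "conjugacy_lift A m \<alpha> v (- \<delta>) (conjugacy_lift A m \<alpha> v \<delta> z) = z"
  unfolding conjugacy_lift_def[of _ _ _ _ "- \<delta>"] twisted_series_conjugacy_lift
  by (simp add: conjugacy_lift_def vec_eq_iff)

lemma lattice_equivariant_conjugacy_lift: "lattice_equivariant (conjugacy_lift A m \<alpha> v \<delta>)"
proof -
  have "twisted_series A m \<alpha> (x + int_vec k) = twisted_series A m \<alpha> x" for x k
    by (rule twisted_series_cong[OF \<alpha>, of _ _ _ _ "\<lambda>j. dotp m (((*v) A ^^ j) k)"])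
       (simp add: mat_act.T_power_add int_vec_mult_power dotp_add_right dotp_int_vec)
  then have "conjugacy_lift A m \<alpha> v \<delta> (x + int_vec k) = conjugacy_lift A m \<alpha> v \<delta> x + int_vec k" for x k
    by (simp add: conjugacy_lift_def)
  then show ?thesis
    by (simp add: lattice_equivariant_def)
qed

lemma conjugacy_lift_continuous: "continuous_on UNIV (conjugacy_lift A m \<alpha> v \<delta>)"
proof -
  have "continuous_on UNIV (\<lambda>z. re2 ((of_real \<delta> * twisted_series A m \<alpha> z) *s v))"
    unfolding re2_def vector_smult_component
    by (intro continuous_intros twisted_series_continuous[OF \<alpha>])
  then show ?thesis
    unfolding conjugacy_lift_def[abs_def] by (intro continuous_intros)
qed

lemma conjugacy_homeomorphism:
  "homeomorphism UNIV UNIV (torus_map (conjugacy_lift A m \<alpha> v \<delta>)) (torus_map (conjugacy_lift A m \<alpha> v (- \<delta>)))"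
proof (rule homeomorphismI)
  have id: "lattice_equivariant (\<lambda>x. x)" "torus_map (\<lambda>x. x) p = p" for p :: "'n torus"
    by (simp_all add: lattice_equivariant_def torus_map_def)
  have inv: "torus_map (conjugacy_lift A m \<alpha> v (- \<delta>)) (torus_map (conjugacy_lift A m \<alpha> v \<delta>) p) = p" for p \<delta>
    using torus_map_eqI[OF lattice_equivariant_conjugacy_lift lattice_equivariant_conjugacy_lift
        conjugacy_lift_inverse id(1)] id(2) by simp
  show "torus_map (conjugacy_lift A m \<alpha> v (- \<delta>)) (torus_map (conjugacy_lift A m \<alpha> v \<delta>) p) = p" for p
    by (rule inv)
  show "torus_map (conjugacy_lift A m \<alpha> v \<delta>) (torus_map (conjugacy_lift A m \<alpha> v (- \<delta>)) p) = p" for p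
    using inv[of "- \<delta>"] by simp
  show "continuous_on UNIV (torus_map (conjugacy_lift A m \<alpha> v \<delta>))"
    "continuous_on UNIV (torus_map (conjugacy_lift A m \<alpha> v (- \<delta>)))"
    by (rule continuous_on_torus_of_lift[OF torus_lift_torus_map[OF lattice_equivariant_conjugacy_lift
          conjugacy_lift_continuous]])+
qed auto

text \<open>The difference \<open>b - a = 2 Re v\<close> is absorbed by the inhomogeneous term of the cohomological
  equation.\<close>

lemma conjugacy_equation:
  assumes ab: "b - a = re2 v" and a: "shear_vector A m a"
  shows "torus_map (conjugacy_lift A m \<alpha> v (- \<delta>)) (shear_map A m \<delta> a p) =
    shear_map A m \<delta> b (torus_map (conjugacy_lift A m \<alpha> v (- \<delta>)) p)"
proof -
  let ?H = "conjugacy_lift A m \<alpha> v (- \<delta>)"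
  have b: "b = a + re2 v"
    using ab by (simp add: algebra_simps)
  have "?H (shear_lift A m \<delta> a z) = shear_lift A m \<delta> b (?H z)" for z
  proof -
    let ?s = "sin (2 * pi * dotp (int_vec m) z)" and ?\<Psi> = "twisted_series A m \<alpha> z"
    have "?H (shear_lift A m \<delta> a z) =
        map_matrix of_int A *v z + (\<delta> * ?s) *s a + re2 ((of_real (- \<delta>) * (\<alpha> * ?\<Psi> - of_real ?s)) *s v)"
      by (simp add: conjugacy_lift_def twisted_series_shear_lift[OF \<alpha> a]) (simp add: shear_lift_def)
    moreover have "re2 ((of_real (- \<delta>) * (\<alpha> * ?\<Psi> - of_real ?s)) *s v) =
        map_matrix of_int A *v re2 ((of_real (- \<delta>) * ?\<Psi>) *s v) + (\<delta> * ?s) *s re2 v"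
      unfolding map_matrix_re2 mat_act.T_scale v(1) by (simp add: vec_eq_iff algebra_simps)
    moreover have "shear_lift A m \<delta> b (?H z) = map_matrix of_int A *v ?H z + (\<delta> * ?s) *s b"
      using dotp_conjugacy_lift[of 0 "- \<delta>" z] by (simp add: shear_lift_def)
    ultimately show ?thesis
      by (simp add: b conjugacy_lift_def mat_act.T_add vec.scale_right_distrib)
  qed
  moreover obtain z where "p = torus_proj z"
    using torus_proj_rep[of p] by metis
  ultimately show ?thesis
    unfolding shear_map_def
    by (simp add: torus_map_proj lattice_equivariant_conjugacy_lift lattice_equivariant_shear_lift)
qed

text \<open>The conjugacy preserves the numbers \<open>m A\<^sup>j z\<close>, so corresponding orbits have the same
  multipliers \<open>e\<close>.\<close>

lemma conjugacy_same_periodic_data: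
  assumes a: "shear_vector A m a" and b: "shear_vector A m b"
    and conj: "\<And>e n. (\<And>j. \<bar>e j\<bar> \<le> \<kappa>) \<Longrightarrow>
        conjugate_linear_maps (shear_cocycle A m a e n) (shear_cocycle A m b e n)"
    and \<delta>: "2 * pi * \<bar>\<delta>\<bar> \<le> \<kappa>"
  shows "same_periodic_data (shear_map A m \<delta> a) (shear_map A m \<delta> b) (torus_map (conjugacy_lift A m \<alpha> v \<delta>'))"
  unfolding same_periodic_data_def
proof (intro allI impI)
  fix p :: "'n torus" and n :: nat
  obtain z where z: "p = torus_proj z"
    using torus_proj_rep[of p] by metis
  let ?e = "\<lambda>j. 2 * pi * \<delta> * cos (2 * pi * dotp (int_vec m) (((*v) (map_matrix of_int A) ^^ j) z))"
  have "\<bar>?e j\<bar> \<le> \<kappa>" for j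
  proof -
    have "\<bar>?e j\<bar> \<le> 2 * pi * \<bar>\<delta>\<bar>"
      by (simp add: abs_mult mult_left_le)
    then show ?thesis
      using \<delta> by simp
  qed
  then have "conjugate_linear_maps (shear_cocycle A m a ?e n) (shear_cocycle A m b ?e n)"
    by (rule conj)
  then show "conjugate_linear_maps (torus_deriv (shear_map A m \<delta> a ^^ n) p)
      (torus_deriv (shear_map A m \<delta> b ^^ n) (torus_map (conjugacy_lift A m \<alpha> v \<delta>') p))"
    unfolding z torus_map_proj[OF lattice_equivariant_conjugacy_lift]
      torus_deriv_shear_map_funpow[OF a] torus_deriv_shear_map_funpow[OF b] dotp_conjugacy_lift .
qed

end

theorem theoremB:
  fixes A :: "int^'n^'n"
  assumes "hyperbolic_automorphism A"
    and "\<not> irreducible (charpoly (map_matrix rat_of_int A))"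
  shows "\<exists>\<eta>>0. \<forall>\<epsilon>>0. \<exists>f g h.
    torus_diffeo f \<and> torus_diffeo g \<and>
    torus_C1_close \<epsilon> f (toral_endo A) \<and> torus_C1_close \<epsilon> g (toral_endo A) \<and>
    the_conjugacy_near_id \<eta> f g h \<and>
    same_periodic_data f g h \<and>
    \<not> (\<exists>C. C-lipschitz_on UNIV h)"
proof -
  note A = assms(1)
  define T where "T = transpose A"
  obtain m :: "int^'n" and \<alpha> v i where res: "isospectral_resonance A m \<alpha> v"
    and distinct: "\<And>j k. j \<noteq> k \<Longrightarrow> ((*v) T ^^ j) m \<noteq> ((*v) T ^^ k) m \<and> ((*v) T ^^ j) m \<noteq> - ((*v) T ^^ k) m"
    and nonzero: "\<And>k. ((*v) T ^^ k) m \<noteq> 0"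
    and growth: "\<not> (\<lambda>k. of_int (((*v) T ^^ k) m $ i) / cmod \<alpha> ^ k) \<longlonglongrightarrow> (0::real)"
    using resonant_shears_exist[OF assms T_def] by blast
  then have \<alpha>: "1 < cmod \<alpha>" and v: "v \<noteq> 0" "map_matrix of_int A *v v = \<alpha> *s v" "dotp (int_vec m) v = 0"
    and shears: "\<And>c. \<exists>a b. b - a = re2 (c *s v) \<and> shear_vector A m a \<and> shear_vector A m b \<and> isospectral_shears A m a b"
    unfolding isospectral_resonance_def by blast+
  let ?\<Psi> = "twisted_series A m \<alpha>"
  define L where "L = (\<lambda>c. \<exists>B. \<exists>r>0. \<forall>x t. 0 < t \<and> t < r \<longrightarrow>
    norm (re2 ((?\<Psi> (x + t *s axis i 1) - ?\<Psi> x) *s (c *s v))) \<le> B * t)"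
  \<comment> \<open>If \<open>Re (\<Psi> v)\<close> and \<open>Re (\<i> \<Psi> v)\<close> are both Lipschitz, so is \<open>\<Psi>\<close>.\<close>
  have "\<not> L 1 \<or> \<not> L \<i>"
  proof (rule ccontr)
    assume "\<not> ?thesis"
    then obtain B1 r1 B2 r2 where r: "r1 > 0" "r2 > 0"
      and B1: "\<And>x t. 0 < t \<Longrightarrow> t < r1 \<Longrightarrow> norm (re2 ((?\<Psi> (x + t *s axis i 1) - ?\<Psi> x) *s (1 *s v))) \<le> B1 * t"
      and B2: "\<And>x t. 0 < t \<Longrightarrow> t < r2 \<Longrightarrow> norm (re2 ((?\<Psi> (x + t *s axis i 1) - ?\<Psi> x) *s (\<i> *s v))) \<le> B2 * t"
      unfolding L_def by blast
    obtain j where j: "v $ j \<noteq> 0"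
      using v(1) by (auto simp: vec_eq_iff)
    obtain x t where t: "0 < t" "t < min r1 r2"
      and large: "(B1 + B2) / (2 * cmod (v $ j)) * t < cmod (?\<Psi> (x + t *s axis i 1) - ?\<Psi> x)"
      using twisted_series_not_lipschitz[OF \<alpha> T_def distinct nonzero growth, of "min r1 r2"
          "(B1 + B2) / (2 * cmod (v $ j))"] r by (simp only: min_less_iff_conj) blast
    let ?D = "?\<Psi> (x + t *s axis i 1) - ?\<Psi> x"
    have re2_component: "re2 (?D *s (1 *s v)) $ j = 2 * Re (?D * v $ j)"
        "re2 (?D *s (\<i> *s v)) $ j = - (2 * Im (?D * v $ j))"
      by (simp_all add: algebra_simps)
    have "2 * \<bar>Re (?D * v $ j)\<bar> \<le> B1 * t"
      using order_trans[OF component_le_norm_cart B1[of t x], of j] t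
      unfolding re2_component by (simp only: abs_mult abs_numeral min_less_iff_conj)
    moreover have "2 * \<bar>Im (?D * v $ j)\<bar> \<le> B2 * t"
      using order_trans[OF component_le_norm_cart B2[of t x], of j] t
      unfolding re2_component by (simp only: abs_mult abs_numeral abs_minus_cancel min_less_iff_conj)
    ultimately have "2 * cmod (?D * v $ j) \<le> (B1 + B2) * t"
      using cmod_le[of "?D * v $ j"] by (simp add: distrib_right)
    then have "cmod ?D * (2 * cmod (v $ j)) \<le> (B1 + B2) * t"
      unfolding norm_mult by (simp only: mult_ac)
    moreover have "(B1 + B2) * t < cmod ?D * (2 * cmod (v $ j))"
      using large j by (simp only: times_divide_eq_left) (simp add: divide_less_eq)
    ultimately show False
      by simp
  qed
  then obtain c where c: "\<not> L c"
    by blast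
  define u where "u = c *s v"
  have u: "map_matrix of_int A *v u = \<alpha> *s u" "dotp (int_vec m) u = 0"
    by (simp_all add: u_def mat_act.T_scale v dotp_scale_right mult.commute)
  obtain a b where ab: "b - a = re2 u" "shear_vector A m a" "shear_vector A m b" "isospectral_shears A m a b"
    using shears[of c] unfolding u_def by blast
  obtain \<kappa> where \<kappa>: "\<kappa> > 0" "\<And>e n. (\<And>j. \<bar>e j\<bar> \<le> \<kappa>) \<Longrightarrow>
      conjugate_linear_maps (shear_cocycle A m a e n) (shear_cocycle A m b e n)"
    using ab(4) unfolding isospectral_shears_def by blast
  obtain ca where ca: "ca > 0" "\<And>\<delta> \<epsilon>. \<bar>\<delta>\<bar> * ca < \<epsilon> \<Longrightarrow> torus_C1_close \<epsilon> (shear_map A m \<delta> a) (toral_endo A)"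
    using shear_map_C1_close[of A m a] by blast
  obtain cb where cb: "cb > 0" "\<And>\<delta> \<epsilon>. \<bar>\<delta>\<bar> * cb < \<epsilon> \<Longrightarrow> torus_C1_close \<epsilon> (shear_map A m \<delta> b) (toral_endo A)"
    using shear_map_C1_close[of A m b] by blast
  define V where "V = (\<Sum>k. cmod (1 / \<alpha> ^ Suc k)) * (2 * (\<Sum>i\<in>UNIV. cmod (u $ i)))"
  have V: "norm (conjugacy_lift A m \<alpha> u \<delta> z - z) \<le> \<bar>\<delta>\<bar> * V" for \<delta> z
  proof -
    have "norm (conjugacy_lift A m \<alpha> u \<delta> z - z) \<le> cmod (of_real \<delta> * ?\<Psi> z) * (2 * (\<Sum>i\<in>UNIV. cmod (u $ i)))"
      unfolding conjugacy_lift_def add_diff_cancel_left' by (rule norm_re2_scale_le)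
    also have "\<dots> \<le> (\<bar>\<delta>\<bar> * (\<Sum>k. cmod (1 / \<alpha> ^ Suc k))) * (2 * (\<Sum>i\<in>UNIV. cmod (u $ i)))"
      unfolding norm_mult norm_of_real
      by (intro mult_right_mono mult_left_mono twisted_series_bound[OF \<alpha>]) (auto intro: sum_nonneg)
    finally show ?thesis
      by (simp add: V_def mult.assoc)
  qed
  have "0 \<le> norm (conjugacy_lift A m \<alpha> u 1 0 - 0)"
    by simp
  also have "\<dots> \<le> \<bar>1\<bar> * V"
    by (rule V)
  finally have V0: "V \<ge> 0"
    by simp
  obtain N where N: "N > 0" "\<And>z::real^'n. norm (map_matrix of_int A *v z) \<le> N * norm z"
    using linear_bounded_pos[OF matrix_vector_mul_linear[of "map_matrix real_of_int A"]] by blast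
  \<comment> \<open>Depends on \<open>A\<close> alone: lifts at distance \<open>2\<eta>\<close> stay within the lattice spacing after one step.\<close>
  define \<eta> where "\<eta> = 1 / (4 * (N + 2))"
  have \<eta>: "\<eta> > 0" "2 * \<eta> * (N + 2) < 1"
    using N(1) by (simp_all add: \<eta>_def field_simps)
  show ?thesis
  proof (intro exI[of _ \<eta>] conjI allI impI \<eta>(1))
    fix \<epsilon> :: real
    assume \<epsilon>: "\<epsilon> > 0"
    \<comment> \<open>\<open>\<delta> K < \<mu>\<close> makes all quantities proportional to \<open>\<delta>\<close> small at once; \<open>1 / 8\<close> leaves lifts of nearby points
      within distance \<open>1 / 2\<close>, where the metric of the torus is Euclidean.\<close>
    define K where "K = ca + cb + 2 * pi + 2 * pi * norm (int_vec m :: real^'n) * norm b + V + 1"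
    define \<mu> where "\<mu> = Min {\<epsilon>, \<kappa>, 1, \<eta>, 1 / 8}"
    have \<mu>: "\<mu> > 0" "\<mu> \<le> \<epsilon>" "\<mu> \<le> \<kappa>" "\<mu> \<le> 1" "\<mu> \<le> \<eta>" "\<mu> \<le> 1 / 8"
      using \<epsilon> \<kappa>(1) \<eta>(1) by (simp_all add: \<mu>_def)
    have K: "K > 0"
      unfolding K_def using ca(1) cb(1) V0 by (intro add_nonneg_pos add_nonneg_nonneg) auto
    define \<delta> where "\<delta> = \<mu> / (2 * K)"
    have \<delta>: "\<delta> > 0" "\<delta> * K < \<mu>"
      using \<mu>(1) K by (simp_all add: \<delta>_def field_simps)
    have small: "\<bar>\<delta>\<bar> * y < \<mu>" if "y \<le> K" for y
      using \<delta> le_less_trans[OF mult_left_mono[OF that, of \<delta>]] by simp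
    have parts: "ca \<le> K" "cb \<le> K" "2 * pi \<le> K" "2 * pi * norm (int_vec m :: real^'n) * norm b \<le> K" "V \<le> K"
      unfolding K_def using ca(1) cb(1) V0 by (auto simp: add_increasing add_increasing2)
    let ?f = "shear_map A m \<delta> a" and ?g = "shear_map A m \<delta> b"
    let ?H = "conjugacy_lift A m \<alpha> u (- \<delta>)"
    let ?h = "torus_map ?H"
    have inv: "invertible A"
      using A by (simp add: hyperbolic_automorphism_def)
    have diffeo: "torus_diffeo ?f" "torus_diffeo ?g"
      by (rule torus_diffeo_shear_map[OF inv ab(2)], rule torus_diffeo_shear_map[OF inv ab(3)])
    have H: "norm (?H z - z) < \<mu>" for z
      using V[of "- \<delta>" z] small[OF parts(5)] by simp
    have conj: "?h (?f p) = ?g (?h p)" for p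
      by (rule conjugacy_equation[OF \<alpha> u ab(1,2)])
    have proj: "?h (torus_proj z) = torus_proj (?H z)" for z
      by (rule torus_map_proj[OF lattice_equivariant_conjugacy_lift[OF \<alpha> u]])
    have near: "dist (?h p) p < \<eta>" for p
    proof -
      obtain z where z: "p = torus_proj z"
        using torus_proj_rep[of p] by metis
      have "dist (torus_proj (?H z)) (torus_proj z) \<le> norm (?H z - z)"
        using dist_torus_proj_le[of "?H z" z] by (simp add: dist_norm)
      then show ?thesis
        using H[of z] \<mu>(5) by (simp add: z proj)
    qed
    have "the_conjugacy_near_id \<eta> ?f ?g ?h"
      unfolding the_conjugacy_near_id_def
    proof (intro conjI allI impI)
      show "torus_conjugacy ?f ?g ?h"
        using conjugacy_homeomorphism[OF \<alpha> u] conj by (auto simp: torus_conjugacy_def fun_eq_iff)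
      show "dist (?h p) p < \<eta>" for p
        by (rule near)
      fix h' assume h': "torus_conjugacy ?f ?g h' \<and> (\<forall>p. dist (h' p) p < \<eta>)"
      show "h' = ?h"
      proof (rule shear_conjugacy_unique[OF A ab(3) N(2) _ \<eta>(2)])
        show "2 * pi * \<bar>\<delta>\<bar> * norm (int_vec m :: real^'n) * norm b \<le> 1"
          using small[OF parts(4)] \<mu>(4) by (simp add: mult_ac)
        show "bij ?f"
          using diffeo(1) by (simp add: torus_diffeo_def)
        show "h' (?f p) = ?g (h' p)" "dist (h' p) p < \<eta>" for p
          using h' by (auto simp: torus_conjugacy_def fun_eq_iff)
      qed (rule conj near)+
    qed
    moreover have "same_periodic_data ?f ?g ?h"
    proof (rule conjugacy_same_periodic_data[OF \<alpha> u ab(2,3) \<kappa>(2)])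
      have "2 * pi * \<bar>\<delta>\<bar> = \<bar>\<delta>\<bar> * (2 * pi)"
        by simp
      also have "\<dots> \<le> \<kappa>"
        using small[OF parts(3)] \<mu>(3) by linarith
      finally show "2 * pi * \<bar>\<delta>\<bar> \<le> \<kappa>" .
    qed
    moreover have "\<not> (\<exists>C. C-lipschitz_on UNIV ?h)"
    proof
      assume "\<exists>C. C-lipschitz_on UNIV ?h"
      then obtain C where C: "C-lipschitz_on UNIV ?h"
        by blast
      have "norm (re2 ((?\<Psi> (x + t *s axis i 1) - ?\<Psi> x) *s u)) \<le> ((C + 1) / \<delta>) * t"
        if t: "0 < t" "t < 1 / 4" for x t
      proof -
        let ?y = "x + t *s axis i 1"
        have yx: "norm (?y - x) = t"
          using t by (simp add: norm_vec_scale norm_axis_1)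
        have eq: "?H ?y - ?H x = (?y - x) + (- \<delta>) *s re2 ((?\<Psi> ?y - ?\<Psi> x) *s u)"
          by (simp add: conjugacy_lift_def vec_eq_iff algebra_simps)
        have "norm (?H ?y - ?H x) \<le> norm (?H ?y - ?y) + norm (?y - x) + norm (?H x - x)"
          by norm
        then have "norm (?H ?y - ?H x) < 1 / 2"
          using H[of ?y] H[of x] \<mu>(6) yx t(2) by simp
        then have "norm (?H ?y - ?H x) = dist (?h (torus_proj ?y)) (?h (torus_proj x))"
          by (simp add: proj dist_torus_proj_eq)
        also have "\<dots> \<le> C * dist (torus_proj ?y) (torus_proj x)"
          by (rule lipschitz_onD[OF C]) auto
        also have "\<dots> \<le> C * t"
          using dist_torus_proj_le[of ?y x] lipschitz_on_nonneg[OF C] yx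
          by (intro mult_left_mono) (simp_all add: dist_norm)
        finally have "norm ((?y - x) + (- \<delta>) *s re2 ((?\<Psi> ?y - ?\<Psi> x) *s u)) \<le> C * t"
          by (simp add: eq)
        then have "norm ((- \<delta>) *s re2 ((?\<Psi> ?y - ?\<Psi> x) *s u)) \<le> C * t + t"
          using norm_triangle_ineq4[of "(?y - x) + (- \<delta>) *s re2 ((?\<Psi> ?y - ?\<Psi> x) *s u)" "?y - x"] yx by simp
        then show ?thesis
          using \<delta>(1) by (simp add: norm_vec_scale field_simps)
      qed
      then have "L c"
        unfolding L_def u_def by (intro exI[of _ "(C + 1) / \<delta>"] exI[of _ "1 / 4"]) auto
      then show False
        using c by contradiction
    qed
    moreover have "torus_C1_close \<epsilon> ?f (toral_endo A)" "torus_C1_close \<epsilon> ?g (toral_endo A)"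
      using small[OF parts(1)] small[OF parts(2)] \<mu>(2) by (auto intro!: ca(2) cb(2))
    ultimately show "\<exists>f g h. torus_diffeo f \<and> torus_diffeo g \<and>
        torus_C1_close \<epsilon> f (toral_endo A) \<and> torus_C1_close \<epsilon> g (toral_endo A) \<and>
        the_conjugacy_near_id \<eta> f g h \<and> same_periodic_data f g h \<and> \<not> (\<exists>C. C-lipschitz_on UNIV h)"
      using diffeo by blast
  qed
qed

end
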